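(* The class $\mathit{DMS}$ of all disjunctive multiplicity schemas is learnable in polynomial time and data from positive examples, i.e., in the learning setting $(\mathit{Tree},\mathit{DMS},L)$, where the examples are unordered labeled trees and $L$ maps every schema $S$ to the set $L(S)$ of all trees satisfying $S$.
   Context: **Alphabet.** $\Sigma$ is a finite alphabet with a total order testable in constant time. The alphabet is given as part of the input, and polynomial bounds are uniform in $\Sigma$. **Unordered words.** An unordered word is a multiset of symbols, i.e., a function $w:\Sigma\to\mathbb{N}_0$. Write $W_\Sigma$ for the set of all of them, $\varepsilon$ for the empty word (all values $0$), and $a\in w$ if $w(a)\neq 0$. The size of a word is its total number of symbol occurrences. Concatenation is multiset union: $(w_1\uplus w_2)(a)=w_1(a)+w_2(a)$; for languages (sets of unordered words), $L_1\uplus L_2=\{w_1\uplus w_2\mid w_1\in L_1, w_2\in L_2\}$. The word $a^i$ consists of $i$ occurrences of $a$. **Disjunctive multiplicity expressions.** A multiplicity is an element of $\{*,+,?,0,1\}$, with $[\![*]\!]=\{0,1,2,\ldots\}$, $[\![+]\!]=\{1,2,\ldots\}$, $[\![?]\!]=\{0,1\}$, $[\![1]\!]=\{1\}$, $[\![0]\!]=\{0\}$. A disjunctive multiplicity expression is $E = D_1^{M_1}\,\|\,\ldots\,\|\,D_n^{M_n}$, where each $M_i$ is a multiplicity and each $D_i$ has the form $a_1^{M_1'}\mid\ldots\mid a_k^{M_k'}$ with $a_j\in\Sigma$ and multiplicities $M_j'$, and every symbol of $\Sigma$ occurs at most once in $E$. Its language is given by $L(a^M)=\{a^i\mid i\in[\![M]\!]\}$,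 $L(a_1^{M_1}\mid\ldots\mid a_k^{M_k})=L(a_1^{M_1})\cup\ldots\cup L(a_k^{M_k})$, $L(D^M)=\{w_1\uplus\ldots\uplus w_i\mid w_1,\ldots,w_i\in L(D),\ i\in[\![M]\!]\}$, and $L(D_1^{M_1}\,\|\,\ldots\,\|\,D_n^{M_n})=L(D_1^{M_1})\uplus\ldots\uplus L(D_n^{M_n})$. **Trees.** A tree $t=(N_t,\mathit{root}_t,\mathit{lab}_t,\mathit{child}_t)$ has a finite set of nodes $N_t$, a root $\mathit{root}_t\in N_t$, a labeling $\mathit{lab}_t:N_t\to\Sigma$, and an acyclic parent-child relation $\mathit{child}_t\subseteq N_t\times N_t$ in which every non-root node has exactly one predecessor. $\mathit{Tree}$ is the set of all finite trees; the size of a tree is its number of nodes. For $n\in N_t$, let $\mathit{ch}_t^n$ be the unordered word with $\mathit{ch}_t^n(a)=|\{m\in N_t\mid (n,m)\in\mathit{child}_t,\ \mathit{lab}_t(m)=a\}|$. **Schemas.** A disjunctive multiplicity schema (DMS) is a pair $S=(\mathit{root}_S,R_S)$ with $\mathit{root}_S\in\Sigma$ and $R_S$ mapping each symbol of $\Sigma$ to a disjunctive multiplicity expression. A tree $t$ satisfies $S$ if $\mathit{lab}_t(\mathit{root}_t)=\mathit{root}_S$ and $\mathit{ch}_t^n\in L(R_S(\mathit{lab}_t(n)))$ for every $n\in N_t$. $L(S)$ is the set of all trees satisfying $S$. **Learnability.** A learning setting is a tuple $(\mathcal{E},\mathcal{C},\mathcal{L})$ with a set $\mathcal{E}$ of examples,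 a class $\mathcal{C}$ of concepts, and a function $\mathcal{L}$ mapping each concept to a subset of $\mathcal{E}$. A sample is a finite nonempty set $D\subseteq\mathcal{E}$ (its size is the sum of the sizes of its examples); it is consistent with $c\in\mathcal{C}$ if $D\subseteq\mathcal{L}(c)$. A learning algorithm takes a sample and returns a concept in $\mathcal{C}$ or a special value null. Concepts $c,c'$ are equivalent if $\mathcal{L}(c)=\mathcal{L}(c')$. The class $\mathcal{C}$ is learnable in polynomial time and data in $(\mathcal{E},\mathcal{C},\mathcal{L})$ if there is a learning algorithm $\mathit{learner}$, running in time polynomial in the size of its input, such that: (1) Soundness: for every sample $D$, $\mathit{learner}(D)$ returns a concept consistent with $D$, or null if no such concept exists; (2) Completeness: for every $c\in\mathcal{C}$ there is a sample $\mathit{CS}_c$, whose cardinality (number of examples) is polynomially bounded by the size of $c$, such that for every sample $D$ with $\mathit{CS}_c\subseteq D\subseteq\mathcal{L}(c)$, $\mathit{learner}(D)$ returns a concept equivalent to $c$. *)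

theory Defs
  imports "HOL-Library.Multiset" "HOL-Library.FuncSet" "HOL-Computational_Algebra.Polynomial"
begin

section \<open>Unordered words and disjunctive multiplicity expressions\<close>

text \<open>An unordered word is a multiset of symbols; the empty word is \<open>{#}\<close>, concatenation is \<open>+\<close>.
  An alphabet is a finite set \<open>\<Sigma>\<close> of elements of a linearly ordered type.\<close>

datatype mult = MStar | MPlus | MOpt | MOne | MZero

fun mult_set :: "mult \<Rightarrow> nat set" where
  "mult_set MStar = UNIV"
| "mult_set MPlus = {1..}"
| "mult_set MOpt = {0, 1}"
| "mult_set MOne = {1}"
| "mult_set MZero = {0}"

text \<open>\<open>[(a\<^sub>1, M\<^sub>1), \<dots>, (a\<^sub>k, M\<^sub>k)]\<close> stands for the disjunction of the \<open>a\<^sub>j\<close> with multiplicities \<open>M\<^sub>j\<close>, and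
  \<open>[(D\<^sub>1, M\<^sub>1), \<dots>, (D\<^sub>n, M\<^sub>n)]\<close> for the unordered concatenation of the \<open>D\<^sub>i\<close> with multiplicities \<open>M\<^sub>i\<close>.\<close>

type_synonym 'a disj = "('a \<times> mult) list"
type_synonym 'a dme = "('a disj \<times> mult) list"

definition dme_symbols :: "'a dme \<Rightarrow> 'a list" where
  "dme_symbols E = map fst (concat (map fst E))"

text \<open>Both \<open>n \<ge> 1\<close> and \<open>k \<ge> 1\<close>: an empty disjunction would have the empty language.\<close>

definition dmes :: "'a set \<Rightarrow> 'a dme set" where
  "dmes \<Sigma> = {E. E \<noteq> [] \<and> (\<forall>(D, M) \<in> set E. D \<noteq> []) \<and>
                 set (dme_symbols E) \<subseteq> \<Sigma> \<and> distinct (dme_symbols E)}"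

definition symbol_lang :: "'a \<Rightarrow> mult \<Rightarrow> 'a multiset set" where
  "symbol_lang a M = {replicate_mset i a |i. i \<in> mult_set M}"

definition disj_lang :: "'a disj \<Rightarrow> 'a multiset set" where
  "disj_lang D = (\<Union>(a, M) \<in> set D. symbol_lang a M)"

definition power_lang :: "'a disj \<Rightarrow> mult \<Rightarrow> 'a multiset set" where
  "power_lang D M = {sum_list ws |ws. length ws \<in> mult_set M \<and> set ws \<subseteq> disj_lang D}"

fun dme_lang :: "'a dme \<Rightarrow> 'a multiset set" where
  "dme_lang [] = {{#}}"
| "dme_lang ((D, M) # E) = {w1 + w2 |w1 w2. w1 \<in> power_lang D M \<and> w2 \<in> dme_lang E}"

definition dme_size :: "'a dme \<Rightarrow> nat" where
  "dme_size E = (\<Sum>(D, M) \<leftarrow> E. 1 + 2 * length D)"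


section \<open>Trees and schemas\<close>

text \<open>Nodes are natural numbers; every finite node set can be renamed to a set of these.\<close>

record 'a tree =
  tree_nodes :: "nat set"
  tree_root :: nat
  tree_lab :: "nat \<Rightarrow> 'a"
  tree_child :: "(nat \<times> nat) set"

definition trees :: "'a set \<Rightarrow> 'a tree set" where
  "trees \<Sigma> = {t. finite (tree_nodes t) \<and> tree_root t \<in> tree_nodes t \<and>
      tree_lab t \<in> tree_nodes t \<rightarrow>\<^sub>E \<Sigma> \<and>
      tree_child t \<subseteq> tree_nodes t \<times> tree_nodes t \<and> acyclic (tree_child t) \<and>
      (\<forall>n \<in> tree_nodes t - {tree_root t}. \<exists>!m. (m, n) \<in> tree_child t)}"

definition tree_size :: "'a tree \<Rightarrow> nat" where
  "tree_size t = card (tree_nodes t)"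

definition child_word :: "'a tree \<Rightarrow> nat \<Rightarrow> 'a multiset" where
  "child_word t n =
     image_mset (tree_lab t) (mset_set {m \<in> tree_nodes t. (n, m) \<in> tree_child t})"

record 'a dms =
  dms_root :: 'a
  dms_rule :: "'a \<Rightarrow> 'a dme"

definition dmss :: "'a set \<Rightarrow> 'a dms set" where
  "dmss \<Sigma> = {S. dms_root S \<in> \<Sigma> \<and> dms_rule S \<in> \<Sigma> \<rightarrow>\<^sub>E dmes \<Sigma>}"

definition satisfies :: "'a tree \<Rightarrow> 'a dms \<Rightarrow> bool" where
  "satisfies t S \<longleftrightarrow> tree_lab t (tree_root t) = dms_root S \<and>
     (\<forall>n \<in> tree_nodes t. child_word t n \<in> dme_lang (dms_rule S (tree_lab t n)))"

definition dms_lang :: "'a set \<Rightarrow> 'a dms \<Rightarrow> 'a tree set" where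
  "dms_lang \<Sigma> S = {t \<in> trees \<Sigma>. satisfies t S}"

definition dms_size :: "'a set \<Rightarrow> 'a dms \<Rightarrow> nat" where
  "dms_size \<Sigma> S = 1 + (\<Sum>a \<in> \<Sigma>. 1 + dme_size (dms_rule S a))"


section \<open>A machine model\<close>

text \<open>Algorithms are programs of a first-order recursive language over binary trees whose leaves
  are symbols or nil. Symbols are opaque: they can be moved around and compared by their
  order, but a program contains no symbol constants, so the same program serves all alphabets.
  Each evaluation step is a constant-time operation on a pointer machine with shared
  immutable cells and costs one unit; in particular only single symbols are compared, never compound
  values. There is no arithmetic.\<close>

datatype 'a val = VNil | VSym 'a | VPair "'a val" "'a val"

datatype expr =
    EVar nat
  | ENil
  | EPair expr expr
  | EFst expr
  | ESnd expr
  | ELess expr expr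
  | EIf expr expr expr
  | ELet expr expr
  | ECall nat "expr list"

fun val_fst :: "'a val \<Rightarrow> 'a val" where
  "val_fst (VPair u v) = u"
| "val_fst _ = VNil"

fun val_snd :: "'a val \<Rightarrow> 'a val" where
  "val_snd (VPair u v) = v"
| "val_snd _ = VNil"

fun val_less :: "'a::linorder val \<Rightarrow> 'a val \<Rightarrow> 'a val" where
  "val_less (VSym a) (VSym b) = (if a < b then VPair VNil VNil else VNil)"
| "val_less _ _ = VNil"

text \<open>A program is a list of function bodies. \<open>eval P env e v k\<close>: in environment \<open>env\<close> (variables are
  de Bruijn indices, \<open>ELet\<close> binds index 0) the expression \<open>e\<close> evaluates to \<open>v\<close> in \<open>k\<close> steps.
  \<open>VNil\<close> is false, every other value is true.\<close>

inductive eval :: "expr list \<Rightarrow> 'a::linorder val list \<Rightarrow> expr \<Rightarrow> 'a val \<Rightarrow> nat \<Rightarrow> bool"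
  and evals :: "expr list \<Rightarrow> 'a::linorder val list \<Rightarrow> expr list \<Rightarrow> 'a val list \<Rightarrow> nat \<Rightarrow> bool"
  for P :: "expr list" where
  EVar: "i < length env \<Longrightarrow> eval P env (EVar i) (env ! i) 1"
| ENil: "eval P env ENil VNil 1"
| EPair: "eval P env e1 u k1 \<Longrightarrow> eval P env e2 v k2 \<Longrightarrow>
    eval P env (EPair e1 e2) (VPair u v) (k1 + k2 + 1)"
| EFst: "eval P env e v k \<Longrightarrow> eval P env (EFst e) (val_fst v) (k + 1)"
| ESnd: "eval P env e v k \<Longrightarrow> eval P env (ESnd e) (val_snd v) (k + 1)"
| ELess: "eval P env e1 u k1 \<Longrightarrow> eval P env e2 v k2 \<Longrightarrow>
    eval P env (ELess e1 e2) (val_less u v) (k1 + k2 + 1)"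
| EIf_true: "eval P env e u k1 \<Longrightarrow> u \<noteq> VNil \<Longrightarrow> eval P env e1 v k2 \<Longrightarrow>
    eval P env (EIf e e1 e2) v (k1 + k2 + 1)"
| EIf_false: "eval P env e VNil k1 \<Longrightarrow> eval P env e2 v k2 \<Longrightarrow>
    eval P env (EIf e e1 e2) v (k1 + k2 + 1)"
| ELet: "eval P env e1 u k1 \<Longrightarrow> eval P (u # env) e2 v k2 \<Longrightarrow>
    eval P env (ELet e1 e2) v (k1 + k2 + 1)"
| ECall: "evals P env es us k1 \<Longrightarrow> f < length P \<Longrightarrow> eval P us (P ! f) v k2 \<Longrightarrow>
    eval P env (ECall f es) v (k1 + k2 + 1)"
| Nil: "evals P env [] [] 0"
| Cons: "eval P env e v k1 \<Longrightarrow> evals P env es vs k2 \<Longrightarrow>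
    evals P env (e # es) (v # vs) (k1 + k2)"

definition run :: "expr list \<Rightarrow> 'a::linorder val list \<Rightarrow> 'a val \<Rightarrow> nat \<Rightarrow> bool" where
  "run P args v k \<longleftrightarrow> P \<noteq> [] \<and> eval P args (P ! 0) v k"

inductive_cases evalE:
  "eval P env (EVar i) v k" "eval P env ENil v k" "eval P env (EPair e1 e2) v k"
  "eval P env (EFst e) v k" "eval P env (ESnd e) v k" "eval P env (ELess e1 e2) v k"
  "eval P env (EIf e e1 e2) v k" "eval P env (ELet e1 e2) v k" "eval P env (ECall f es) v k"
inductive_cases evalsE: "evals P env [] vs k" "evals P env (e # es) vs k"

lemma eval_deterministic_aux:
  "eval P env e v k \<Longrightarrow> (\<And>v' k'. eval P env e v' k' \<Longrightarrow> v' = v \<and> k' = k)"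
  "evals P env es vs k \<Longrightarrow> (\<And>vs' k'. evals P env es vs' k' \<Longrightarrow> vs' = vs \<and> k' = k)"
proof (induction rule: eval_evals.inducts)
  case EVar
  from EVar.prems show ?case by (rule evalE(1)) simp
next
  case ENil
  from ENil.prems show ?case by (rule evalE(2)) simp
next
  case EPair
  from EPair.prems show ?case by (rule evalE(3)) (auto dest!: EPair.IH(2,4))
next
  case EFst
  from EFst.prems show ?case by (rule evalE(4)) (auto dest!: EFst.IH(2))
next
  case ESnd
  from ESnd.prems show ?case by (rule evalE(5)) (auto dest!: ESnd.IH(2))
next
  case ELess
  from ELess.prems show ?case by (rule evalE(6)) (auto dest!: ELess.IH(2,4))
next
  case (EIf_true env e u k1 e1 v k2 e2)
  from EIf_true.prems show ?case
    by (rule evalE(7)) (use \<open>u \<noteq> VNil\<close> in \<open>auto dest!: EIf_true.IH(2,4)\<close>)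
next
  case EIf_false
  from EIf_false.prems show ?case by (rule evalE(7)) (auto dest!: EIf_false.IH(2,4))
next
  case ELet
  from ELet.prems show ?case by (rule evalE(8)) (auto dest!: ELet.IH(2,4))
next
  case ECall
  from ECall.prems show ?case by (rule evalE(9)) (auto dest!: ECall.IH(2,5))
next
  case Nil
  from Nil.prems show ?case by (rule evalsE(1)) simp
next
  case Cons
  from Cons.prems show ?case by (rule evalsE(2)) (auto dest!: Cons.IH(2,4))
qed

lemma run_deterministic: "run P args v k \<Longrightarrow> run P args v' k' \<Longrightarrow> v' = v \<and> k' = k"
  unfolding run_def by (metis eval_deterministic_aux(1))


section \<open>Encodings\<close>

text \<open>Sets have no canonical listing and trees are unordered, so their encodings are relations:
  an object is represented by each listing of its parts.\<close>

fun enc_list :: "'a val list \<Rightarrow> 'a val" where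
  "enc_list [] = VNil"
| "enc_list (v # vs) = VPair v (enc_list vs)"

definition enc_alphabet :: "'a set \<Rightarrow> 'a val \<Rightarrow> bool" where
  "enc_alphabet \<Sigma> v \<longleftrightarrow> (\<exists>xs. distinct xs \<and> set xs = \<Sigma> \<and> v = enc_list (map VSym xs))"

inductive enc_node :: "'a tree \<Rightarrow> nat \<Rightarrow> 'a val \<Rightarrow> bool" for t :: "'a tree" where
  "distinct ms \<Longrightarrow> set ms = {m. (n, m) \<in> tree_child t} \<Longrightarrow> list_all2 (enc_node t) ms vs \<Longrightarrow>
    enc_node t n (VPair (VSym (tree_lab t n)) (enc_list vs))"

definition enc_tree :: "'a tree \<Rightarrow> 'a val \<Rightarrow> bool" where
  "enc_tree t v \<longleftrightarrow> enc_node t (tree_root t) v"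

lemma enc_tree_exists:
  assumes "t \<in> trees \<Sigma>"
  shows "\<exists>v. enc_tree t v"
proof -
  have fin: "finite (tree_child t)" and acyc: "acyclic (tree_child t)"
    using assms finite_subset[of "tree_child t" "tree_nodes t \<times> tree_nodes t"]
    unfolding trees_def by simp_all
  have "wf ((tree_child t)\<inverse>)"
    using fin acyc by (rule finite_acyclic_wf_converse)
  then have "\<exists>v. enc_node t n v" for n
  proof (induction n rule: wf_induct_rule)
    case (less n)
    have "{m. (n, m) \<in> tree_child t} \<subseteq> snd ` tree_child t" by force
    then have "finite {m. (n, m) \<in> tree_child t}" using fin by (blast intro: finite_subset)
    then obtain ms where ms: "set ms = {m. (n, m) \<in> tree_child t}" "distinct ms"
      using finite_distinct_list by blast
    have "\<forall>m \<in> set ms. \<exists>v. enc_node t m v" using less ms by auto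
    then obtain f where "\<forall>m \<in> set ms. enc_node t m (f m)" by metis
    then have "list_all2 (enc_node t) ms (map f ms)"
      by (simp add: list_all2_conv_all_nth)
    then show ?case using ms enc_node.intros by blast
  qed
  then show ?thesis by (simp add: enc_tree_def)
qed

definition enc_sample :: "('e \<Rightarrow> 'a val \<Rightarrow> bool) \<Rightarrow> 'e set \<Rightarrow> 'a val \<Rightarrow> bool" where
  "enc_sample enc D v \<longleftrightarrow>
     (\<exists>es vs. distinct es \<and> set es = D \<and> list_all2 enc es vs \<and> v = enc_list vs)"

fun enc_mult :: "mult \<Rightarrow> 'a val" where
  "enc_mult MZero = enc_list []"
| "enc_mult MOne = enc_list [VNil]"
| "enc_mult MOpt = enc_list [VNil, VNil]"
| "enc_mult MPlus = enc_list [VNil, VNil, VNil]"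
| "enc_mult MStar = enc_list [VNil, VNil, VNil, VNil]"

definition enc_disj :: "'a disj \<Rightarrow> 'a val" where
  "enc_disj D = enc_list (map (\<lambda>(a, M). VPair (VSym a) (enc_mult M)) D)"

definition enc_dme :: "'a dme \<Rightarrow> 'a val" where
  "enc_dme E = enc_list (map (\<lambda>(D, M). VPair (enc_disj D) (enc_mult M)) E)"

definition enc_dms :: "'a set \<Rightarrow> 'a dms \<Rightarrow> 'a val \<Rightarrow> bool" where
  "enc_dms \<Sigma> S v \<longleftrightarrow> (\<exists>xs. distinct xs \<and> set xs = \<Sigma> \<and>
     v = VPair (VSym (dms_root S))
               (enc_list (map (\<lambda>a. VPair (VSym a) (enc_dme (dms_rule S a))) xs)))"

text \<open>The value \<open>None\<close> plays the role of null.\<close>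

fun enc_result :: "('c \<Rightarrow> 'a val \<Rightarrow> bool) \<Rightarrow> 'c option \<Rightarrow> 'a val \<Rightarrow> bool" where
  "enc_result enc None v \<longleftrightarrow> v = VNil"
| "enc_result enc (Some c) v \<longleftrightarrow> (\<exists>u. enc c u \<and> v = VPair u VNil)"


section \<open>Learnability in polynomial time and data\<close>

text \<open>A learning setting is given as a family indexed by the alphabet, together with the size measures
  and the encodings that the complexity bounds refer to.\<close>

record ('a, 'e, 'c) learning_setting =
  examples :: "'a set \<Rightarrow> 'e set"
  concepts :: "'a set \<Rightarrow> 'c set"
  language :: "'a set \<Rightarrow> 'c \<Rightarrow> 'e set"
  example_size :: "'e \<Rightarrow> nat"
  concept_size :: "'a set \<Rightarrow> 'c \<Rightarrow> nat"
  example_enc :: "'e \<Rightarrow> 'a val \<Rightarrow> bool"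
  concept_enc :: "'a set \<Rightarrow> 'c \<Rightarrow> 'a val \<Rightarrow> bool"

definition is_sample :: "('a, 'e, 'c) learning_setting \<Rightarrow> 'a set \<Rightarrow> 'e set \<Rightarrow> bool" where
  "is_sample LS \<Sigma> D \<longleftrightarrow> finite D \<and> D \<noteq> {} \<and> D \<subseteq> examples LS \<Sigma>"

definition sample_size :: "('a, 'e, 'c) learning_setting \<Rightarrow> 'e set \<Rightarrow> nat" where
  "sample_size LS D = (\<Sum>e \<in> D. example_size LS e)"

definition consistent ::
  "('a, 'e, 'c) learning_setting \<Rightarrow> 'a set \<Rightarrow> 'e set \<Rightarrow> 'c \<Rightarrow> bool" where
  "consistent LS \<Sigma> D c \<longleftrightarrow> D \<subseteq> language LS \<Sigma> c"

definition poly_time_learner ::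
  "('a::linorder, 'e, 'c) learning_setting \<Rightarrow> ('a set \<Rightarrow> 'e set \<Rightarrow> 'c option) \<Rightarrow> bool" where
  "poly_time_learner LS learner \<longleftrightarrow>
     (\<exists>P (p :: nat poly). \<forall>\<Sigma> D x y.
        finite \<Sigma> \<and> is_sample LS \<Sigma> D \<and> enc_alphabet \<Sigma> x \<and> enc_sample (example_enc LS) D y \<longrightarrow>
        (\<exists>v k. run P [x, y] v k \<and>
               k \<le> poly p (card \<Sigma> + sample_size LS D) \<and>
               enc_result (concept_enc LS \<Sigma>) (learner \<Sigma> D) v))"

definition sound_learner ::
  "('a, 'e, 'c) learning_setting \<Rightarrow> ('a set \<Rightarrow> 'e set \<Rightarrow> 'c option) \<Rightarrow> bool" where
  "sound_learner LS learner \<longleftrightarrow>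
     (\<forall>\<Sigma> D. finite \<Sigma> \<and> is_sample LS \<Sigma> D \<longrightarrow>
        (case learner \<Sigma> D of
           Some c \<Rightarrow> c \<in> concepts LS \<Sigma> \<and> consistent LS \<Sigma> D c
         | None \<Rightarrow> \<not> (\<exists>c \<in> concepts LS \<Sigma>. consistent LS \<Sigma> D c)))"

text \<open>The characteristic sample \<open>CS\<close> has to be consistent with \<open>c\<close>, otherwise the last conjunct would be
  vacuous. The only exception are concepts with empty language, which no (nonempty) sample is
  consistent with.\<close>

definition complete_learner ::
  "('a, 'e, 'c) learning_setting \<Rightarrow> ('a set \<Rightarrow> 'e set \<Rightarrow> 'c option) \<Rightarrow> bool" where
  "complete_learner LS learner \<longleftrightarrow>
     (\<exists>q :: nat poly. \<forall>\<Sigma>. finite \<Sigma> \<longrightarrow> (\<forall>c \<in> concepts LS \<Sigma>.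
        \<exists>CS. is_sample LS \<Sigma> CS \<and> (language LS \<Sigma> c \<noteq> {} \<longrightarrow> consistent LS \<Sigma> CS c) \<and>
             card CS \<le> poly q (concept_size LS \<Sigma> c) \<and>
             (\<forall>D. is_sample LS \<Sigma> D \<and> CS \<subseteq> D \<and> D \<subseteq> language LS \<Sigma> c \<longrightarrow>
                (\<exists>c' \<in> concepts LS \<Sigma>.
                   learner \<Sigma> D = Some c' \<and> language LS \<Sigma> c' = language LS \<Sigma> c))))"

definition learnable_in_poly_time_and_data ::
  "('a::linorder, 'e, 'c) learning_setting \<Rightarrow> bool" where
  "learnable_in_poly_time_and_data LS \<longleftrightarrow>
     (\<exists>learner. poly_time_learner LS learner \<and> sound_learner LS learner \<and>
                complete_learner LS learner)"

definition dms_setting :: "('a, 'a tree, 'a dms) learning_setting" where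
  "dms_setting =
     \<lparr>examples = trees, concepts = dmss, language = dms_lang,
      example_size = tree_size, concept_size = dms_size,
      example_enc = enc_tree, concept_enc = enc_dms\<rparr>"

end

theory Submission
  imports Defs "HOL-Library.Nat_Bijection"
begin

text \<open>
  Restricted to the symbols that can occur in trees, the language of an expression is given by
  conflict classes (at most one symbol of the class occurs), required sets (at least one symbol
  occurs) and symbols that occur at most once. Cooccurrence of pairs of symbols in the sample
  reveals the conflict classes, and with them the required ones among them. The remaining required
  sets, the blocks coming from factors \<open>(a | b | \<dots>)\<^sup>+\<close>, are harder, because there are
  exponentially many candidates. They are read off words that contain all conflict-free symbols
  except those of \<open>A - {a}\<close>, where \<open>a \<in> A\<close> and \<open>A\<close> is a block; the resulting candidates are
  accepted by increasing size, provided that they meet every word of the sample and no smaller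
  accepted set. A false candidate \<open>R\<close> of size \<open>m\<close> can then only meet blocks of size at least \<open>m\<close>,
  so that a counting argument over the transversals \<open>t \<mapsto> (t mod |A|)\<close>-th element of each block,
  \<open>t < n\<^sup>2\<close>, yields a word of the characteristic sample that avoids \<open>R\<close>. The characteristic sample
  of a schema realizes these words at the nodes of trees of the schema.

  The program is never written down: the functions that some program computes in polynomial time
  are closed under composition and under recursion on lists with results of polynomial size.
\<close>

section \<open>Polynomial-time computability\<close>

text \<open>The characteristic words must be fixed in advance, although further words of the sample
  may propose any of exponentially many false sets \<open>R\<close>. Transversals by residues
  derandomize the choice of one element per block: polynomially many words contain, for each such
  \<open>R\<close>, one that avoids it.

  Soundness concerns arbitrary samples, in which conflict need not be transitive and accepted sets
  may overlap. The learner therefore groups symbols by equality of their conflict sets or of their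
  memberships, which always gives a partition; that these groups are the true ones is claimed only
  over a characteristic sample.

  On a machine with shared cells, k steps can build a value of size exponential in k, so a time
  bound for one function says nothing about the size of the input to the next. For this reason
  \<open>poly_time\<close> demands a size bound for results besides the time bound, and every
  recursion comes with its own proof that results stay small.\<close>

fun vsize :: "'a val \<Rightarrow> nat" where
  "vsize VNil = 1"
| "vsize (VSym a) = 3"
| "vsize (VPair u v) = 1 + vsize u + vsize v"

definition env_size :: "'a val list \<Rightarrow> nat" where
  "env_size env = sum_list (map vsize env)"

lemma env_size_simps [simp]:
  "env_size [] = 0" "env_size (v # env) = vsize v + env_size env"
  by (simp_all add: env_size_def)

text \<open>The base is at least 2 even where \<open>M s\<close> vanishes, so constants, sums and
  factors are absorbed by raising the single exponent \<open>d\<close>.\<close>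

definition poly_bounded :: "('s \<Rightarrow> nat) \<Rightarrow> ('s \<Rightarrow> nat) \<Rightarrow> bool" where
  "poly_bounded M k \<longleftrightarrow> (\<exists>d. \<forall>s. k s \<le> (M s + 2) ^ d)"

lemma poly_boundedI: "(\<And>s. k s \<le> (M s + 2) ^ d) \<Longrightarrow> poly_bounded M k"
  unfolding poly_bounded_def by blast

lemma poly_bounded_const: "poly_bounded M (\<lambda>s. c)"
proof (rule poly_boundedI)
  fix s
  have "c \<le> 2 ^ c" by (simp add: less_imp_le)
  also have "\<dots> \<le> (M s + 2) ^ c" by (simp add: power_mono)
  finally show "c \<le> (M s + 2) ^ c" .
qed

lemma poly_bounded_self: "poly_bounded M M"
  by (rule poly_boundedI[where d = 1]) simp

lemma poly_bounded_le: "poly_bounded M k \<Longrightarrow> (\<And>s. j s \<le> k s) \<Longrightarrow> poly_bounded M j"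
  unfolding poly_bounded_def by (meson le_trans)

lemma poly_bounded_add:
  assumes "poly_bounded M j" "poly_bounded M k"
  shows "poly_bounded M (\<lambda>s. j s + k s)"
proof -
  obtain d1 d2 where d: "\<And>s. j s \<le> (M s + 2) ^ d1" "\<And>s. k s \<le> (M s + 2) ^ d2"
    using assms unfolding poly_bounded_def by blast
  show ?thesis
  proof (rule poly_boundedI)
    fix s
    let ?d = "max d1 d2"
    have "j s \<le> (M s + 2) ^ ?d" "k s \<le> (M s + 2) ^ ?d"
      using d[of s] power_increasing[of d1 ?d "M s + 2"] power_increasing[of d2 ?d "M s + 2"]
      by linarith+
    then have "j s + k s \<le> 2 * (M s + 2) ^ ?d" by linarith
    also have "\<dots> \<le> (M s + 2) ^ Suc ?d" by simp
    finally show "j s + k s \<le> (M s + 2) ^ Suc ?d" .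
  qed
qed

lemma poly_bounded_mult:
  assumes "poly_bounded M j" "poly_bounded M k"
  shows "poly_bounded M (\<lambda>s. j s * k s)"
proof -
  obtain d1 d2 where d: "\<And>s. j s \<le> (M s + 2) ^ d1" "\<And>s. k s \<le> (M s + 2) ^ d2"
    using assms unfolding poly_bounded_def by blast
  show ?thesis
    by (rule poly_boundedI[where d = "d1 + d2"]) (unfold power_add, intro mult_le_mono d)
qed

lemma poly_bounded_trans:
  assumes "poly_bounded k j" "poly_bounded M k"
  shows "poly_bounded M j"
proof -
  obtain d1 d2 where d: "\<And>s. j s \<le> (k s + 2) ^ d1" "\<And>s. k s \<le> (M s + 2) ^ d2"
    using assms unfolding poly_bounded_def by blast
  show ?thesis
  proof (rule poly_boundedI)
    fix s
    have "(k s + 2) \<le> (M s + 2) ^ d2 + 2" using d by simp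
    also have "\<dots> \<le> (M s + 2) ^ (d2 + 2)"
    proof -
      have "(M s + 2) ^ d2 \<ge> 1" by simp
      then have "(M s + 2) ^ d2 + 2 \<le> (M s + 2) ^ d2 * 4" by linarith
      also have "\<dots> \<le> (M s + 2) ^ d2 * (M s + 2) ^ 2"
        using power_mono[of 2 "M s + 2" 2] by (intro mult_le_mono) simp_all
      finally show ?thesis unfolding power_add .
    qed
    finally have "(k s + 2) ^ d1 \<le> ((M s + 2) ^ (d2 + 2)) ^ d1" by (rule power_mono) simp
    then show "j s \<le> (M s + 2) ^ ((d2 + 2) * d1)"
      unfolding power_mult using d(1)[of s] le_trans by blast
  qed
qed

lemma poly_bounded_comp: "poly_bounded M k \<Longrightarrow> poly_bounded (\<lambda>t. M (g t)) (\<lambda>t. k (g t))"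
  unfolding poly_bounded_def by blast

lemma poly_bounded_Suc: "poly_bounded M k \<Longrightarrow> poly_bounded M (\<lambda>s. Suc (k s))"
  using poly_bounded_add[OF _ poly_bounded_const[of M 1]] by simp

lemmas poly_bounded_intros = poly_bounded_Suc poly_bounded_add poly_bounded_mult poly_bounded_const

section \<open>Joining programs\<close>

fun shift :: "nat \<Rightarrow> expr \<Rightarrow> expr" where
  "shift n (EVar i) = EVar i"
| "shift n ENil = ENil"
| "shift n (EPair a b) = EPair (shift n a) (shift n b)"
| "shift n (EFst a) = EFst (shift n a)"
| "shift n (ESnd a) = ESnd (shift n a)"
| "shift n (ELess a b) = ELess (shift n a) (shift n b)"
| "shift n (EIf a b c) = EIf (shift n a) (shift n b) (shift n c)"
| "shift n (ELet a b) = ELet (shift n a) (shift n b)"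
| "shift n (ECall f es) = ECall (n + f) (map (shift n) es)"

lemma eval_append:
  "eval P env e v k \<Longrightarrow> eval (P @ Q) env e v k"
  "evals P env es vs k \<Longrightarrow> evals (P @ Q) env es vs k"
  by (induction rule: eval_evals.inducts)
     (rule eval_evals.intros; (assumption | simp add: nth_append))+

lemma eval_shift:
  "eval P env e v k \<Longrightarrow> eval (Q @ map (shift (length Q)) P) env (shift (length Q) e) v k"
  "evals P env es vs k \<Longrightarrow>
    evals (Q @ map (shift (length Q)) P) env (map (shift (length Q)) es) vs k"
  by (induction rule: eval_evals.inducts)
     (unfold shift.simps list.map, (rule eval_evals.intros; (assumption | simp add: nth_append))+)

text \<open>Appending one program to another renumbers the calls of the second, which changes its
  expressions. The translation \<open>\<phi>\<close> is uniform in the environment, and values and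
  costs are kept exactly, so a computed function carries over with the same time bound.\<close>

definition simulates :: "'a::linorder itself \<Rightarrow> expr list \<Rightarrow> expr list \<Rightarrow> bool" where
  "simulates TYPE('a) P P' \<longleftrightarrow> (\<exists>\<phi>. \<forall>env :: 'a val list.
     (\<forall>e v k. eval P env e v k \<longrightarrow> eval P' env (\<phi> e) v k) \<and>
     (\<forall>es vs k. evals P env es vs k \<longrightarrow> evals P' env (map \<phi> es) vs k))"

lemma simulates_append: "simulates TYPE('a::linorder) P (P @ Q)"
  unfolding simulates_def by (rule exI[of _ id]) (simp add: eval_append)

lemma simulates_shift: "simulates TYPE('a::linorder) Q (P @ map (shift (length P)) Q)"
  unfolding simulates_def by (rule exI[of _ "shift (length P)"]) (simp add: eval_shift)

text \<open>The program serves as a library for an open expression \<open>e\<close>. Expressions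
  over the same library can be nested freely, so combining functions reduces to merging their
  libraries.\<close>

definition computes :: "expr list \<Rightarrow> ('s \<Rightarrow> 'a::linorder val list) \<Rightarrow> ('s \<Rightarrow> 'a val) \<Rightarrow> bool" where
  "computes P \<rho> f \<longleftrightarrow> (\<exists>e T. (\<forall>s. eval P (\<rho> s) e (f s) (T s)) \<and>
     poly_bounded (\<lambda>s. env_size (\<rho> s)) T)"

definition computes_all ::
  "expr list \<Rightarrow> ('s \<Rightarrow> 'a::linorder val list) \<Rightarrow> ('s \<Rightarrow> 'a val list) \<Rightarrow> bool" where
  "computes_all P \<rho> f \<longleftrightarrow> (\<exists>es T. (\<forall>s. evals P (\<rho> s) es (f s) (T s)) \<and>
     poly_bounded (\<lambda>s. env_size (\<rho> s)) T)"

text \<open>A situation \<open>s\<close> fixes the environment \<open>\<rho> s\<close> and the required value \<open>f s\<close>. A let-bound or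
  recursively computed value thus simply becomes a further entry of the environment.\<close>

definition poly_time :: "('s \<Rightarrow> 'a::linorder val list) \<Rightarrow> ('s \<Rightarrow> 'a val) \<Rightarrow> bool" where
  "poly_time \<rho> f \<longleftrightarrow> (\<exists>n. \<forall>s. length (\<rho> s) = n) \<and> (\<exists>P. computes P \<rho> f) \<and>
     poly_bounded (\<lambda>s. env_size (\<rho> s)) (\<lambda>s. vsize (f s))"

definition poly_times :: "('s \<Rightarrow> 'a::linorder val list) \<Rightarrow> ('s \<Rightarrow> 'a val list) \<Rightarrow> bool" where
  "poly_times \<rho> f \<longleftrightarrow> (\<exists>n. \<forall>s. length (\<rho> s) = n) \<and> (\<exists>P. computes_all P \<rho> f) \<and>
     poly_bounded (\<lambda>s. env_size (\<rho> s)) (\<lambda>s. env_size (f s))"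

lemma computes_simulates:
  fixes \<rho> :: "'s \<Rightarrow> 'a::linorder val list"
  shows "computes P \<rho> f \<Longrightarrow> simulates TYPE('a) P P' \<Longrightarrow> computes P' \<rho> f"
    "computes_all P \<rho> F \<Longrightarrow> simulates TYPE('a) P P' \<Longrightarrow> computes_all P' \<rho> F"
  unfolding simulates_def computes_def computes_all_def by blast+

lemma common_program:
  "\<exists>P'. simulates TYPE('a::linorder) P P' \<and> simulates TYPE('a) Q P'"
  using simulates_append simulates_shift by blast

lemma computesI:
  "(\<And>s. eval P (\<rho> s) e (f s) (T s)) \<Longrightarrow> poly_bounded (\<lambda>s. env_size (\<rho> s)) T \<Longrightarrow> computes P \<rho> f"
  unfolding computes_def by blast

lemma computesE:
  assumes "computes P \<rho> f"
  obtains e T where "\<And>s. eval P (\<rho> s) e (f s) (T s)" "poly_bounded (\<lambda>s. env_size (\<rho> s)) T"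
  using assms unfolding computes_def by blast

lemma computes_allE:
  assumes "computes_all P \<rho> f"
  obtains es T where "\<And>s. evals P (\<rho> s) es (f s) (T s)" "poly_bounded (\<lambda>s. env_size (\<rho> s)) T"
  using assms unfolding computes_all_def by blast

lemma poly_time_arity: "poly_time \<rho> f \<Longrightarrow> \<exists>n. \<forall>s. length (\<rho> s) = n"
  by (simp add: poly_time_def)

lemma poly_time2E:
  fixes \<rho>1 :: "'s \<Rightarrow> 'a::linorder val list" and \<rho>2 :: "'t \<Rightarrow> 'a::linorder val list"
  assumes "poly_time \<rho>1 f" "poly_time \<rho>2 g"
  obtains P where "computes P \<rho>1 f" "computes P \<rho>2 g"
  using assms common_program computes_simulates(1) unfolding poly_time_def by metis

section \<open>Closure under the constructs of the language\<close>

lemma poly_time_nil: "\<exists>n. \<forall>s. length (\<rho> s) = n \<Longrightarrow> poly_time \<rho> (\<lambda>s. VNil)"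
  unfolding poly_time_def
  by (auto intro!: computesI eval_evals.intros poly_bounded_const)

lemma poly_time_var:
  assumes "\<And>s. length (\<rho> s) = n" "i < n"
  shows "poly_time \<rho> (\<lambda>s. \<rho> s ! i)"
proof -
  have "vsize (\<rho> s ! i) \<le> env_size (\<rho> s)" for s
    using assms by (simp add: env_size_def member_le_sum_list)
  then show ?thesis
    unfolding poly_time_def
    using assms by (auto intro!: computesI[where e = "EVar i" and T = "\<lambda>_. 1"] eval_evals.intros poly_bounded_const
        intro: poly_bounded_le[OF poly_bounded_self])
qed

lemma poly_time_hd:
  assumes "\<exists>n. \<forall>s. length (\<rho> s) = n"
  shows "poly_time (\<lambda>s. v s # \<rho> s) v"
proof -
  obtain n where "\<And>s. length (\<rho> s) = n" using assms by blast
  then show ?thesis using poly_time_var[of "\<lambda>s. v s # \<rho> s" "Suc n" 0] by simp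
qed

lemma poly_time_pair:
  assumes "poly_time \<rho> f" "poly_time \<rho> g"
  shows "poly_time \<rho> (\<lambda>s. VPair (f s) (g s))"
proof -
  obtain P where "computes P \<rho> f" "computes P \<rho> g" using poly_time2E[OF assms] .
  then have "computes P \<rho> (\<lambda>s. VPair (f s) (g s))"
    by (elim computesE) (rule computesI, rule eval_evals.EPair, auto intro!: poly_bounded_intros)
  then show ?thesis using assms unfolding poly_time_def
    by (auto intro!: poly_bounded_intros)
qed

lemma vsize_pos [simp]: "vsize v > 0" by (cases v) simp_all
lemma vsize_ge_1 [simp]: "Suc 0 \<le> vsize v" by (cases v) simp_all

lemma vsize_fst_le: "vsize (val_fst v) \<le> vsize v" and vsize_snd_le: "vsize (val_snd v) \<le> vsize v"
  by (cases v; simp)+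

lemma poly_time_fst:
  assumes "poly_time \<rho> f"
  shows "poly_time \<rho> (\<lambda>s. val_fst (f s))"
proof -
  obtain P where "computes P \<rho> f" using assms by (auto simp: poly_time_def)
  then have "computes P \<rho> (\<lambda>s. val_fst (f s))"
    by (elim computesE) (rule computesI, rule eval_evals.EFst, auto intro!: poly_bounded_intros)
  then show ?thesis using assms unfolding poly_time_def
    by (auto intro: poly_bounded_le simp: vsize_fst_le)
qed

lemma poly_time_snd:
  assumes "poly_time \<rho> f"
  shows "poly_time \<rho> (\<lambda>s. val_snd (f s))"
proof -
  obtain P where "computes P \<rho> f" using assms by (auto simp: poly_time_def)
  then have "computes P \<rho> (\<lambda>s. val_snd (f s))"
    by (elim computesE) (rule computesI, rule eval_evals.ESnd, auto intro!: poly_bounded_intros)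
  then show ?thesis using assms unfolding poly_time_def
    by (auto intro: poly_bounded_le simp: vsize_snd_le)
qed

definition bool_val :: "bool \<Rightarrow> 'a val" where
  "bool_val b = (if b then VPair VNil VNil else VNil)"

lemma vsize_bool_val: "vsize (bool_val b) \<le> 3"
  by (simp add: bool_val_def)

lemma bool_val_eq_nil [simp]: "bool_val b = VNil \<longleftrightarrow> \<not> b"
  by (simp add: bool_val_def)

lemma poly_time_less:
  assumes "poly_time \<rho> (\<lambda>s. VSym (a s))" "poly_time \<rho> (\<lambda>s. VSym (b s))"
  shows "poly_time \<rho> (\<lambda>s. bool_val (a s < b s))"
proof -
  obtain P where "computes P \<rho> (\<lambda>s. VSym (a s))" "computes P \<rho> (\<lambda>s. VSym (b s))"
    using poly_time2E[OF assms] .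
  then have "computes P \<rho> (\<lambda>s. val_less (VSym (a s)) (VSym (b s)))"
    by (elim computesE) (rule computesI, rule eval_evals.ELess, auto intro!: poly_bounded_intros)
  moreover have "(\<lambda>s. val_less (VSym (a s)) (VSym (b s))) = (\<lambda>s. bool_val (a s < b s))"
    by (auto simp: bool_val_def)
  ultimately show ?thesis using assms unfolding poly_time_def
    by (auto intro!: poly_bounded_le[OF poly_bounded_const] vsize_bool_val)
qed

lemma poly_time_ite:
  fixes \<rho> :: "'s \<Rightarrow> 'a::linorder val list"
  assumes "poly_time \<rho> c" "poly_time \<rho> f" "poly_time \<rho> g"
  shows "poly_time \<rho> (\<lambda>s. if c s \<noteq> VNil then f s else g s)"
proof -
  obtain P where P: "computes P \<rho> c" "computes P \<rho> f" using poly_time2E[OF assms(1,2)] .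
  obtain Q where Q: "computes Q \<rho> g" using assms(3) by (auto simp: poly_time_def)
  obtain P' where "simulates TYPE('a) P P'" "simulates TYPE('a) Q P'" using common_program by blast
  with P Q have P': "computes P' \<rho> c" "computes P' \<rho> f" "computes P' \<rho> g"
    using computes_simulates(1) by blast+
  obtain e0 T0 e1 T1 e2 T2 where
    e: "\<And>s. eval P' (\<rho> s) e0 (c s) (T0 s)" "\<And>s. eval P' (\<rho> s) e1 (f s) (T1 s)"
      "\<And>s. eval P' (\<rho> s) e2 (g s) (T2 s)" and
    T: "poly_bounded (\<lambda>s. env_size (\<rho> s)) T0" "poly_bounded (\<lambda>s. env_size (\<rho> s)) T1"
      "poly_bounded (\<lambda>s. env_size (\<rho> s)) T2"
    using P' by (elim computesE) blast
  have "eval P' (\<rho> s) (EIf e0 e1 e2) (if c s \<noteq> VNil then f s else g s)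
      (T0 s + (if c s \<noteq> VNil then T1 s else T2 s) + 1)" for s
    using eval_evals.EIf_true[OF e(1)[of s] _ e(2)[of s], of e2]
      eval_evals.EIf_false[of P' "\<rho> s" e0 "T0 s", OF _ e(3)[of s], of e1] e(1)[of s]
    by (cases "c s = VNil") simp_all
  moreover have "poly_bounded (\<lambda>s. env_size (\<rho> s))
      (\<lambda>s. T0 s + (if c s \<noteq> VNil then T1 s else T2 s) + 1)"
    by (rule poly_bounded_le[where k = "\<lambda>s. T0 s + (T1 s + T2 s) + 1"])
       (auto intro!: poly_bounded_intros T)
  ultimately have "computes P' \<rho> (\<lambda>s. if c s \<noteq> VNil then f s else g s)"
    by (rule computesI)
  moreover have "poly_bounded (\<lambda>s. env_size (\<rho> s)) (\<lambda>s. vsize (if c s \<noteq> VNil then f s else g s))"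
    by (rule poly_bounded_le[where k = "\<lambda>s. vsize (f s) + vsize (g s)"])
       (use assms in \<open>auto intro!: poly_bounded_intros simp: poly_time_def\<close>)
  ultimately show ?thesis using assms unfolding poly_time_def by blast
qed

lemma poly_times_nil: "\<exists>n. \<forall>s. length (\<rho> s) = n \<Longrightarrow> poly_times \<rho> (\<lambda>s. [])"
  unfolding poly_times_def computes_all_def
  by (auto intro!: exI[of _ "[]"] exI[of _ "\<lambda>_. 0"] eval_evals.intros poly_bounded_const)

lemma poly_times_cons:
  fixes \<rho> :: "'s \<Rightarrow> 'a::linorder val list"
  assumes "poly_time \<rho> f" "poly_times \<rho> F"
  shows "poly_times \<rho> (\<lambda>s. f s # F s)"
proof -
  obtain P Q where "computes P \<rho> f" "computes_all Q \<rho> F"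
    using assms by (auto simp: poly_time_def poly_times_def)
  moreover obtain P' where "simulates TYPE('a) P P'" "simulates TYPE('a) Q P'"
    using common_program by blast
  ultimately have P': "computes P' \<rho> f" "computes_all P' \<rho> F" using computes_simulates by blast+
  then have "computes_all P' \<rho> (\<lambda>s. f s # F s)"
    unfolding computes_all_def
    by (elim computesE, elim exE conjE)
       (intro exI conjI allI, rule eval_evals.Cons, auto intro!: poly_bounded_intros)
  then show ?thesis using assms unfolding poly_time_def poly_times_def
    by (auto intro!: poly_bounded_intros)
qed

lemma evals_vars:
  "j + m \<le> length env \<Longrightarrow> evals P env (map EVar [j..<j + m]) (take m (drop j env)) m"
proof (induction m arbitrary: j)
  case 0
  then show ?case by (auto intro: eval_evals.intros)
next
  case (Suc m)
  then have "evals P env (map EVar [Suc j..<Suc j + m]) (take m (drop (Suc j) env)) m"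
    using Suc.IH[of "Suc j"] by (simp del: upt_Suc)
  moreover have "eval P env (EVar j) (env ! j) 1"
    using Suc.prems by (intro eval_evals.EVar) simp
  moreover have "take (Suc m) (drop j env) = env ! j # take m (drop (Suc j) env)"
    using Suc.prems by (simp add: Cons_nth_drop_Suc[symmetric])
  moreover have "[j..<j + Suc m] = j # [Suc j..<Suc j + m]"
    using upt_conv_Cons[of j "j + Suc m"] by simp
  ultimately show ?case
    using eval_evals.Cons by fastforce
qed

lemma poly_times_suffix:
  assumes \<rho>: "\<exists>n. \<forall>s. length (\<rho> s) = n" and m: "\<And>s. length (vs s) = m"
  shows "poly_times (\<lambda>s. vs s @ \<rho> s) \<rho>"
proof -
  obtain n where n: "\<And>s. length (\<rho> s) = n" using \<rho> by blast
  have "evals P (vs s @ \<rho> s) (map EVar [m..<m + n]) (\<rho> s) n" for P s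
    using evals_vars[of m n "vs s @ \<rho> s"] n[of s] m[of s] by simp
  moreover have "poly_bounded (\<lambda>s. env_size (vs s @ \<rho> s)) (\<lambda>s. env_size (\<rho> s))"
    by (rule poly_bounded_le[OF poly_bounded_self]) (simp add: env_size_def)
  ultimately show ?thesis
    unfolding poly_times_def computes_all_def
    using n m by (auto intro!: poly_bounded_const exI[of _ "m + n"] exI[of _ "\<lambda>_. n"])
qed

lemma poly_times_tl: "\<exists>n. \<forall>s. length (\<rho> s) = n \<Longrightarrow> poly_times (\<lambda>s. v s # \<rho> s) \<rho>"
  using poly_times_suffix[of \<rho> "\<lambda>s. [v s]" 1] by simp

lemma poly_times_self:
  assumes "\<exists>n. \<forall>s. length (\<rho> s) = n"
  shows "poly_times \<rho> \<rho>"
proof -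
  obtain n where n: "\<And>s. length (\<rho> s) = n" using assms by blast
  have "evals P (\<rho> s) (map EVar [0..<0 + n]) (\<rho> s) n" for P s
    using evals_vars[of 0 n "\<rho> s"] n[of s] by simp
  then show ?thesis
    unfolding poly_times_def computes_all_def
    using n by (auto intro!: poly_bounded_const poly_bounded_self exI[of _ "\<lambda>_. n"])
qed

text \<open>The expression for \<open>f\<close> becomes a new function at index
  \<open>length P'\<close> and is called on the computed arguments. Its cost is polynomial in the
  size of \<open>\<rho> (g t)\<close>, which \<open>poly_times\<close> in turn bounds in terms of
  \<open>\<rho>' t\<close>; this is where the size bounds pay off.\<close>

lemma poly_time_comp:
  fixes \<rho> :: "'s \<Rightarrow> 'a::linorder val list" and \<rho>' :: "'t \<Rightarrow> 'a::linorder val list"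
  assumes f: "poly_time \<rho> f" and F: "poly_times \<rho>' (\<lambda>t. \<rho> (g t))"
  shows "poly_time \<rho>' (\<lambda>t. f (g t))"
proof -
  obtain P Q where "computes P \<rho> f" "computes_all Q \<rho>' (\<lambda>t. \<rho> (g t))"
    using assms by (auto simp: poly_time_def poly_times_def)
  moreover obtain P' where "simulates TYPE('a) P P'" "simulates TYPE('a) Q P'"
    using common_program by blast
  ultimately have "computes P' \<rho> f" "computes_all P' \<rho>' (\<lambda>t. \<rho> (g t))"
    using computes_simulates by blast+
  then obtain e T es T' where
    e: "\<And>s. eval P' (\<rho> s) e (f s) (T s)" and T: "poly_bounded (\<lambda>s. env_size (\<rho> s)) T" and
    es: "\<And>t. evals P' (\<rho>' t) es (\<rho> (g t)) (T' t)" and T': "poly_bounded (\<lambda>t. env_size (\<rho>' t)) T'"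
    by (elim computesE computes_allE) blast
  have bd: "poly_bounded (\<lambda>t. env_size (\<rho>' t)) (\<lambda>t. env_size (\<rho> (g t)))"
    using F by (simp add: poly_times_def)
  have "eval (P' @ [e]) (\<rho>' t) (ECall (length P') es) (f (g t)) (T' t + T (g t) + 1)" for t
    using eval_evals.ECall[OF eval_append(2)[OF es[of t], of "[e]"], of "length P'"]
      eval_append(1)[OF e[of "g t"], of "[e]"] by simp
  moreover have "poly_bounded (\<lambda>t. env_size (\<rho>' t)) (\<lambda>t. T' t + T (g t) + 1)"
    using poly_bounded_trans[OF poly_bounded_comp[OF T] bd] T' by (intro poly_bounded_intros)
  ultimately have "computes (P' @ [e]) \<rho>' (\<lambda>t. f (g t))" by (rule computesI)
  moreover have "poly_bounded (\<lambda>t. env_size (\<rho>' t)) (\<lambda>t. vsize (f (g t)))"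
    using poly_bounded_trans[OF poly_bounded_comp[of "\<lambda>s. env_size (\<rho> s)" "\<lambda>s. vsize (f s)"] bd] f
    by (simp add: poly_time_def)
  ultimately show ?thesis using F unfolding poly_time_def poly_times_def by blast
qed

lemma poly_times_comp:
  assumes "poly_times \<rho> F"
  shows "poly_times (\<lambda>t. \<rho> (g t)) (\<lambda>t. F (g t))"
  using assms unfolding poly_times_def computes_all_def
  by (elim conjE exE) (intro conjI exI allI, auto dest: poly_bounded_comp)

lemma poly_time_subst: "poly_time \<rho> f \<Longrightarrow> poly_time (\<lambda>t. \<rho> (g t)) (\<lambda>t. f (g t))"
  by (rule poly_time_comp, assumption, rule poly_times_comp, rule poly_times_self)
     (rule poly_time_arity)


lemma poly_time_weak:
  assumes "poly_time \<rho> f"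
  shows "poly_time (\<lambda>t. v t # \<rho> (g t)) (\<lambda>t. f (g t))"
proof (rule poly_time_comp[OF assms])
  show "poly_times (\<lambda>t. v t # \<rho> (g t)) (\<lambda>t. \<rho> (g t))"
    using poly_time_arity[OF assms] by (intro poly_times_tl) blast
qed

text \<open>No \<open>ELet\<close> is generated: the bound value is passed to a new function as an
  additional first argument.\<close>

lemma poly_time_let:
  assumes "poly_time \<rho> v" "poly_time (\<lambda>s. v s # \<rho> s) f"
  shows "poly_time \<rho> f"
  using poly_time_comp[OF assms(2), of \<rho> id]
    poly_times_cons[OF assms(1) poly_times_self[OF poly_time_arity[OF assms(1)]]] by simp


text \<open>The recursion tree has at most \<open>2 * \<mu> t + 1\<close> calls, since an inner call
  uses up at least one unit of \<open>\<mu>\<close> beyond what its two subcalls share. Environments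
  never grow, by \<open>sz\<close>, so each call costs at most a fixed power of the initial size.
  The bound \<open>bd_F\<close> is a hypothesis because a step could double its result at every
  level. The step \<open>H\<close> is required only on the range of \<open>g\<close>, which contains
  all inner calls; likewise \<open>A1\<close> and \<open>A2\<close> have to be right only
  there.\<close>

lemma poly_time_rec:
  fixes \<rho> :: "'t \<Rightarrow> 'a::linorder val list" and F :: "'t \<Rightarrow> 'a val" and g :: "'u \<Rightarrow> 't"
  assumes c: "poly_time \<rho> c" and b: "poly_time \<rho> b"
    and a1: "poly_times \<rho> A1" and a2: "poly_times \<rho> A2"
    and A: "\<And>t. c t \<noteq> VNil \<Longrightarrow> A1 t = \<rho> (sl t)" "\<And>t. c t \<noteq> VNil \<Longrightarrow> A2 t = \<rho> (sr t)"
    and H: "poly_time (\<lambda>u. F (sl (g u)) # F (sr (g u)) # \<rho> (g u)) (\<lambda>u. F (g u))"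
    and F: "\<And>t. c t \<noteq> VNil \<Longrightarrow> \<exists>u. g u = t" "\<And>t. c t = VNil \<Longrightarrow> F t = b t"
    and \<mu>: "\<And>t. c t \<noteq> VNil \<Longrightarrow> \<mu> (sl t) + \<mu> (sr t) < \<mu> t"
    and bd_\<mu>: "poly_bounded (\<lambda>t. env_size (\<rho> t)) \<mu>"
    and sz: "\<And>t. c t \<noteq> VNil \<Longrightarrow> env_size (\<rho> (sl t)) \<le> env_size (\<rho> t)"
      "\<And>t. c t \<noteq> VNil \<Longrightarrow> env_size (\<rho> (sr t)) \<le> env_size (\<rho> t)"
    and bd_F: "poly_bounded (\<lambda>t. env_size (\<rho> t)) (\<lambda>t. vsize (F t))"
  shows "poly_time \<rho> F"
proof -
  define \<rho>H where "\<rho>H = (\<lambda>u. F (sl (g u)) # F (sr (g u)) # \<rho> (g u))"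
  define U where "U = (\<lambda>t. SOME u. g u = t)"
  have U: "g (U t) = t" if "c t \<noteq> VNil" for t unfolding U_def by (rule someI_ex) (rule F(1)[OF that])
  let ?M = "\<lambda>t. env_size (\<rho> t)"
  obtain n where n: "\<And>t. length (\<rho> t) = n" using poly_time_arity[OF c] by blast
  obtain P0 where "computes P0 \<rho> c" "computes P0 \<rho> b" using poly_time2E[OF c b] .
  moreover obtain P1 P2 P3 where "computes_all P1 \<rho> A1" "computes_all P2 \<rho> A2" "computes P3 \<rho>H (\<lambda>u. F (g u))"
    using a1 a2 H by (auto simp: poly_time_def poly_times_def \<rho>H_def)
  moreover obtain P01 where "simulates TYPE('a) P0 P01" "simulates TYPE('a) P1 P01"
    using common_program by blast
  moreover obtain P23 where "simulates TYPE('a) P2 P23" "simulates TYPE('a) P3 P23"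
    using common_program by blast
  moreover obtain P where "simulates TYPE('a) P01 P" "simulates TYPE('a) P23 P"
    using common_program by blast
  ultimately have "computes P \<rho> c" "computes P \<rho> b" "computes_all P \<rho> A1" "computes_all P \<rho> A2"
      "computes P \<rho>H (\<lambda>u. F (g u))"
    by (meson computes_simulates)+
  then obtain ce Tc be Tb es1 T1 es2 T2 he TH where
    ce: "\<And>t. eval P (\<rho> t) ce (c t) (Tc t)" and Tc: "poly_bounded ?M Tc" and
    be: "\<And>t. eval P (\<rho> t) be (b t) (Tb t)" and Tb: "poly_bounded ?M Tb" and
    es1: "\<And>t. evals P (\<rho> t) es1 (A1 t) (T1 t)" and T1: "poly_bounded ?M T1" and
    es2: "\<And>t. evals P (\<rho> t) es2 (A2 t) (T2 t)" and T2: "poly_bounded ?M T2" and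
    he: "\<And>u. eval P (\<rho>H u) he (F (g u)) (TH u)" and TH: "poly_bounded (\<lambda>u. env_size (\<rho>H u)) TH"
    by (elim computesE computes_allE) blast
  \<comment> \<open>Index \<open>length P\<close> is the step function,
    \<open>Suc (length P)\<close> the recursive function itself. The step receives both recursive
    results, followed by the unchanged arguments.\<close>
  define body where "body = EIf ce (ECall (length P)
    (ECall (Suc (length P)) es1 # ECall (Suc (length P)) es2 # map EVar [0..<n])) be"
  define P' where "P' = P @ [he, body]"
  \<comment> \<open>\<open>TH\<close> is indexed by the parameters of \<open>g\<close>; a base case
    need not have a preimage, hence the default 0.\<close>
  define TH' where "TH' = (\<lambda>t. if c t = VNil then 0 else TH (U t))"
  have "poly_bounded ?M TH'"
  proof -
    obtain d1 where d1: "\<And>t. vsize (F t) \<le> (?M t + 2) ^ d1"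
      using bd_F unfolding poly_bounded_def by blast
    obtain d2 where d2: "\<And>u. TH u \<le> (env_size (\<rho>H u) + 2) ^ d2"
      using TH unfolding poly_bounded_def by blast
    have "TH' t \<le> ((?M t + 2) ^ d1 + (?M t + 2) ^ d1 + ?M t + 2) ^ d2" for t
    proof (cases "c t = VNil")
      case False
      then have "(?M (sl t) + 2) ^ d1 \<le> (?M t + 2) ^ d1" "(?M (sr t) + 2) ^ d1 \<le> (?M t + 2) ^ d1"
        using sz[of t] by (simp_all add: power_mono)
      then have "env_size (\<rho>H (U t)) \<le> (?M t + 2) ^ d1 + (?M t + 2) ^ d1 + ?M t"
        using d1[of "sl t"] d1[of "sr t"] U[OF False] by (simp add: \<rho>H_def)
      then have "(env_size (\<rho>H (U t)) + 2) ^ d2 \<le> ((?M t + 2) ^ d1 + (?M t + 2) ^ d1 + ?M t + 2) ^ d2"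
        by (intro power_mono) auto
      then show ?thesis using d2[of "U t"] False by (simp add: TH'_def)
    qed (simp add: TH'_def)
    moreover have "poly_bounded ?M (\<lambda>t. (?M t + 2) ^ d1)"
      by (rule poly_boundedI) (rule le_refl)
    then have "poly_bounded ?M (\<lambda>t. (?M t + 2) ^ d1 + (?M t + 2) ^ d1 + ?M t)"
      by (intro poly_bounded_add poly_bounded_self)
    then have "poly_bounded ?M (\<lambda>t. ((?M t + 2) ^ d1 + (?M t + 2) ^ d1 + ?M t + 2) ^ d2)"
      by (rule poly_bounded_trans[rotated]) (rule poly_boundedI, rule le_refl)
    ultimately show ?thesis by (rule poly_bounded_le[rotated])
  qed
  \<comment> \<open>The 10 covers the unit costs of the conditional and of the calls.\<close>
  then have "poly_bounded ?M (\<lambda>t. Tc t + Tb t + T1 t + T2 t + TH' t + n + 10)"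
    by (intro poly_bounded_intros Tc Tb T1 T2)
  then obtain d where d: "\<And>t. Tc t + Tb t + T1 t + T2 t + TH' t + n + 10 \<le> (?M t + 2) ^ d"
    unfolding poly_bounded_def by blast
  have P'_nth: "P' ! length P = he" "P' ! Suc (length P) = body" "length P' = Suc (Suc (length P))"
    by (simp_all add: P'_def nth_append)
  have lift: "eval P env e v k \<Longrightarrow> eval P' env e v k" "evals P env es vs k \<Longrightarrow> evals P' env es vs k"
    for env e v k es vs unfolding P'_def by (simp_all add: eval_append)
  have "\<exists>k. eval P' (\<rho> t) body (F t) k \<and> k \<le> (2 * \<mu> t + 1) * (?M t + 2) ^ d" for t
  proof (induction "\<mu> t" arbitrary: t rule: less_induct)
    case less
    show ?case
    proof (cases "c t = VNil")
      case True
      have "eval P' (\<rho> t) ce VNil (Tc t)" using lift(1)[OF ce[of t]] True by simp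
      then have "eval P' (\<rho> t) body (b t) (Tc t + Tb t + 1)"
        unfolding body_def by (rule eval_evals.EIf_false) (rule lift(1)[OF be])
      moreover have "Tc t + Tb t + 1 \<le> (2 * \<mu> t + 1) * (?M t + 2) ^ d"
        using d[of t] trans_le_add1 by fastforce
      ultimately show ?thesis using F(2)[OF True] by auto
    next
      case False
      have "\<mu> (sl t) < \<mu> t" "\<mu> (sr t) < \<mu> t" using \<mu>[OF False] by linarith+
      then obtain k1 k2 where
        k1: "eval P' (\<rho> (sl t)) body (F (sl t)) k1" "k1 \<le> (2 * \<mu> (sl t) + 1) * (?M (sl t) + 2) ^ d" and
        k2: "eval P' (\<rho> (sr t)) body (F (sr t)) k2" "k2 \<le> (2 * \<mu> (sr t) + 1) * (?M (sr t) + 2) ^ d"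
        using less by blast
      have mono: "(?M (sl t) + 2) ^ d \<le> (?M t + 2) ^ d" "(?M (sr t) + 2) ^ d \<le> (?M t + 2) ^ d"
        using sz[OF False] by (simp_all add: power_mono)
      have r1: "eval P' (\<rho> t) (ECall (Suc (length P)) es1) (F (sl t)) (T1 t + k1 + 1)"
        using A(1)[OF False] k1(1) P'_nth
        by (intro eval_evals.ECall[OF lift(2)[OF es1]]) simp_all
      have r2: "eval P' (\<rho> t) (ECall (Suc (length P)) es2) (F (sr t)) (T2 t + k2 + 1)"
        using A(2)[OF False] k2(1) P'_nth
        by (intro eval_evals.ECall[OF lift(2)[OF es2]]) simp_all
      have "evals P' (\<rho> t) (map EVar [0..<n]) (\<rho> t) n"
        using evals_vars[of 0 n "\<rho> t"] n[of t] by simp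
      then have "evals P' (\<rho> t) (ECall (Suc (length P)) es1 # ECall (Suc (length P)) es2 # map EVar [0..<n])
          (\<rho>H (U t)) (T1 t + k1 + 1 + (T2 t + k2 + 1 + n))"
        unfolding \<rho>H_def U[OF False] by (intro eval_evals.Cons r1 r2)
      then have "eval P' (\<rho> t) (ECall (length P) (ECall (Suc (length P)) es1 #
          ECall (Suc (length P)) es2 # map EVar [0..<n])) (F (g (U t)))
          (T1 t + k1 + 1 + (T2 t + k2 + 1 + n) + TH (U t) + 1)"
        by (rule eval_evals.ECall) (use P'_nth lift(1)[OF he] in simp_all)
      then have "eval P' (\<rho> t) body (F t) (Tc t + (T1 t + k1 + 1 + (T2 t + k2 + 1 + n) + TH (U t) + 1) + 1)"
        unfolding body_def U[OF False] by (rule eval_evals.EIf_true[OF lift(1)[OF ce] False])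
      moreover have "Tc t + (T1 t + k1 + 1 + (T2 t + k2 + 1 + n) + TH (U t) + 1) + 1 \<le>
          (2 * \<mu> t + 1) * (?M t + 2) ^ d"
      proof -
        have "Tc t + (T1 t + k1 + 1 + (T2 t + k2 + 1 + n) + TH (U t) + 1) + 1 \<le> (?M t + 2) ^ d + k1 + k2"
          using d[of t] False by (simp add: TH'_def)
        also have "\<dots> \<le> (?M t + 2) ^ d + (2 * \<mu> (sl t) + 1) * (?M t + 2) ^ d +
            (2 * \<mu> (sr t) + 1) * (?M t + 2) ^ d"
          using order_trans[OF k1(2) mult_le_mono2[OF mono(1)]]
            order_trans[OF k2(2) mult_le_mono2[OF mono(2)]] by linarith
        also have "\<dots> = (2 * (\<mu> (sl t) + \<mu> (sr t) + 1) + 1) * (?M t + 2) ^ d"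
          by (simp add: algebra_simps)
        also have "\<dots> \<le> (2 * \<mu> t + 1) * (?M t + 2) ^ d"
          using \<mu>[OF False] by (intro mult_le_mono1) simp
        finally show ?thesis .
      qed
      ultimately show ?thesis by blast
    qed
  qed
  then obtain T where T: "\<And>t. eval P' (\<rho> t) body (F t) (T t)"
      "\<And>t. T t \<le> (2 * \<mu> t + 1) * (?M t + 2) ^ d" by metis
  have "poly_bounded ?M T"
  proof (rule poly_bounded_le[OF _ T(2)])
    show "poly_bounded ?M (\<lambda>t. (2 * \<mu> t + 1) * (?M t + 2) ^ d)"
      by (intro poly_bounded_intros bd_\<mu>) (rule poly_boundedI, rule le_refl)
  qed
  then have "computes P' \<rho> F" by (intro computesI[OF T(1)])
  then show ?thesis using n bd_F unfolding poly_time_def by blast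
qed

lemma vsize_enc_list: "vsize (enc_list vs) = 1 + (\<Sum>v\<leftarrow>vs. 1 + vsize v)"
  by (induction vs) simp_all

text \<open>Instance of \<open>poly_time_rec\<close> whose second branch is spent on the empty list.
  The size bound \<open>bd\<close> ranges over all lists, not only \<open>l s\<close>, because the
  recursion passes through the tails while the situation stays the same.\<close>

lemma poly_time_list_rec:
  fixes \<rho> :: "'s \<Rightarrow> 'a::linorder val list" and F :: "'s \<Rightarrow> 'b list \<Rightarrow> 'a val" and e :: "'b \<Rightarrow> 'a val"
  assumes base: "poly_time \<rho> (\<lambda>s. F s [])"
    and l: "poly_time \<rho> (\<lambda>s. enc_list (map e (l s)))"
    and step: "poly_time (\<lambda>t. F (snd (snd t)) (fst (snd t)) # e (fst t) #
        enc_list (map e (fst (snd t))) # \<rho> (snd (snd t)))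
      (\<lambda>t. F (snd (snd t)) (fst t # fst (snd t)))"
    and bd: "poly_bounded (\<lambda>t. vsize (enc_list (map e (fst t))) + env_size (\<rho> (snd t)))
      (\<lambda>t. vsize (F (snd t) (fst t)))"
  shows "poly_time \<rho> (\<lambda>s. F s (l s))"
proof -
  define \<rho>' where "\<rho>' = (\<lambda>t. enc_list (map e (fst t)) # \<rho> (snd t))"
  define c where "c = (\<lambda>t :: 'b list \<times> 's. enc_list (map e (fst t)))"
  have ar: "\<exists>n. \<forall>s. length (\<rho> s) = n" using base by (rule poly_time_arity)
  then have ar': "\<exists>n. \<forall>t. length (\<rho>' t) = n" by (auto simp: \<rho>'_def)
  have hd: "poly_time \<rho>' c" unfolding \<rho>'_def c_def using ar by (intro poly_time_hd) blast
  have tl: "poly_times \<rho>' (\<lambda>t. \<rho> (snd t))"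
    unfolding \<rho>'_def using ar by (intro poly_times_tl) blast
  have c_nil: "c t = VNil \<longleftrightarrow> fst t = []" for t by (cases "fst t") (simp_all add: c_def)
  define sl where "sl = (\<lambda>t :: 'b list \<times> 's. (tl (fst t), snd t))"
  define sr where "sr = (\<lambda>t :: 'b list \<times> 's. ([] :: 'b list, snd t))"
  define g where "g = (\<lambda>u :: 'b \<times> 'b list \<times> 's. (fst u # fst (snd u), snd (snd u)))"
  define F' where "F' = (\<lambda>t. F (snd t) (fst t))"
  have "poly_time \<rho>' F'"
  proof (rule poly_time_rec[where c = c and b = "\<lambda>t. F (snd t) []" and sl = sl and sr = sr and g = g
      and \<mu> = "\<lambda>t. 2 * length (fst t)"])
    show "poly_time \<rho>' c" by (rule hd)
    show "poly_time \<rho>' (\<lambda>t. F (snd t) [])" by (rule poly_time_comp[OF base tl])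
    show "poly_times \<rho>' (\<lambda>t. val_snd (c t) # \<rho> (snd t))"
      by (intro poly_times_cons poly_time_snd hd tl)
    show "poly_times \<rho>' (\<lambda>t. VNil # \<rho> (snd t))"
      by (intro poly_times_cons poly_time_nil ar' tl)
    show "val_snd (c t) # \<rho> (snd t) = \<rho>' (sl t)" if "c t \<noteq> VNil" for t
      using that by (cases "fst t") (simp_all add: c_def sl_def \<rho>'_def)
    show "VNil # \<rho> (snd t) = \<rho>' (sr t)" for t by (simp add: \<rho>'_def sr_def)
    show "F' t = F (snd t) []" if "c t = VNil" for t
      using that by (simp add: c_nil F'_def)
    show "2 * length (fst (sl t)) + 2 * length (fst (sr t)) < 2 * length (fst t)" if "c t \<noteq> VNil" for t
      using that by (cases "fst t") (simp_all add: c_def sl_def sr_def)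
    show "poly_bounded (\<lambda>t. env_size (\<rho>' t)) (\<lambda>t. 2 * length (fst t))"
    proof (rule poly_bounded_le[OF poly_bounded_self])
      have "2 * length xs \<le> vsize (enc_list (map e xs))" for xs
      proof (induction xs)
        case (Cons x xs)
        then have "Suc (2 * length xs) \<le> vsize (e x) + vsize (enc_list (map e xs))"
          using vsize_pos[of "e x"] by linarith
        then show ?case by simp
      qed simp
      then show "2 * length (fst t) \<le> env_size (\<rho>' t)" for t
        by (simp add: \<rho>'_def trans_le_add1)
    qed
    show "env_size (\<rho>' (sl t)) \<le> env_size (\<rho>' t)" for t
      by (cases "fst t") (simp_all add: \<rho>'_def sl_def)
    show "env_size (\<rho>' (sr t)) \<le> env_size (\<rho>' t)" for t
      by (simp add: \<rho>'_def sr_def Suc_leI)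
    show "poly_bounded (\<lambda>t. env_size (\<rho>' t)) (\<lambda>t. vsize (F' t))"
      using bd by (simp add: \<rho>'_def F'_def)
    have "poly_time (\<lambda>u. F' (sl (g u)) # F' (sr (g u)) # \<rho>' (g u))
        (\<lambda>u. F (snd (snd u)) (fst u # fst (snd u)))"
    proof (rule poly_time_comp[OF step, where g = id, unfolded id_apply])
      let ?\<rho> = "\<lambda>u. F' (sl (g u)) # F' (sr (g u)) # \<rho>' (g u)"
      have arH: "\<exists>n. \<forall>u. length (?\<rho> u) = n"
      proof -
        obtain n where "\<And>t. length (\<rho>' t) = n" using ar' by blast
        then show ?thesis by (intro exI[of _ "Suc (Suc n)"]) simp
      qed
      obtain m where m: "\<And>t. length (\<rho>' t) = m" using ar' by blast
      have c: "poly_time ?\<rho> (\<lambda>u. c (g u))"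
        using poly_time_weak[OF poly_time_weak[OF hd]] .
      have "poly_times ?\<rho> (\<lambda>u. \<rho> (snd (snd u)))"
        using poly_times_suffix[of "\<lambda>u. \<rho> (snd (snd u))"
            "\<lambda>u. [F' (sl (g u)), F' (sr (g u)), c (g u)]" 3] ar
        by (auto simp: \<rho>'_def c_def g_def)
      moreover have "poly_time ?\<rho> (\<lambda>u. F' (sl (g u)))"
        by (intro poly_time_hd exI[of _ "Suc m"]) (simp add: m)
      ultimately show "poly_times ?\<rho> (\<lambda>t. F (snd (snd t)) (fst (snd t)) # e (fst t) #
        enc_list (map e (fst (snd t))) # \<rho> (snd (snd t)))"
        using poly_times_cons[OF _ poly_times_cons[OF poly_time_fst[OF c]
          poly_times_cons[OF poly_time_snd[OF c]]]]
        by (simp add: c_def g_def F'_def sl_def)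
    qed
    then show "poly_time (\<lambda>u. F' (sl (g u)) # F' (sr (g u)) # \<rho>' (g u)) (\<lambda>u. F' (g u))"
      by (simp add: F'_def g_def)
    show "\<exists>u. g u = t" if "c t \<noteq> VNil" for t
      using that by (cases t; cases "fst t") (auto simp: c_def g_def)
  qed
  then have "poly_time (\<lambda>s. \<rho>' (l s, s)) (\<lambda>s. F' (l s, s))" by (rule poly_time_subst)
  then show ?thesis using l by (intro poly_time_let[OF l]) (simp_all add: \<rho>'_def F'_def)
qed

section \<open>Truth values and list functions\<close>

lemma poly_time_fstI:
  "\<exists>n. \<forall>s. length (\<rho> s) = n \<Longrightarrow> poly_time (\<lambda>t. e (fst t) # \<rho> (snd t)) (\<lambda>t. e (fst t))"
  by (intro poly_time_hd) blast

lemma poly_time_sndI: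
  "poly_time \<rho> f \<Longrightarrow> poly_time (\<lambda>t. e (fst t) # \<rho> (snd t)) (\<lambda>t. f (snd t))"
  by (rule poly_time_weak)

lemma poly_time_if:
  assumes "poly_time \<rho> (\<lambda>s. bool_val (b s))" "poly_time \<rho> f" "poly_time \<rho> g"
  shows "poly_time \<rho> (\<lambda>s. if b s then f s else g s)"
  using poly_time_ite[OF assms] by simp

lemma poly_time_cong: "poly_time \<rho> f \<Longrightarrow> (\<And>s. f s = g s) \<Longrightarrow> poly_time \<rho> g"
  by (drule arg_cong[of f g "poly_time \<rho>", OF ext]) simp

lemma poly_time_False: "\<exists>n. \<forall>s. length (\<rho> s) = n \<Longrightarrow> poly_time \<rho> (\<lambda>s. bool_val False)"
  by (simp add: bool_val_def poly_time_nil)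

lemma poly_time_True: "\<exists>n. \<forall>s. length (\<rho> s) = n \<Longrightarrow> poly_time \<rho> (\<lambda>s. bool_val True)"
  by (simp add: bool_val_def poly_time_nil poly_time_pair)

lemma poly_time_is_true:
  assumes "poly_time \<rho> f"
  shows "poly_time \<rho> (\<lambda>s. bool_val (f s \<noteq> VNil))"
  using poly_time_ite[OF assms poly_time_True poly_time_False] poly_time_arity[OF assms]
  by (simp add: if_distrib[symmetric] bool_val_def cong: if_cong)

lemma poly_time_not:
  assumes "poly_time \<rho> (\<lambda>s. bool_val (b s))"
  shows "poly_time \<rho> (\<lambda>s. bool_val (\<not> b s))"
  by (rule poly_time_cong[OF poly_time_if[OF assms poly_time_False poly_time_True]])
     (use poly_time_arity[OF assms] in auto)

lemma poly_time_conj: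
  assumes "poly_time \<rho> (\<lambda>s. bool_val (b s))" "poly_time \<rho> (\<lambda>s. bool_val (c s))"
  shows "poly_time \<rho> (\<lambda>s. bool_val (b s \<and> c s))"
  by (rule poly_time_cong[OF poly_time_if[OF assms poly_time_False]])
     (use poly_time_arity[OF assms(1)] in auto)

lemma poly_time_disj:
  assumes "poly_time \<rho> (\<lambda>s. bool_val (b s))" "poly_time \<rho> (\<lambda>s. bool_val (c s))"
  shows "poly_time \<rho> (\<lambda>s. bool_val (b s \<or> c s))"
  using poly_time_not[OF poly_time_conj[OF poly_time_not[OF assms(1)] poly_time_not[OF assms(2)]]]
  by simp

lemma poly_time_iff:
  assumes "poly_time \<rho> (\<lambda>s. bool_val (b s))" "poly_time \<rho> (\<lambda>s. bool_val (c s))"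
  shows "poly_time \<rho> (\<lambda>s. bool_val (b s \<longleftrightarrow> c s))"
  by (rule poly_time_cong[OF poly_time_if[OF assms poly_time_not[OF assms(2)]]]) auto

text \<open>Symbols can be compared only by their order, so equality is the failure of both strict
  comparisons.\<close>

lemma poly_time_eq:
  assumes "poly_time \<rho> (\<lambda>s. VSym (a s))" "poly_time \<rho> (\<lambda>s. VSym (b s))"
  shows "poly_time \<rho> (\<lambda>s. bool_val (a s = b s))"
  using poly_time_not[OF poly_time_disj[OF poly_time_less[OF assms] poly_time_less[OF assms(2,1)]]]
  by (simp add: neq_iff[symmetric])

lemma poly_time_list_nonempty:
  assumes "poly_time \<rho> (\<lambda>s. enc_list (map e (l s)))"
  shows "poly_time \<rho> (\<lambda>s. bool_val (l s \<noteq> []))"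
proof -
  have "enc_list (map e xs) \<noteq> VNil \<longleftrightarrow> xs \<noteq> []" for xs by (cases xs) simp_all
  then show ?thesis using poly_time_is_true[OF assms] by simp
qed

lemma poly_time_list_nil:
  "\<exists>n. \<forall>s. length (\<rho> s) = n \<Longrightarrow> poly_time \<rho> (\<lambda>s. enc_list (map e []))"
  by (simp add: poly_time_nil)

lemma poly_time_list_cons:
  assumes "poly_time \<rho> (\<lambda>s. e (x s))" "poly_time \<rho> (\<lambda>s. enc_list (map e (l s)))"
  shows "poly_time \<rho> (\<lambda>s. enc_list (map e (x s # l s)))"
  using poly_time_pair[OF assms] by simp

text \<open>Element functions for filters, maps and quantifiers are computed with just the element
  in front of \<open>\<rho>\<close>, whereas the step of \<open>poly_time_list_rec\<close> also sees
  the recursive result and the tail. This lemma bridges the two environments.\<close>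

lemma poly_time_step_env:
  assumes "poly_time (\<lambda>t. e (fst t) # \<rho> (snd t)) h"
  shows "poly_time (\<lambda>t. G t # e (fst t) # E t # \<rho> (snd (snd t))) (\<lambda>t. h (fst t, snd (snd t)))"
proof (rule poly_time_comp[OF assms])
  obtain n where n: "length (\<rho> s) = n" for s
    using poly_time_arity[OF assms] by (metis diff_Suc_1 length_Cons snd_conv)
  then have ar: "\<exists>n. \<forall>t. length (e (fst t) # E t # \<rho> (snd (snd t))) = n" by auto
  have "poly_times (\<lambda>t. G t # e (fst t) # E t # \<rho> (snd (snd t))) (\<lambda>t. \<rho> (snd (snd t)))"
    using poly_times_suffix[of "\<lambda>t. \<rho> (snd (snd t))" "\<lambda>t. [G t, e (fst t), E t]" 3] n by auto
  moreover have "poly_time (\<lambda>t. G t # e (fst t) # E t # \<rho> (snd (snd t))) (\<lambda>t. e (fst t))"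
    using n by (intro poly_time_weak[where g = "\<lambda>t. t"] poly_time_hd) auto
  ultimately show "poly_times (\<lambda>t. G t # e (fst t) # E t # \<rho> (snd (snd t)))
      (\<lambda>t. e (fst (fst t, snd (snd t))) # \<rho> (snd (fst t, snd (snd t))))"
    using poly_times_cons by fastforce
qed

lemma poly_time_step_env':
  assumes "poly_time \<rho> f"
  shows "poly_time (\<lambda>t. G t # e (fst t) # E t # \<rho> (snd (snd t))) (\<lambda>t. f (snd (snd t)))"
  using poly_time_step_env[OF poly_time_sndI[OF assms, of e]] by simp

lemma poly_time_step_rec:
  assumes "\<exists>n. \<forall>s. length (\<rho> s) = n"
  shows "poly_time (\<lambda>t. G t # e (fst t) # E t # \<rho> (snd (snd t))) G"
    "poly_time (\<lambda>t. G t # e (fst t) # E t # \<rho> (snd (snd t))) (\<lambda>t. e (fst t))"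
    "poly_time (\<lambda>t. G t # e (fst t) # E t # \<rho> (snd (snd t))) E"
  using assms
  by (auto intro!: poly_time_weak[where g = "\<lambda>t. t"] poly_time_hd)

lemma poly_time_bex:
  assumes l: "poly_time \<rho> (\<lambda>s. enc_list (map e (l s)))"
    and p: "poly_time (\<lambda>t. e (fst t) # \<rho> (snd t)) (\<lambda>t. bool_val (p (snd t) (fst t)))"
  shows "poly_time \<rho> (\<lambda>s. bool_val (\<exists>x\<in>set (l s). p s x))"
proof (rule poly_time_list_rec[where F = "\<lambda>s xs. bool_val (\<exists>x\<in>set xs. p s x)", OF _ l])
  note ar = poly_time_arity[OF l]
  show "poly_time \<rho> (\<lambda>s. bool_val (\<exists>x\<in>set []. p s x))" using poly_time_False[OF ar] by simp
  show "poly_time (\<lambda>t. bool_val (\<exists>x\<in>set (fst (snd t)). p (snd (snd t)) x) # e (fst t) #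
      enc_list (map e (fst (snd t))) # \<rho> (snd (snd t)))
     (\<lambda>t. bool_val (\<exists>x\<in>set (fst t # fst (snd t)). p (snd (snd t)) x))"
    unfolding list.set bex_simps
    by (intro poly_time_disj poly_time_step_rec ar) (use poly_time_step_env[OF p] in simp)
qed (auto intro!: poly_bounded_le[OF poly_bounded_const] vsize_bool_val)

lemma poly_time_ball:
  assumes l: "poly_time \<rho> (\<lambda>s. enc_list (map e (l s)))"
    and p: "poly_time (\<lambda>t. e (fst t) # \<rho> (snd t)) (\<lambda>t. bool_val (p (snd t) (fst t)))"
  shows "poly_time \<rho> (\<lambda>s. bool_val (\<forall>x\<in>set (l s). p s x))"
  using poly_time_not[OF poly_time_bex[OF l poly_time_not[OF p]]] by simp

lemma poly_time_append:
  assumes xs: "poly_time \<rho> (\<lambda>s. enc_list (map e (xs s)))"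
    and ys: "poly_time \<rho> (\<lambda>s. enc_list (map e (ys s)))"
  shows "poly_time \<rho> (\<lambda>s. enc_list (map e (xs s @ ys s)))"
proof (rule poly_time_list_rec[where F = "\<lambda>s xs. enc_list (map e (xs @ ys s))", OF _ xs])
  note ar = poly_time_arity[OF xs]
  show "poly_time \<rho> (\<lambda>s. enc_list (map e ([] @ ys s)))" using ys by simp
  show "poly_time (\<lambda>t. enc_list (map e (fst (snd t) @ ys (snd (snd t)))) # e (fst t) #
      enc_list (map e (fst (snd t))) # \<rho> (snd (snd t)))
     (\<lambda>t. enc_list (map e ((fst t # fst (snd t)) @ ys (snd (snd t)))))"
    unfolding append_Cons by (intro poly_time_list_cons poly_time_step_rec ar)
  let ?M = "\<lambda>t. vsize (enc_list (map e (fst t))) + env_size (\<rho> (snd t))"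
  obtain d where d: "\<And>s. vsize (enc_list (map e (ys s))) \<le> (env_size (\<rho> s) + 2) ^ d"
    using ys unfolding poly_time_def poly_bounded_def by blast
  have "poly_bounded ?M (\<lambda>t. ?M t + (?M t + 2) ^ d)"
    by (intro poly_bounded_intros poly_bounded_self) (rule poly_boundedI, rule le_refl)
  then show "poly_bounded ?M (\<lambda>t. vsize (enc_list (map e (fst t @ ys (snd t)))))"
  proof (rule poly_bounded_le)
    fix t
    have "(env_size (\<rho> (snd t)) + 2) ^ d \<le> (?M t + 2) ^ d" by (rule power_mono) auto
    then show "vsize (enc_list (map e (fst t @ ys (snd t)))) \<le> ?M t + (?M t + 2) ^ d"
      using d[of "snd t"] by (simp add: vsize_enc_list del: power_Suc)
  qed
qed

text \<open>The size estimate, number of elements times largest output, is made once here;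
  \<open>poly_time_map\<close> and \<open>poly_time_filter\<close> are the cases of at most one
  output per element.\<close>

lemma poly_time_concat_map:
  fixes \<rho> :: "'s \<Rightarrow> 'a::linorder val list" and e :: "'b \<Rightarrow> 'a val" and e' :: "'c \<Rightarrow> 'a val"
  assumes l: "poly_time \<rho> (\<lambda>s. enc_list (map e (l s)))"
    and f: "poly_time (\<lambda>t. e (fst t) # \<rho> (snd t)) (\<lambda>t. enc_list (map e' (f (snd t) (fst t))))"
  shows "poly_time \<rho> (\<lambda>s. enc_list (map e' (concat (map (f s) (l s)))))"
proof (rule poly_time_list_rec[where F = "\<lambda>s xs. enc_list (map e' (concat (map (f s) xs)))", OF _ l])
  note ar = poly_time_arity[OF l]
  show "poly_time \<rho> (\<lambda>s. enc_list (map e' (concat (map (f s) []))))"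
    using poly_time_nil[OF ar] by simp
  show "poly_time (\<lambda>t. enc_list (map e' (concat (map (f (snd (snd t))) (fst (snd t))))) # e (fst t) #
      enc_list (map e (fst (snd t))) # \<rho> (snd (snd t)))
     (\<lambda>t. enc_list (map e' (concat (map (f (snd (snd t))) (fst t # fst (snd t))))))"
    unfolding list.map concat.simps
    by (intro poly_time_append poly_time_step_rec ar) (use poly_time_step_env[OF f] in simp)
  let ?M = "\<lambda>t. vsize (enc_list (map e (fst t))) + env_size (\<rho> (snd t))"
  obtain d where d: "\<And>t. vsize (enc_list (map e' (f (snd t) (fst t)))) \<le>
      (vsize (e (fst t)) + env_size (\<rho> (snd t)) + 2) ^ d"
    using f unfolding poly_time_def poly_bounded_def by auto
  have "poly_bounded ?M (\<lambda>t. 1 + ?M t * (?M t + 2) ^ d)"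
    by (intro poly_bounded_intros poly_bounded_self) (rule poly_boundedI, rule le_refl)
  then show "poly_bounded ?M (\<lambda>t. vsize (enc_list (map e' (concat (map (f (snd t)) (fst t))))))"
  proof (rule poly_bounded_le)
    fix t :: "'b list \<times> 's"
    obtain xs s where t: "t = (xs, s)" by (cases t)
    have "vsize (enc_list (map e' (concat (map (f s) xs)))) \<le> 1 + length xs * K"
      if "\<And>x. x \<in> set xs \<Longrightarrow> vsize (enc_list (map e' (f s x))) \<le> K" for K xs
      using that
    proof (induction xs)
      case (Cons x xs)
      then have "vsize (enc_list (map e' (concat (map (f s) xs)))) \<le> 1 + length xs * K"
        "vsize (enc_list (map e' (f s x))) \<le> K" by simp_all
      then show ?case by (simp add: vsize_enc_list)
    qed simp
    moreover have "vsize (enc_list (map e' (f s x))) \<le> (?M t + 2) ^ d" if "x \<in> set xs" for x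
    proof -
      have "vsize (e x) \<le> vsize (enc_list (map e xs))"
        using member_le_sum_list[of "1 + vsize (e x)" "map (\<lambda>v. 1 + vsize v) (map e xs)"] that
        by (auto simp: vsize_enc_list o_def)
      then have "(vsize (e x) + env_size (\<rho> s) + 2) ^ d \<le> (?M t + 2) ^ d"
        by (intro power_mono) (auto simp: t)
      then show ?thesis using d[of "(x, s)"] by simp
    qed
    moreover have "length xs \<le> ?M t"
    proof -
      have "length xs \<le> vsize (enc_list (map e xs))" by (induction xs) simp_all
      then show ?thesis by (simp add: t)
    qed
    ultimately have "vsize (enc_list (map e' (concat (map (f s) xs)))) \<le> 1 + length xs * (?M t + 2) ^ d"
      by blast
    also have "\<dots> \<le> 1 + ?M t * (?M t + 2) ^ d"
      using \<open>length xs \<le> ?M t\<close> by (intro add_left_mono mult_le_mono1)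
    finally show "vsize (enc_list (map e' (concat (map (f (snd t)) (fst t))))) \<le>
        1 + ?M t * (?M t + 2) ^ d" by (simp add: t)
  qed
qed

lemma poly_time_map:
  assumes l: "poly_time \<rho> (\<lambda>s. enc_list (map e (l s)))"
    and f: "poly_time (\<lambda>t. e (fst t) # \<rho> (snd t)) (\<lambda>t. e' (f (snd t) (fst t)))"
  shows "poly_time \<rho> (\<lambda>s. enc_list (map e' (map (f s) (l s))))"
proof -
  have "poly_time (\<lambda>t. e (fst t) # \<rho> (snd t)) (\<lambda>t. enc_list (map e' [f (snd t) (fst t)]))"
    using poly_time_pair[OF f poly_time_nil[OF poly_time_arity[OF f]]] by simp
  moreover have "concat (map (\<lambda>x. [f s x]) xs) = map (f s) xs" for s xs by (induction xs) simp_all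
  ultimately show ?thesis using poly_time_concat_map[OF l] by fastforce
qed

lemma poly_time_filter:
  assumes l: "poly_time \<rho> (\<lambda>s. enc_list (map e (l s)))"
    and p: "poly_time (\<lambda>t. e (fst t) # \<rho> (snd t)) (\<lambda>t. bool_val (p (snd t) (fst t)))"
  shows "poly_time \<rho> (\<lambda>s. enc_list (map e (filter (p s) (l s))))"
proof -
  note ar = poly_time_arity[OF p]
  have ar': "\<exists>n. \<forall>s. length (\<rho> s) = n" using poly_time_arity[OF l] .
  have "poly_time (\<lambda>t. e (fst t) # \<rho> (snd t))
      (\<lambda>t. enc_list (map e (if p (snd t) (fst t) then [fst t] else [])))"
    unfolding if_distrib[of "\<lambda>l. enc_list (map e l)"]
    by (intro poly_time_if p poly_time_list_cons poly_time_fstI ar' poly_time_list_nil ar)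
  moreover have "concat (map (\<lambda>x. if p s x then [x] else []) xs) = filter (p s) xs" for s xs
    by (induction xs) simp_all
  ultimately show ?thesis using poly_time_concat_map[OF l] by fastforce
qed

lemma poly_time_insort:
  fixes \<rho> :: "'s \<Rightarrow> 'a::linorder val list"
  assumes x: "poly_time \<rho> (\<lambda>s. VSym (x s))" and ys: "poly_time \<rho> (\<lambda>s. enc_list (map VSym (ys s)))"
  shows "poly_time \<rho> (\<lambda>s. enc_list (map VSym (insort (x s) (ys s))))"
proof (rule poly_time_list_rec[where F = "\<lambda>s ys. enc_list (map VSym (insort (x s) ys))", OF _ ys])
  note ar = poly_time_arity[OF x]
  show "poly_time \<rho> (\<lambda>s. enc_list (map VSym (insort (x s) [])))"
    using poly_time_list_cons[of \<rho> VSym, OF x poly_time_list_nil[OF ar]] by simp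
  show "poly_time (\<lambda>t. enc_list (map VSym (insort (x (snd (snd t))) (fst (snd t)))) # VSym (fst t) #
        enc_list (map VSym (fst (snd t))) # \<rho> (snd (snd t)))
      (\<lambda>t. enc_list (map VSym (insort (x (snd (snd t))) (fst t # fst (snd t)))))"
    unfolding insort_key.simps if_distrib[of "\<lambda>l. enc_list (map VSym l)"] not_less[symmetric]
    by (intro poly_time_if poly_time_not poly_time_less poly_time_list_cons poly_time_step_rec ar
        poly_time_step_env'[OF x])
  have "vsize (enc_list (map VSym (insort y xs))) = 4 + vsize (enc_list (map VSym xs))"
    for y and xs :: "'a list" by (induction xs) (auto simp: vsize_enc_list)
  then show "poly_bounded (\<lambda>t. vsize (enc_list (map VSym (fst t :: 'a list))) + env_size (\<rho> (snd t)))
     (\<lambda>t. vsize (enc_list (map VSym (insort (x (snd t)) (fst t)))))"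
    by (intro poly_bounded_le[OF poly_bounded_add[OF poly_bounded_const[of _ 4] poly_bounded_self]]) simp
qed

text \<open>The input lists the alphabet in an arbitrary order, while the learner is a function of
  the set; sorting removes the dependence on the listing.\<close>

lemma poly_time_sort:
  fixes \<rho> :: "'s \<Rightarrow> 'a::linorder val list"
  assumes xs: "poly_time \<rho> (\<lambda>s. enc_list (map VSym (xs s)))"
  shows "poly_time \<rho> (\<lambda>s. enc_list (map VSym (sort (xs s))))"
proof (rule poly_time_list_rec[where F = "\<lambda>s xs. enc_list (map VSym (sort xs))", OF _ xs])
  note ar = poly_time_arity[OF xs]
  show "poly_time \<rho> (\<lambda>s. enc_list (map VSym (sort [])))"
    using poly_time_nil[OF ar] by simp
  have [simp]: "sort (x # xs) = insort x (sort xs)" for x :: 'a and xs by simp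
  show "poly_time (\<lambda>t. enc_list (map VSym (sort (fst (snd t)))) # VSym (fst t) #
        enc_list (map VSym (fst (snd t))) # \<rho> (snd (snd t)))
      (\<lambda>t. enc_list (map VSym (sort (fst t # fst (snd t)))))"
    unfolding \<open>sort (_ # _) = _\<close> by (intro poly_time_insort poly_time_step_rec ar)
  have *: "vsize (enc_list (map VSym xs)) = 1 + 4 * length xs" for xs :: "'a list"
    by (induction xs) auto
  then show "poly_bounded (\<lambda>t. vsize (enc_list (map VSym (fst t :: 'a list))) + env_size (\<rho> (snd t)))
     (\<lambda>t. vsize (enc_list (map VSym (sort (fst t)))))"
    by (intro poly_bounded_le[OF poly_bounded_self]) (simp add: *)
qed

section \<open>Languages of expressions\<close>

lemma disj_lang_iff:
  "w \<in> disj_lang D \<longleftrightarrow> (\<exists>a M i. (a, M) \<in> set D \<and> i \<in> mult_set M \<and> w = replicate_mset i a)"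
  unfolding disj_lang_def symbol_lang_def by blast

lemma set_mset_sum_list: "set_mset (sum_list ws) = (\<Union>w\<in>set ws. set_mset w)"
  by (induction ws) auto

definition live_symbols :: "'a disj \<Rightarrow> 'a set" where
  "live_symbols D = {a. \<exists>M. (a, M) \<in> set D \<and> M \<noteq> MZero}"

lemma live_symbols_subset: "live_symbols D \<subseteq> fst ` set D"
  unfolding live_symbols_def by force

lemma disj_lang_subset: "w \<in> disj_lang D \<Longrightarrow> set_mset w \<subseteq> live_symbols D"
  unfolding disj_lang_iff live_symbols_def by (auto split: if_splits)

lemma power_lang_subset: "w \<in> power_lang D M \<Longrightarrow> set_mset w \<subseteq> live_symbols D"
  unfolding power_lang_def using disj_lang_subset by (fastforce simp: set_mset_sum_list)

lemma singleton_in_disj_lang: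
  assumes "a \<in> live_symbols D"
  shows "{#a#} \<in> disj_lang D"
proof -
  obtain M where M: "(a, M) \<in> set D" "M \<noteq> MZero" using assms unfolding live_symbols_def by blast
  then have "1 \<in> mult_set M" by (cases M) auto
  then show ?thesis unfolding disj_lang_iff using M by (metis replicate_mset_Suc replicate_mset_0 One_nat_def)
qed

text \<open>Every nonzero multiplicity contains 1, so each live symbol is a word of \<open>D\<close>
  by itself. Under an outer \<open>*\<close> or \<open>+\<close> the inner multiplicities thus no
  longer restrict the counts.\<close>

lemma sum_of_singletons:
  assumes "set_mset w \<subseteq> live_symbols D"
  shows "\<exists>ws. sum_list ws = w \<and> length ws = size w \<and> set ws \<subseteq> disj_lang D"
  using assms
proof (induction w)
  case empty
  show ?case by (rule exI[of _ "[]"]) simp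
next
  case (add a w)
  then obtain ws where "sum_list ws = w" "length ws = size w" "set ws \<subseteq> disj_lang D" by auto
  moreover have "{#a#} \<in> disj_lang D" using add.prems by (intro singleton_in_disj_lang) simp
  ultimately show ?case by (intro exI[of _ "{#a#} # ws"]) simp
qed

lemma power_lang_zero: "power_lang D MZero = {{#}}"
  unfolding power_lang_def by auto

lemma power_lang_one: "power_lang D MOne = disj_lang D"
proof (intro equalityI subsetI)
  fix w assume "w \<in> power_lang D MOne"
  then show "w \<in> disj_lang D" unfolding power_lang_def by (auto simp: length_Suc_conv)
next
  fix w assume "w \<in> disj_lang D"
  then show "w \<in> power_lang D MOne" unfolding power_lang_def by (auto intro!: exI[of _ "[w]"])
qed

lemma power_lang_opt: "power_lang D MOpt = insert {#} (disj_lang D)"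
proof -
  have "power_lang D MOpt = power_lang D MZero \<union> power_lang D MOne"
    unfolding power_lang_def mult_set.simps by blast
  then show ?thesis by (simp add: power_lang_zero power_lang_one)
qed

lemma power_lang_star: "power_lang D MStar = {w. set_mset w \<subseteq> live_symbols D}"
proof -
  have "w \<in> power_lang D MStar" if "set_mset w \<subseteq> live_symbols D" for w
    using sum_of_singletons[OF that] unfolding power_lang_def by auto
  then show ?thesis using power_lang_subset by blast
qed

text \<open>A sum of at least one word is empty only if every summand is, so for the empty word it
  matters whether \<open>D\<close> itself admits it.\<close>

lemma power_lang_plus:
  "power_lang D MPlus = {w. set_mset w \<subseteq> live_symbols D \<and> (w \<noteq> {#} \<or> {#} \<in> disj_lang D)}"
proof -
  have "w \<in> power_lang D MPlus" if "set_mset w \<subseteq> live_symbols D" "w \<noteq> {#}" for w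
    using sum_of_singletons[OF that(1)] that(2) unfolding power_lang_def
    by (auto simp: Suc_le_eq nonempty_has_size)
  moreover have "{#} \<in> power_lang D MPlus" if "{#} \<in> disj_lang D"
    using that unfolding power_lang_def by (auto intro!: exI[of _ "[{#}]"])
  moreover have "{#} \<in> disj_lang D" if "{#} \<in> power_lang D MPlus"
  proof -
    obtain ws where "sum_list ws = {#}" "length ws \<ge> 1" "set ws \<subseteq> disj_lang D"
      using \<open>{#} \<in> power_lang D MPlus\<close> unfolding power_lang_def by auto
    then show ?thesis by (cases ws) auto
  qed
  ultimately show ?thesis using power_lang_subset by blast
qed

lemma dme_symbols_simps [simp]:
  "dme_symbols [] = []"
  "dme_symbols ((D, M) # E) = map fst D @ dme_symbols E"
  by (simp_all add: dme_symbols_def)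

lemma dme_lang_subset: "w \<in> dme_lang E \<Longrightarrow> set_mset w \<subseteq> set (dme_symbols E)"
proof (induction E arbitrary: w rule: dme_lang.induct)
  case (2 D M E)
  then obtain w1 w2 where "w = w1 + w2" "w1 \<in> power_lang D M" "w2 \<in> dme_lang E" by auto
  then show ?case
    using 2 power_lang_subset[of w1 D M] live_symbols_subset[of D] by auto
qed simp

lemma filter_mset_cong_set: "(\<And>x. x \<in># w \<Longrightarrow> P x = Q x) \<Longrightarrow> filter_mset P w = filter_mset Q w"
  by (rule filter_mset_cong) simp_all

lemma filter_mset_all: "set_mset w \<subseteq> A \<Longrightarrow> filter_mset (\<lambda>x. x \<in> A) w = w"
  by (auto simp: filter_mset_eq_conv)

lemma filter_mset_none: "set_mset w \<inter> A = {} \<Longrightarrow> filter_mset (\<lambda>x. x \<in> A) w = {#}"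
  by (auto simp: multiset_eq_iff count_eq_zero_iff)

text \<open>No symbol occurs in two factors, so a word splits among the factors in only one way and
  membership can be tested factor by factor.\<close>

lemma dme_lang_iff:
  assumes "distinct (dme_symbols E)"
  shows "w \<in> dme_lang E \<longleftrightarrow> set_mset w \<subseteq> set (dme_symbols E) \<and>
    (\<forall>(D, M) \<in> set E. filter_mset (\<lambda>x. x \<in> fst ` set D) w \<in> power_lang D M)"
  using assms
proof (induction E arbitrary: w rule: dme_lang.induct)
  case 1
  then show ?case by auto
next
  case (2 D M E)
  let ?A = "fst ` set D" and ?R = "set (dme_symbols E)"
  have dis: "?A \<inter> ?R = {}" and d: "distinct (dme_symbols E)" using 2 by auto
  have sub: "fst ` set D' \<subseteq> ?R" if "(D', M') \<in> set E" for D' M'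
    using that by (force simp: dme_symbols_def)
  have filt: "filter_mset (\<lambda>x. x \<in> fst ` set D') (filter_mset (\<lambda>x. x \<in> ?R) w) =
      filter_mset (\<lambda>x. x \<in> fst ` set D') w" if "(D', M') \<in> set E" for D' M' w
    using sub[OF that] by (auto simp: filter_filter_mset intro: filter_mset_cong)
  show ?case
  proof
    assume "w \<in> dme_lang ((D, M) # E)"
    then obtain w1 w2 where w: "w = w1 + w2" "w1 \<in> power_lang D M" "w2 \<in> dme_lang E" by auto
    have s: "set_mset w1 \<subseteq> ?A" "set_mset w2 \<subseteq> ?R"
      using w power_lang_subset[of w1 D M] live_symbols_subset[of D] dme_lang_subset[of w2 E] by auto
    then have eq: "filter_mset (\<lambda>x. x \<in> ?A) w = w1" "filter_mset (\<lambda>x. x \<in> ?R) w = w2"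
      using dis filter_mset_none[of w2 ?A] filter_mset_none[of w1 ?R]
      by (auto simp: w(1) filter_mset_all)
    have IH: "\<forall>(D, M) \<in> set E. filter_mset (\<lambda>x. x \<in> fst ` set D) w2 \<in> power_lang D M"
      using 2 d w(3) by blast
    have "filter_mset (\<lambda>x. x \<in> fst ` set D') w \<in> power_lang D' M'" if "(D', M') \<in> set E" for D' M'
      using filt[OF that, of w, symmetric] IH that unfolding eq by auto
    moreover have "set_mset w \<subseteq> ?A \<union> ?R" using s w(1) by auto
    ultimately show "set_mset w \<subseteq> set (dme_symbols ((D, M) # E)) \<and>
      (\<forall>(D, M) \<in> set ((D, M) # E). filter_mset (\<lambda>x. x \<in> fst ` set D) w \<in> power_lang D M)"
      using w(2) by (auto simp: eq)
  next
    assume R: "set_mset w \<subseteq> set (dme_symbols ((D, M) # E)) \<and>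
      (\<forall>(D, M) \<in> set ((D, M) # E). filter_mset (\<lambda>x. x \<in> fst ` set D) w \<in> power_lang D M)"
    let ?w1 = "filter_mset (\<lambda>x. x \<in> ?A) w" and ?w2 = "filter_mset (\<lambda>x. x \<in> ?R) w"
    have "filter_mset (\<lambda>x. x \<in> fst ` set D') ?w2 \<in> power_lang D' M'" if "(D', M') \<in> set E" for D' M'
      using R that unfolding filt[OF that] by auto
    then have "?w2 \<in> dme_lang E" using 2 d by auto
    moreover have "?w1 \<in> power_lang D M" using R by simp
    moreover have "w = ?w1 + ?w2"
    proof -
      have "filter_mset (\<lambda>x. x \<notin> ?A) w = ?w2"
        using R dis by (intro filter_mset_cong_set) auto
      then show ?thesis using multiset_partition[of w "\<lambda>x. x \<in> ?A"] by simp
    qed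
    ultimately show "w \<in> dme_lang ((D, M) # E)" by auto
  qed
qed

section \<open>A normal form for the languages of expressions\<close>

text \<open>The language of an expression, restricted to a subalphabet, always has this form, where the sets
  in \<open>\<C>\<close> come from the disjunctions that are not repeated.\<close>

definition shape_lang :: "'a set \<Rightarrow> 'a set set \<Rightarrow> 'a set set \<Rightarrow> 'a set \<Rightarrow> 'a multiset set" where
  "shape_lang X \<C> \<Q> Mx = {w. set_mset w \<subseteq> X \<and> (\<forall>a\<in>Mx. count w a \<le> 1) \<and>
     (\<forall>C\<in>\<C>. \<forall>a\<in>C. \<forall>b\<in>C. a \<in># w \<longrightarrow> b \<in># w \<longrightarrow> a = b) \<and> (\<forall>Q\<in>\<Q>. \<exists>a\<in>Q. a \<in># w)}"

text \<open>The conditions make the data recoverable from the language. A single symbol excludes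
  nothing, so classes have two elements. A required set is a class, from a factor that chooses
  exactly one symbol, or else it comes from a repeated factor \<open>D^+\<close> or from a single
  required symbol. Only in the last case can its counts be bounded, which is
  \<open>\<Q>_Mx\<close>.\<close>

locale shape =
  fixes X :: "'a set" and \<C> \<Q> :: "'a set set" and Mx :: "'a set"
  assumes finite_X: "finite X" and \<C>_X: "\<Union>\<C> \<subseteq> X" and \<Q>_X: "\<Union>\<Q> \<subseteq> X" and Mx_X: "Mx \<subseteq> X"
    and \<C>_disjoint: "\<lbrakk>C \<in> \<C>; C' \<in> \<C>; a \<in> C; a \<in> C'\<rbrakk> \<Longrightarrow> C = C'"
    and \<Q>_disjoint: "\<lbrakk>Q \<in> \<Q>; Q' \<in> \<Q>; a \<in> Q; a \<in> Q'\<rbrakk> \<Longrightarrow> Q = Q'"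
    and \<Q>_nonempty: "Q \<in> \<Q> \<Longrightarrow> \<exists>a. a \<in> Q"
    and \<C>_two: "C \<in> \<C> \<Longrightarrow> \<exists>a\<in>C. \<exists>b\<in>C. a \<noteq> b"
    and \<Q>_\<C>: "\<lbrakk>Q \<in> \<Q>; Q \<notin> \<C>; a \<in> Q\<rbrakk> \<Longrightarrow> a \<notin> \<Union>\<C>"
    and \<Q>_Mx: "\<lbrakk>Q \<in> \<Q>; Q \<notin> \<C>; a \<in> Q; a \<in> Mx\<rbrakk> \<Longrightarrow> Q = {a}"

definition shapely :: "'a set \<Rightarrow> 'a multiset set \<Rightarrow> bool" where
  "shapely X L \<longleftrightarrow> (\<exists>\<C> \<Q> Mx. shape X \<C> \<Q> Mx \<and> L = shape_lang X \<C> \<Q> Mx)"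

lemma shapelyI: "shape X \<C> \<Q> Mx \<Longrightarrow> L = shape_lang X \<C> \<Q> Mx \<Longrightarrow> shapely X L"
  unfolding shapely_def by blast

lemma shapely_sum:
  assumes "shapely X1 L1" "shapely X2 L2" "X1 \<inter> X2 = {}"
  shows "shapely (X1 \<union> X2) {u + v |u v. u \<in> L1 \<and> v \<in> L2}"
proof -
  obtain C1 Q1 M1 where s1: "shape X1 C1 Q1 M1" and L1: "L1 = shape_lang X1 C1 Q1 M1"
    using assms(1) unfolding shapely_def by blast
  obtain C2 Q2 M2 where s2: "shape X2 C2 Q2 M2" and L2: "L2 = shape_lang X2 C2 Q2 M2"
    using assms(2) unfolding shapely_def by blast
  interpret s1: shape X1 C1 Q1 M1 by fact
  interpret s2: shape X2 C2 Q2 M2 by fact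
  have d: "a \<notin> X2" if "a \<in> X1" for a using assms(3) that by blast
  have X12: "\<And>C a. C \<in> C1 \<Longrightarrow> a \<in> C \<Longrightarrow> a \<in> X1" "\<And>C a. C \<in> C2 \<Longrightarrow> a \<in> C \<Longrightarrow> a \<in> X2"
    "\<And>C a. C \<in> Q1 \<Longrightarrow> a \<in> C \<Longrightarrow> a \<in> X1" "\<And>C a. C \<in> Q2 \<Longrightarrow> a \<in> C \<Longrightarrow> a \<in> X2"
    "\<And>a. a \<in> M1 \<Longrightarrow> a \<in> X1" "\<And>a. a \<in> M2 \<Longrightarrow> a \<in> X2"
    using s1.\<C>_X s2.\<C>_X s1.\<Q>_X s2.\<Q>_X s1.Mx_X s2.Mx_X by blast+
  have "shape (X1 \<union> X2) (C1 \<union> C2) (Q1 \<union> Q2) (M1 \<union> M2)"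
  proof
    show "finite (X1 \<union> X2)" using s1.finite_X s2.finite_X by simp
    show "\<Union> (C1 \<union> C2) \<subseteq> X1 \<union> X2" "\<Union> (Q1 \<union> Q2) \<subseteq> X1 \<union> X2" "M1 \<union> M2 \<subseteq> X1 \<union> X2"
      using X12 by blast+
    show "C = C'" if "C \<in> C1 \<union> C2" "C' \<in> C1 \<union> C2" "a \<in> C" "a \<in> C'" for C C' a
      using that s1.\<C>_disjoint s2.\<C>_disjoint X12 d by (metis UnE)
    show "C = C'" if "C \<in> Q1 \<union> Q2" "C' \<in> Q1 \<union> Q2" "a \<in> C" "a \<in> C'" for C C' a
      using that s1.\<Q>_disjoint s2.\<Q>_disjoint X12 d by (metis UnE)
    show "\<exists>a. a \<in> Q" if "Q \<in> Q1 \<union> Q2" for Q using that s1.\<Q>_nonempty s2.\<Q>_nonempty by blast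
    show "\<exists>a\<in>C. \<exists>b\<in>C. a \<noteq> b" if "C \<in> C1 \<union> C2" for C using that s1.\<C>_two s2.\<C>_two by blast
    show "a \<notin> \<Union> (C1 \<union> C2)" if "Q \<in> Q1 \<union> Q2" "Q \<notin> C1 \<union> C2" "a \<in> Q" for Q a
    proof (cases "Q \<in> Q1")
      case True
      then have "a \<notin> \<Union>C1" "a \<notin> X2" using that s1.\<Q>_\<C>[of Q a] X12(3) d by simp_all
      then show ?thesis using X12(2) by blast
    next
      case False
      then have "a \<notin> \<Union>C2" "a \<notin> X1" using that s2.\<Q>_\<C>[of Q a] X12(4)[of Q a] d by auto
      then show ?thesis using X12(1) by blast
    qed
    show "Q = {a}" if "Q \<in> Q1 \<union> Q2" "Q \<notin> C1 \<union> C2" "a \<in> Q" "a \<in> M1 \<union> M2" for Q a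
    proof (cases "Q \<in> Q1")
      case True
      then have "a \<in> M1" using that X12(3) X12(6) d by blast
      then show ?thesis using True that s1.\<Q>_Mx[of Q a] by simp
    next
      case False
      then have "a \<in> M2" using that X12(4)[of Q a] X12(5) d by blast
      then show ?thesis using False that s2.\<Q>_Mx[of Q a] by simp
    qed
  qed
  moreover have "{u + v |u v. u \<in> L1 \<and> v \<in> L2} = shape_lang (X1 \<union> X2) (C1 \<union> C2) (Q1 \<union> Q2) (M1 \<union> M2)"
    (is "?L = ?R")
  proof (intro equalityI subsetI)
    fix w assume "w \<in> ?L"
    then obtain u v where w: "w = u + v" and u: "u \<in> shape_lang X1 C1 Q1 M1"
      and v: "v \<in> shape_lang X2 C2 Q2 M2" by (auto simp: L1 L2)
    have nv: "a \<notin># v" if "a \<in> X1" for a using v d[OF that] by (auto simp: shape_lang_def)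
    have nu: "a \<notin># u" if "a \<in> X2" for a using u d that by (auto simp: shape_lang_def)
    show "w \<in> ?R"
      unfolding w shape_lang_def mem_Collect_eq
    proof (intro conjI ballI impI)
      show "set_mset (u + v) \<subseteq> X1 \<union> X2" using u v by (auto simp: shape_lang_def)
      show "count (u + v) a \<le> 1" if "a \<in> M1 \<union> M2" for a
      proof (cases "a \<in> M1")
        case True
        then show ?thesis using u nv X12(5) by (simp add: shape_lang_def count_eq_zero_iff[THEN iffD2])
      next
        case False
        then show ?thesis using that v nu X12(6) by (simp add: shape_lang_def count_eq_zero_iff[THEN iffD2])
      qed
      show "a = b" if "C \<in> C1 \<union> C2" "a \<in> C" "b \<in> C" "a \<in># u + v" "b \<in># u + v" for C a b
      proof (cases "C \<in> C1")
        case True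
        then have "a \<in># u" "b \<in># u" using that nv X12(1)[OF True] by auto
        then show ?thesis using u True that(2,3) unfolding shape_lang_def by blast
      next
        case False
        then have "a \<in># v" "b \<in># v" using that nu X12(2) by auto
        then show ?thesis using v False that(1-3) unfolding shape_lang_def by blast
      qed
      show "\<exists>a\<in>Q. a \<in># u + v" if "Q \<in> Q1 \<union> Q2" for Q
        using that u v unfolding shape_lang_def by auto
    qed
  next
    fix w assume w: "w \<in> ?R"
    let ?u = "filter_mset (\<lambda>x. x \<in> X1) w" and ?v = "filter_mset (\<lambda>x. x \<in> X2) w"
    have "filter_mset (\<lambda>x. x \<notin> X1) w = ?v"
      using w d by (intro filter_mset_cong_set) (auto simp: shape_lang_def)
    then have "w = ?u + ?v" using multiset_partition[of w "\<lambda>x. x \<in> X1"] by simp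
    moreover have "?u \<in> L1"
      unfolding L1 shape_lang_def mem_Collect_eq
    proof (intro conjI ballI impI)
      show "\<exists>a\<in>Q. a \<in># ?u" if "Q \<in> Q1" for Q
        using w that X12(3)[OF that] by (fastforce simp: shape_lang_def)
      show "a = b" if "C \<in> C1" "a \<in> C" "b \<in> C" "a \<in># ?u" "b \<in># ?u" for C a b
        using w that by (simp add: shape_lang_def) blast
      show "count ?u a \<le> 1" if "a \<in> M1" for a using w that by (simp add: shape_lang_def)
    qed auto
    moreover have "?v \<in> L2"
      unfolding L2 shape_lang_def mem_Collect_eq
    proof (intro conjI ballI impI)
      show "\<exists>a\<in>Q. a \<in># ?v" if "Q \<in> Q2" for Q
        using w that X12(4)[OF that] by (fastforce simp: shape_lang_def)
      show "a = b" if "C \<in> C2" "a \<in> C" "b \<in> C" "a \<in># ?v" "b \<in># ?v" for C a b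
        using w that by (simp add: shape_lang_def) blast
      show "count ?v a \<le> 1" if "a \<in> M2" for a using w that by (simp add: shape_lang_def)
    qed auto
    ultimately show "w \<in> ?L" by blast
  qed
  ultimately show ?thesis by (rule shapelyI)
qed

text \<open>Under outer \<open>*\<close> or \<open>+\<close> the inner multiplicities disappear and
  at most a required set remains; under \<open>1\<close> or \<open>?\<close> each word uses at most
  one symbol, which gives a class. Nonemptiness rules out a required set of which no symbol is left
  in \<open>U\<close>.\<close>

lemma shapely_power:
  assumes dist: "distinct (map fst D)" and ne: "{w \<in> power_lang D M. set_mset w \<subseteq> U} \<noteq> {}"
  shows "\<exists>X \<subseteq> fst ` set D. shapely X {w \<in> power_lang D M. set_mset w \<subseteq> U}"
proof -
  let ?L = "{w \<in> power_lang D M. set_mset w \<subseteq> U}"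
  let ?X = "live_symbols D \<inter> U"
  have X: "?X \<subseteq> fst ` set D" by (rule le_infI1[OF live_symbols_subset])
  have fin: "finite ?X" by (rule finite_subset[OF X]) simp
  have free: "shapely Y {w. set_mset w \<subseteq> Y}" if "finite Y" for Y
  proof -
    have "shape Y {} {} {}" by unfold_locales (simp_all add: that)
    moreover have "{w. set_mset w \<subseteq> Y} = shape_lang Y {} {} {}" by (simp add: shape_lang_def)
    ultimately show ?thesis by (rule shapelyI)
  qed
  show ?thesis
  proof (cases "M = MOne \<or> M = MOpt")
    case False
    then consider "M = MZero" | "?L = {w. set_mset w \<subseteq> ?X}"
      | "?L = {w. set_mset w \<subseteq> ?X \<and> w \<noteq> {#}}"
      by (cases M) (auto simp: power_lang_zero power_lang_star power_lang_plus)
    then show ?thesis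
    proof cases
      case 1
      then have "?L = {w. set_mset w \<subseteq> {}}" by (auto simp: power_lang_zero)
      then show ?thesis using free[of "{}"] by auto
    next
      case 2
      show ?thesis unfolding 2 using free[OF fin] X by (intro exI[of _ ?X] conjI)
    next
      case 3
      have "?X \<noteq> {}" using ne unfolding 3 by (metis (mono_tags, lifting) Collect_empty_eq set_mset_eq_empty_iff subset_empty)
      then have sh: "shape ?X {} {?X} {}" by unfold_locales (use fin in auto)
      have *: "\<exists>a\<in>?X. a \<in># w" if "set_mset w \<subseteq> ?X" "w \<noteq> {#}" for w
        using that by (meson multiset_nonemptyE subsetD)
      have "?L = shape_lang ?X {} {?X} {}"
        unfolding 3 shape_lang_def using * by auto
      from shapelyI[OF sh this] have "shapely ?X ?L" .
      then show ?thesis using X by (intro exI[of _ ?X] conjI)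
    qed
  next
    case True
    \<comment> \<open>The empty word can come from an outer \<open>?\<close> as well as from an
      inner multiplicity containing 0, so it is tested in the language and not in the
      syntax.\<close>
    define null where "null \<longleftrightarrow> {#} \<in> ?L"
    define Mx where "Mx = {a \<in> ?X. (a, MOne) \<in> set D \<or> (a, MOpt) \<in> set D}"
    have uniq: "N = N'" if "(a, N) \<in> set D" "(a, N') \<in> set D" for a N N'
      using that dist by (simp add: eq_key_imp_eq_value)
    have L: "w \<in> ?L \<longleftrightarrow> (if w = {#} then null else
        \<exists>a \<in> ?X. set_mset w = {a} \<and> (a \<in> Mx \<longrightarrow> count w a \<le> 1))" for w
    proof (cases "w = {#}")
      case True
      then show ?thesis by (simp add: null_def)
    next
      case ne: False
      have "w \<in> ?L \<longleftrightarrow> w \<in> disj_lang D \<and> set_mset w \<subseteq> U"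
        using True ne by (auto simp: power_lang_one power_lang_opt)
      also have "\<dots> \<longleftrightarrow> (\<exists>a \<in> ?X. set_mset w = {a} \<and> (a \<in> Mx \<longrightarrow> count w a \<le> 1))"
      proof
        assume w: "w \<in> disj_lang D \<and> set_mset w \<subseteq> U"
        then obtain a N i where "(a, N) \<in> set D" "i \<in> mult_set N" "w = replicate_mset i a"
          unfolding disj_lang_iff by blast
        then show "\<exists>a \<in> ?X. set_mset w = {a} \<and> (a \<in> Mx \<longrightarrow> count w a \<le> 1)"
          using ne w uniq unfolding Mx_def
          by (intro bexI[of _ a]) (auto simp: live_symbols_def split: if_splits dest: uniq)
      next
        assume "\<exists>a \<in> ?X. set_mset w = {a} \<and> (a \<in> Mx \<longrightarrow> count w a \<le> 1)"
        then obtain a where a: "a \<in> ?X" "set_mset w = {a}" "a \<in> Mx \<longrightarrow> count w a \<le> 1" by blast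
        then have w: "w = replicate_mset (count w a) a"
          by (auto simp: multiset_eq_iff count_eq_zero_iff)
        have pos: "count w a \<ge> 1" using a by (simp add: Suc_le_eq)
        obtain N where N: "(a, N) \<in> set D" "N \<noteq> MZero" using a unfolding live_symbols_def by blast
        obtain i where i: "count w a = Suc i" using pos by (cases "count w a") auto
        have "count w a \<in> mult_set N"
          using N a(1,3) unfolding Mx_def i by (cases N) auto
        then show "w \<in> disj_lang D \<and> set_mset w \<subseteq> U" using N w a unfolding disj_lang_iff by auto
      qed
      finally show ?thesis using ne by simp
    qed
    \<comment> \<open>With a single symbol left nothing is excluded, and the normal form admits no
      such class.\<close>
    define \<C> where "\<C> = (if \<exists>a\<in>?X. \<exists>b\<in>?X. a \<noteq> b then {?X} else {})"
    define \<Q> where "\<Q> = (if null then {} else {?X})"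
    have X_ne: "?X \<noteq> {}" if "\<not> null"
    proof -
      obtain w where w: "w \<in> ?L" using ne by blast
      then have "w \<noteq> {#}" using that null_def by blast
      then show ?thesis using w unfolding L by auto
    qed
    have X_single: "?X = {a}" if "?X \<notin> \<C>" "a \<in> ?X" for a
      using that by (auto simp: \<C>_def split: if_splits)
    have sh: "shape ?X \<C> \<Q> Mx"
    proof
      show "Q = {a}" if "Q \<in> \<Q>" "Q \<notin> \<C>" "a \<in> Q" "a \<in> Mx" for Q a
        using that X_single by (auto simp: \<Q>_def split: if_splits)
      show "a \<notin> \<Union>\<C>" if "Q \<in> \<Q>" "Q \<notin> \<C>" "a \<in> Q" for Q a
        using that by (auto simp: \<Q>_def \<C>_def split: if_splits)
      show "\<exists>a. a \<in> Q" if "Q \<in> \<Q>" for Q using that X_ne by (auto simp: \<Q>_def split: if_splits)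
    qed (use fin in \<open>auto simp: \<C>_def \<Q>_def Mx_def split: if_splits\<close>)
    have "?L = shape_lang ?X \<C> \<Q> Mx"
    proof (rule set_eqI)
      fix w
      have one: "(\<forall>C\<in>\<C>. \<forall>a\<in>C. \<forall>b\<in>C. a \<in># w \<longrightarrow> b \<in># w \<longrightarrow> a = b) \<longleftrightarrow>
          (\<forall>a\<in>?X. \<forall>b\<in>?X. a \<in># w \<longrightarrow> b \<in># w \<longrightarrow> a = b)"
        by (auto simp: \<C>_def)
      show "w \<in> ?L \<longleftrightarrow> w \<in> shape_lang ?X \<C> \<Q> Mx"
      proof (cases "w = {#}")
        case True
        then show ?thesis unfolding L by (auto simp: shape_lang_def \<Q>_def)
      next
        case False
        then obtain c where c: "c \<in># w" by (meson multiset_nonemptyE)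
        show ?thesis unfolding L shape_lang_def mem_Collect_eq one
        proof (simp only: False if_False, intro iffI)
          assume "\<exists>a\<in>?X. set_mset w = {a} \<and> (a \<in> Mx \<longrightarrow> count w a \<le> 1)"
          then obtain a where a: "a \<in> ?X" "set_mset w = {a}" "a \<in> Mx \<longrightarrow> count w a \<le> 1" by blast
          have "count w b \<le> 1" if "b \<in> Mx" for b
            using a that by (cases "b = a") (auto simp: count_eq_zero_iff[THEN iffD2])
          then show "set_mset w \<subseteq> ?X \<and> (\<forall>a\<in>Mx. count w a \<le> 1) \<and>
             (\<forall>a\<in>?X. \<forall>b\<in>?X. a \<in># w \<longrightarrow> b \<in># w \<longrightarrow> a = b) \<and> (\<forall>Q\<in>\<Q>. \<exists>a\<in>Q. a \<in># w)"
            using a by (auto simp: \<Q>_def)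
        next
          assume R: "set_mset w \<subseteq> ?X \<and> (\<forall>a\<in>Mx. count w a \<le> 1) \<and>
             (\<forall>a\<in>?X. \<forall>b\<in>?X. a \<in># w \<longrightarrow> b \<in># w \<longrightarrow> a = b) \<and> (\<forall>Q\<in>\<Q>. \<exists>a\<in>Q. a \<in># w)"
          then have "set_mset w = {c}" using c by blast
          then show "\<exists>a\<in>?X. set_mset w = {a} \<and> (a \<in> Mx \<longrightarrow> count w a \<le> 1)" using R c by blast
        qed
      qed
    qed
    from shapelyI[OF sh this] have "shapely ?X ?L" .
      then show ?thesis using X by (intro exI[of _ ?X] conjI)
  qed
qed

lemma shapely_dme:
  assumes "distinct (dme_symbols E)" "{w \<in> dme_lang E. set_mset w \<subseteq> U} \<noteq> {}"
  shows "\<exists>X \<subseteq> set (dme_symbols E). shapely X {w \<in> dme_lang E. set_mset w \<subseteq> U}"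
  using assms
proof (induction E rule: dme_lang.induct)
  case 1
  have "shape {} {} {} ({} :: 'a set)" by unfold_locales auto
  moreover have "{w \<in> dme_lang []. set_mset w \<subseteq> U} = shape_lang {} {} {} {}"
    by (auto simp: shape_lang_def)
  ultimately show ?case unfolding shapely_def by (intro exI[of _ "{}"]) auto
next
  case (2 D M E)
  let ?L1 = "{w \<in> power_lang D M. set_mset w \<subseteq> U}" and ?L2 = "{w \<in> dme_lang E. set_mset w \<subseteq> U}"
  have eq: "{w \<in> dme_lang ((D, M) # E). set_mset w \<subseteq> U} = {u + v |u v. u \<in> ?L1 \<and> v \<in> ?L2}"
    by (simp add: set_eq_iff) (metis set_mset_union Un_subset_iff)
  have ne: "?L1 \<noteq> {}" "?L2 \<noteq> {}" using 2(3) unfolding eq by blast+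
  have d: "distinct (map fst D)" "distinct (dme_symbols E)"
    "fst ` set D \<inter> set (dme_symbols E) = {}" using 2(2) by auto
  obtain X1 where X1: "X1 \<subseteq> fst ` set D" "shapely X1 ?L1" using shapely_power[OF d(1) ne(1)] by blast
  obtain X2 where X2: "X2 \<subseteq> set (dme_symbols E)" "shapely X2 ?L2" using 2(1)[OF d(2) ne(2)] by blast
  have "X1 \<inter> X2 = {}" using d(3) X1(1) X2(1) by blast
  from shapely_sum[OF X1(2) X2(2) this] have "shapely (X1 \<union> X2) {u + v |u v. u \<in> ?L1 \<and> v \<in> ?L2}" .
  moreover have "X1 \<union> X2 \<subseteq> set (dme_symbols ((D, M) # E))" using X1(1) X2(1) by auto
  ultimately show ?case unfolding eq by (intro exI[of _ "X1 \<union> X2"] conjI)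
qed

section \<open>Characteristic words\<close>

context shape begin

definition blocks :: "'a set set" where "blocks = \<Q> - \<C>"

definition free_part :: "'a set" where "free_part = X - \<Union>\<C>"

definition pick :: "'a set \<Rightarrow> 'a" where "pick C = (SOME a. a \<in> C)"

definition elem :: "'a set \<Rightarrow> nat \<Rightarrow> 'a" where
  "elem A i = (SOME l. set l = A \<and> distinct l) ! i"

text \<open>Two copies are enough to exhibit a symbol outside \<open>Mx\<close> as
  \<open>repeated\<close>.\<close>

definition word :: "'a set \<Rightarrow> 'a multiset" where
  "word S = mset_set S + mset_set (S - Mx)"

text \<open>Shows that \<open>a\<close> and \<open>b\<close> cooccur; with \<open>a = b\<close> also
  that the symbol occurs and, through \<open>word\<close>, whether it may repeat. All of
  \<open>free_part\<close> is present so that every block is met, and the picks serve the remaining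
  classes.\<close>

definition pair_support :: "'a \<Rightarrow> 'a \<Rightarrow> 'a set" where
  "pair_support a b = free_part \<union> {a, b} \<union> pick ` {C\<in>\<C>. a \<notin> C \<and> b \<notin> C}"

text \<open>Meets a class only if the class is required, so that every optional one is
  missed.\<close>

definition min_support :: "'a set" where
  "min_support = free_part \<union> pick ` (\<C> \<inter> \<Q>)"

definition max_support :: "'a \<Rightarrow> 'a set" where
  "max_support a = (free_part - (\<Union>{A\<in>blocks. a \<in> A} - {a})) \<union> pick ` \<C>"

text \<open>The choice in the block of \<open>a\<close> is fixed, the other choices rotate with
  \<open>t\<close>. The intersection drops an \<open>a\<close> outside all blocks, so that apart
  from the picks only symbols of blocks occur.\<close>

definition transversal :: "'a \<Rightarrow> nat \<Rightarrow> 'a set" where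
  "transversal a t = pick ` \<C> \<union> ({a} \<inter> \<Union>blocks) \<union> (\<lambda>A. elem A (t mod card A)) ` {A\<in>blocks. a \<notin> A}"

definition char_supports :: "nat \<Rightarrow> 'a set set" where
  "char_supports n =
     (\<lambda>(a, b). pair_support a b) ` {(a, b) \<in> X \<times> X. \<forall>C\<in>\<C>. a \<in> C \<longrightarrow> b \<in> C \<longrightarrow> a = b} \<union>
     {min_support} \<union> max_support ` X \<union> (\<lambda>(a, t). transversal a t) ` (X \<times> {..<n\<^sup>2})"

definition char_words :: "nat \<Rightarrow> 'a multiset set" where
  "char_words n = word ` char_supports n"

lemma finite_\<C>: "finite \<C>" "C \<in> \<C> \<Longrightarrow> finite C"
  using \<C>_X finite_X by (auto intro: finite_UnionD finite_subset)

lemma finite_block: "A \<in> blocks \<Longrightarrow> finite A"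
  using \<Q>_X finite_X by (auto simp: blocks_def intro: finite_subset)

lemma block_free: "A \<in> blocks \<Longrightarrow> a \<in> A \<Longrightarrow> a \<in> free_part"
  using \<Q>_\<C> \<Q>_X by (auto simp: blocks_def free_part_def)

lemma blocks_disjoint: "\<lbrakk>A \<in> blocks; A' \<in> blocks; a \<in> A; a \<in> A'\<rbrakk> \<Longrightarrow> A = A'"
  using \<Q>_disjoint by (auto simp: blocks_def)

lemma block_nonempty: "A \<in> blocks \<Longrightarrow> A \<noteq> {}"
  using \<Q>_nonempty by (auto simp: blocks_def)

lemma pick_in: "C \<in> \<C> \<Longrightarrow> pick C \<in> C"
  unfolding pick_def using \<C>_two by (metis someI_ex)

lemma pick_eq: "\<lbrakk>C \<in> \<C>; C' \<in> \<C>; pick C \<in> C'\<rbrakk> \<Longrightarrow> C = C'"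
  using pick_in \<C>_disjoint by blast

lemma pick_X: "C \<in> \<C> \<Longrightarrow> pick C \<in> X"
  using pick_in \<C>_X by blast

lemma pick_not_free: "C \<in> \<C> \<Longrightarrow> pick C \<notin> free_part"
  using pick_in by (auto simp: free_part_def)

lemma not_class_free: "\<lbrakk>C \<in> \<C>; a \<in> C\<rbrakk> \<Longrightarrow> a \<notin> free_part"
  by (auto simp: free_part_def)

lemma elem_bij:
  assumes "finite A" shows "bij_betw (elem A) {..<card A} A"
proof -
  define l where "l = (SOME l. set l = A \<and> distinct l)"
  have l: "set l = A" "distinct l"
    unfolding l_def using someI_ex[OF finite_distinct_list[OF assms]] by blast+
  then have "bij_betw ((!) l) {..<card A} A"
    using distinct_card[OF l(2)] by (intro bij_betw_nth) simp_all
  moreover have "elem A = (!) l" by (simp add: fun_eq_iff elem_def l_def)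
  ultimately show ?thesis by simp
qed

lemma elem_in: "A \<in> blocks \<Longrightarrow> elem A (t mod card A) \<in> A"
  using bij_betw_apply[OF elem_bij[OF finite_block], of A "t mod card A"] finite_block[of A]
    block_nonempty[of A] by (simp add: card_gt_0_iff)

lemma set_word: "finite S \<Longrightarrow> set_mset (word S) = S"
  by (auto simp: word_def)

lemma count_word: "finite S \<Longrightarrow> count (word S) a = (if a \<in> S then if a \<in> Mx then 1 else 2 else 0)"
  by (simp add: word_def count_mset_set')

definition valid_support :: "'a set \<Rightarrow> bool" where
  "valid_support S \<longleftrightarrow> S \<subseteq> X \<and> (\<forall>C\<in>\<C>. \<forall>a\<in>C. \<forall>b\<in>C. a \<in> S \<longrightarrow> b \<in> S \<longrightarrow> a = b) \<and>
     (\<forall>C\<in>\<C>\<inter>\<Q>. \<exists>a\<in>C. a \<in> S) \<and> (\<forall>A\<in>blocks. \<exists>a\<in>A. a \<in> S)"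

lemma valid_support_finite: "valid_support S \<Longrightarrow> finite S"
  unfolding valid_support_def using finite_subset[OF _ finite_X] by simp

lemma valid_support_word:
  assumes "valid_support S" shows "word S \<in> shape_lang X \<C> \<Q> Mx"
proof -
  have f: "finite S" using assms by (rule valid_support_finite)
  have "\<exists>a\<in>Q. a \<in> S" if "Q \<in> \<Q>" for Q
    using assms that unfolding valid_support_def blocks_def by blast
  then show ?thesis
    using assms unfolding valid_support_def shape_lang_def
    by (auto simp: set_word[OF f] count_word[OF f])
qed

lemma valid_pair_support:
  assumes "a \<in> X" "b \<in> X" "\<forall>C\<in>\<C>. a \<in> C \<longrightarrow> b \<in> C \<longrightarrow> a = b"
  shows "valid_support (pair_support a b)"
  unfolding valid_support_def
proof (intro conjI ballI impI)
  show "pair_support a b \<subseteq> X"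
    using assms pick_X by (auto simp: pair_support_def free_part_def)
  show "x = y" if "C \<in> \<C>" "x \<in> C" "y \<in> C" "x \<in> pair_support a b" "y \<in> pair_support a b" for C x y
  proof -
    have "z = a \<or> z = b \<or> (a \<notin> C \<and> b \<notin> C \<and> z = pick C)" if "z \<in> C" "z \<in> pair_support a b" for z
      using that \<open>C \<in> \<C>\<close> not_class_free pick_eq unfolding pair_support_def by blast
    from this[of x] this[of y] that assms(3) show ?thesis by blast
  qed
  show "\<exists>x\<in>C. x \<in> pair_support a b" if "C \<in> \<C> \<inter> \<Q>" for C
  proof (cases "a \<in> C \<or> b \<in> C")
    case False
    then have "pick C \<in> pair_support a b" using that by (auto simp: pair_support_def)
    then show ?thesis using pick_in that by blast
  qed (auto simp: pair_support_def)
  show "\<exists>x\<in>A. x \<in> pair_support a b" if "A \<in> blocks" for A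
    using block_nonempty[OF that] block_free[OF that] by (auto simp: pair_support_def)
qed

lemma valid_min_support: "valid_support min_support"
  unfolding valid_support_def
proof (intro conjI ballI impI)
  show "min_support \<subseteq> X" using pick_X by (auto simp: min_support_def free_part_def)
  show "x = y" if "C \<in> \<C>" "x \<in> C" "y \<in> C" "x \<in> min_support" "y \<in> min_support" for C x y
  proof -
    have "z = pick C" if "z \<in> C" "z \<in> min_support" for z
      using that \<open>C \<in> \<C>\<close> not_class_free pick_eq unfolding min_support_def by blast
    from this[of x] this[of y] that show ?thesis by simp
  qed
  show "\<exists>x\<in>C. x \<in> min_support" if "C \<in> \<C> \<inter> \<Q>" for C
    using that pick_in by (auto simp: min_support_def)
  show "\<exists>x\<in>A. x \<in> min_support" if "A \<in> blocks" for A
    using block_nonempty[OF that] block_free[OF that] by (auto simp: min_support_def)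
qed

lemma valid_full_class_support:
  assumes "S \<subseteq> free_part" "\<And>A. A \<in> blocks \<Longrightarrow> \<exists>a\<in>A. a \<in> S"
  shows "valid_support (S \<union> pick ` \<C>)"
  unfolding valid_support_def
proof (intro conjI ballI impI)
  show "S \<union> pick ` \<C> \<subseteq> X" using pick_X assms(1) by (auto simp: free_part_def)
  show "x = y" if "C \<in> \<C>" "x \<in> C" "y \<in> C" "x \<in> S \<union> pick ` \<C>" "y \<in> S \<union> pick ` \<C>" for C x y
  proof -
    have "z = pick C" if "z \<in> C" "z \<in> S \<union> pick ` \<C>" for z
      using that \<open>C \<in> \<C>\<close> not_class_free pick_eq assms(1) by blast
    from this[of x] this[of y] that show ?thesis by simp
  qed
  show "\<exists>x\<in>C. x \<in> S \<union> pick ` \<C>" if "C \<in> \<C> \<inter> \<Q>" for C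
    using that pick_in by auto
  show "\<exists>x\<in>A. x \<in> S \<union> pick ` \<C>" if "A \<in> blocks" for A
    using assms(2)[OF that] by auto
qed

lemma valid_max_support: "valid_support (max_support a)"
  unfolding max_support_def
proof (rule valid_full_class_support)
  show "\<exists>x\<in>A. x \<in> free_part - (\<Union>{A \<in> blocks. a \<in> A} - {a})" if A: "A \<in> blocks" for A
  proof (cases "a \<in> A")
    case True
    then show ?thesis using block_free[OF A] by blast
  next
    case False
    obtain x where "x \<in> A" using block_nonempty[OF A] by blast
    then show ?thesis using block_free[OF A] blocks_disjoint[OF A] False by blast
  qed
qed blast

lemma valid_transversal: "valid_support (transversal a t)"
proof -
  have "transversal a t =
    ({a} \<inter> \<Union>blocks \<union> (\<lambda>A. elem A (t mod card A)) ` {A\<in>blocks. a \<notin> A}) \<union> pick ` \<C>"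
    by (auto simp: transversal_def)
  moreover have "valid_support \<dots>"
  proof (rule valid_full_class_support)
    show "{a} \<inter> \<Union>blocks \<union> (\<lambda>A. elem A (t mod card A)) ` {A\<in>blocks. a \<notin> A} \<subseteq> free_part"
      using block_free elem_in by blast
    show "\<exists>x\<in>A. x \<in> {a} \<inter> \<Union>blocks \<union> (\<lambda>A. elem A (t mod card A)) ` {A\<in>blocks. a \<notin> A}"
      if "A \<in> blocks" for A
      using elem_in[OF that] that by (cases "a \<in> A") blast+
  qed
  ultimately show ?thesis by simp
qed

lemma char_supports_valid: "S \<in> char_supports n \<Longrightarrow> valid_support S"
  unfolding char_supports_def
  using valid_pair_support valid_min_support valid_max_support valid_transversal by auto

lemma char_words_subset: "char_words n \<subseteq> shape_lang X \<C> \<Q> Mx"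
  unfolding char_words_def using char_supports_valid valid_support_word by blast

lemma finite_char_words: "finite (char_words n)"
proof -
  have "finite {(a, b) \<in> X \<times> X. \<forall>C\<in>\<C>. a \<in> C \<longrightarrow> b \<in> C \<longrightarrow> a = b}"
    by (rule finite_subset[of _ "X \<times> X"]) (use finite_X in auto)
  then show ?thesis unfolding char_words_def char_supports_def using finite_X by simp
qed

lemma char_words_nonempty: "char_words n \<noteq> {}"
  by (simp add: char_words_def char_supports_def)

text \<open>The transversals dominate, with one word for each symbol and each of
  \<open>n\<^sup>2\<close> values of \<open>t\<close>; the pairs contribute a square, the other
  supports a linear term.\<close>

lemma card_char_words:
  assumes "card X \<le> n" shows "card (char_words n) \<le> (n + 1) ^ 3"
proof -
  let ?P = "{(a, b) \<in> X \<times> X. \<forall>C\<in>\<C>. a \<in> C \<longrightarrow> b \<in> C \<longrightarrow> a = b}"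
  have sub: "?P \<subseteq> X \<times> X" by auto
  then have "finite ?P" using finite_X by (simp add: finite_subset)
  moreover have "card ?P \<le> card (X \<times> X)" using sub finite_X by (intro card_mono) simp_all
  ultimately have 1: "card ((\<lambda>(a, b). pair_support a b) ` ?P) \<le> card X * card X"
    using card_image_le[of ?P "\<lambda>(a, b). pair_support a b"] by (simp add: card_cartesian_product)
  have 2: "card (max_support ` X) \<le> card X" using finite_X by (rule card_image_le)
  have 3: "card ((\<lambda>(a, t). transversal a t) ` (X \<times> {..<n\<^sup>2})) \<le> card X * n\<^sup>2"
    using card_image_le[of "X \<times> {..<n\<^sup>2}" "\<lambda>(a, t). transversal a t"] finite_X
    by (simp add: card_cartesian_product)
  have "finite (char_supports n)" unfolding char_supports_def using \<open>finite ?P\<close> finite_X by simp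
  then have "card (char_words n) \<le> card (char_supports n)"
    unfolding char_words_def by (rule card_image_le)
  also have "\<dots> \<le> card X * card X + 1 + card X + card X * n\<^sup>2"
    unfolding char_supports_def
    by (intro card_Un_le[THEN order_trans] add_mono 1 2 3) simp
  also have "\<dots> \<le> n * n + 1 + n + n * n\<^sup>2"
    using assms by (intro add_mono mult_le_mono) simp_all
  also have "\<dots> \<le> (n + 1) ^ 3" by (simp add: power3_eq_cube power2_eq_square algebra_simps)
  finally show ?thesis .
qed

lemma count_residues: "s > 0 \<Longrightarrow> card {t. t < N \<and> t mod s = i} \<le> N div s + (1::nat)"
proof -
  assume s: "s > 0"
  have "{t. t < N \<and> t mod s = i} \<subseteq> (\<lambda>j. j * s + i) ` {..N div s}"
  proof
    fix t assume t: "t \<in> {t. t < N \<and> t mod s = i}"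
    then have "t = t div s * s + i" by (metis (mono_tags) div_mult_mod_eq mem_Collect_eq)
    moreover have "t div s \<le> N div s" using t by (simp add: div_le_mono)
    ultimately show "t \<in> (\<lambda>j. j * s + i) ` {..N div s}" by blast
  qed
  then have "card {t. t < N \<and> t mod s = i} \<le> card ((\<lambda>j. j * s + i) ` {..N div s})"
    by (intro card_mono) auto
  also have "\<dots> \<le> N div s + 1" using card_image_le[of "{..N div s}" "\<lambda>j. j * s + i"] by simp
  finally show ?thesis .
qed

text \<open>Averaging over \<open>t\<close>: if no block meeting \<open>R\<close> is smaller than \<open>R\<close>, a random transversal meets
  \<open>R\<close> at most once on average, and fixing one element outside \<open>R\<close> makes this less than one.\<close>

lemma transversal_avoids:
  assumes R: "R \<subseteq> free_part" "R \<noteq> {}" and n: "card X \<le> n"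
    and no_block: "\<And>A. A \<in> blocks \<Longrightarrow> \<not> A \<subseteq> R"
    and large: "\<And>A. A \<in> blocks \<Longrightarrow> A \<inter> R \<noteq> {} \<Longrightarrow> card R \<le> card A"
  shows "\<exists>S \<in> char_supports n. S \<inter> R = {}"
proof -
  have fin: "finite R" by (rule finite_subset[OF R(1)]) (simp add: free_part_def finite_X)
  have "card R \<le> card X" using R finite_X by (intro card_mono) (auto simp: free_part_def)
  then have Rn: "card R \<le> n" using n by simp
  have Rpos: "card R > 0" using fin R by (simp add: card_gt_0_iff)
  have "\<exists>a\<in>X. \<exists>t<n\<^sup>2. transversal a t \<inter> R = {}"
  proof (cases "\<exists>A0\<in>blocks. A0 \<inter> R \<noteq> {}")
    case False
    \<comment> \<open>No block meets \<open>R\<close>, so this \<open>a\<close> lies in no block and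
      the transversal drops it.\<close>
    obtain a where a: "a \<in> R" "a \<in> X" using R by (auto simp: free_part_def)
    have "x \<notin> R" if "x \<in> transversal a 0" for x
    proof (cases "x \<in> pick ` \<C>")
      case True
      then show ?thesis using pick_not_free R(1) by blast
    next
      case no_pick: False
      then have "x \<in> \<Union>blocks" using that elem_in[of _ 0] unfolding transversal_def by auto
      then show ?thesis using False by blast
    qed
    then have "transversal a 0 \<inter> R = {}" by blast
    moreover have "0 < n\<^sup>2" using Rn Rpos by simp
    ultimately show ?thesis using a by blast
  next
    case True
    then obtain A0 where A0: "A0 \<in> blocks" "A0 \<inter> R \<noteq> {}" by blast
    \<comment> \<open>With \<open>a\<close> representing \<open>A0\<close>, no symbol of
      \<open>R\<close> in \<open>A0\<close> is ever chosen. The sum below runs over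
      \<open>R - A0\<close>, which lacks at least one element of \<open>R\<close>.\<close>
    obtain a where a: "a \<in> A0" "a \<notin> R" using no_block[OF A0(1)] by blast
    have aX: "a \<in> X" using block_free[OF A0(1) a(1)] by (simp add: free_part_def)
    show ?thesis
    proof (rule ccontr)
      assume "\<not> ?thesis"
      then have hit: "transversal a t \<inter> R \<noteq> {}" if "t < n\<^sup>2" for t using aX that by blast
      \<comment> \<open>The values of \<open>t\<close> that select \<open>r\<close> in its block;
        they form a residue class modulo the size of the block, which is at least
        \<open>card R\<close> if \<open>r\<close> is in \<open>R\<close>.\<close>
      define bad where "bad = (\<lambda>r. {t. t < n\<^sup>2 \<and> (\<exists>A\<in>blocks. r \<in> A \<and> elem A (t mod card A) = r)})"
      have "{..<n\<^sup>2} \<subseteq> (\<Union>r\<in>R - A0. bad r)"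
      proof
        fix t assume t: "t \<in> {..<n\<^sup>2}"
        obtain r where r: "r \<in> transversal a t" "r \<in> R" using hit t by blast
        then have "r \<notin> pick ` \<C>" "r \<noteq> a" using a pick_not_free R(1) by blast+
        then obtain A where A: "A \<in> blocks" "a \<notin> A" "r = elem A (t mod card A)"
          using r unfolding transversal_def by blast
        then have "r \<in> A" using elem_in by simp
        moreover have "r \<notin> A0" using A \<open>r \<in> A\<close> a A0 blocks_disjoint by blast
        ultimately show "t \<in> (\<Union>r\<in>R - A0. bad r)" using A r t unfolding bad_def by blast
      qed
      then have "card {..<n\<^sup>2} \<le> card (\<Union>r\<in>R - A0. bad r)"
        by (intro card_mono) (auto simp: fin bad_def)
      also have "\<dots> \<le> (\<Sum>r\<in>R - A0. card (bad r))" using fin by (intro card_UN_le) simp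
      also have "\<dots> \<le> (\<Sum>r\<in>R - A0. n\<^sup>2 div card R + 1)"
      proof (rule sum_mono)
        fix r assume r: "r \<in> R - A0"
        show "card (bad r) \<le> n\<^sup>2 div card R + 1"
        proof (cases "\<exists>A\<in>blocks. r \<in> A")
          case False
          then have "bad r = {}" by (auto simp: bad_def)
          then show ?thesis by simp
        next
          case True
          then obtain A where A: "A \<in> blocks" "r \<in> A" by blast
          have cA: "card R \<le> card A" using large[OF A(1)] A r by blast
          have bij: "bij_betw (elem A) {..<card A} A" using finite_block[OF A(1)] by (rule elem_bij)
          then obtain i where i: "i < card A" "elem A i = r" using A(2)
            by (metis bij_betw_imp_surj_on imageE lessThan_iff)
          have "bad r \<subseteq> {t. t < n\<^sup>2 \<and> t mod card A = i}"
          proof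
            fix t assume t: "t \<in> bad r"
            then have "elem A (t mod card A) = r" using A blocks_disjoint unfolding bad_def by blast
            moreover have "t mod card A < card A" using i by simp
            ultimately have "t mod card A = i" using i bij
              by (metis bij_betw_imp_inj_on inj_onD lessThan_iff)
            then show "t \<in> {t. t < n\<^sup>2 \<and> t mod card A = i}" using t by (simp add: bad_def)
          qed
          then have "card (bad r) \<le> card {t. t < n\<^sup>2 \<and> t mod card A = i}"
            by (intro card_mono) auto
          also have "\<dots> \<le> n\<^sup>2 div card A + 1" using i by (intro count_residues) simp
          also have "\<dots> \<le> n\<^sup>2 div card R + 1" using cA Rpos by (simp add: div_le_mono2)
          finally show ?thesis .
        qed
      qed
      also have "\<dots> = card (R - A0) * (n\<^sup>2 div card R + 1)" by simp
      also have "\<dots> \<le> (card R - 1) * (n\<^sup>2 div card R + 1)"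
      proof -
        have "card (R - A0) < card R" using A0 fin by (intro psubset_card_mono) auto
        then show ?thesis by (intro mult_le_mono1) simp
      qed
      \<comment> \<open>The range \<open>n\<^sup>2\<close> of \<open>t\<close> is chosen for this
        estimate: \<open>card R \<le> n\<close> gives \<open>q \<ge> card R = Suc m\<close>, hence
        \<open>m * (q + 1) = m * q + m < Suc m * q \<le> n\<^sup>2\<close>.\<close>
      also have "\<dots> < n\<^sup>2"
      proof -
        obtain m where m: "card R = Suc m" using Rpos gr0_implies_Suc by blast
        define q where "q = n\<^sup>2 div card R"
        have "card R * card R \<le> n\<^sup>2" using Rn by (simp add: power2_eq_square mult_le_mono)
        then have "card R \<le> q" unfolding q_def using Rpos by (simp add: less_eq_div_iff_mult_less_eq)
        then have "m * (q + 1) < Suc m * q" by (simp add: m)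
        also have "Suc m * q \<le> n\<^sup>2" unfolding q_def m by (rule times_div_less_eq_dividend)
        finally show ?thesis by (simp add: m q_def)
      qed
      finally show False by simp
    qed
  qed
  then show ?thesis unfolding char_supports_def by blast
qed

end

section \<open>Learning an expression\<close>

definition occurs :: "'a multiset set \<Rightarrow> 'a \<Rightarrow> bool" where
  "occurs W a \<longleftrightarrow> (\<exists>w\<in>W. a \<in># w)"

definition cooccur :: "'a multiset set \<Rightarrow> 'a \<Rightarrow> 'a \<Rightarrow> bool" where
  "cooccur W a b \<longleftrightarrow> (\<exists>w\<in>W. a \<in># w \<and> b \<in># w)"

definition repeated :: "'a multiset set \<Rightarrow> 'a \<Rightarrow> bool" where
  "repeated W a \<longleftrightarrow> (\<exists>w\<in>W. 2 \<le> count w a)"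

definition hits :: "'a multiset set \<Rightarrow> 'a set \<Rightarrow> bool" where
  "hits W R \<longleftrightarrow> (\<forall>w\<in>W. \<exists>a\<in>R. a \<in># w)"

definition conflicts :: "'a multiset set \<Rightarrow> 'a \<Rightarrow> 'a set" where
  "conflicts W a = {b. b = a \<or> occurs W b \<and> \<not> cooccur W a b}"

definition conflict_free :: "'a multiset set \<Rightarrow> 'a set" where
  "conflict_free W = {a. occurs W a \<and> conflicts W a = {a}}"

text \<open>Indexed by a symbol and a word of the sample, hence polynomially many. A true block is
  found from any of its symbols \<open>a\<close> together with the word of
  \<open>max_support a\<close>.\<close>

definition candidates :: "'a multiset set \<Rightarrow> 'a set set" where
  "candidates W = {R. hits W R \<and>
     (\<exists>a\<in>conflict_free W. \<exists>w\<in>W. R = insert a (conflict_free W - set_mset w))}"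

text \<open>Smaller candidates take precedence: only a candidate that avoids all smaller blocks of the
  target expression is refuted by a characteristic sample.\<close>

fun accepted :: "'a multiset set \<Rightarrow> nat \<Rightarrow> 'a set set" where
  "accepted W 0 = {}"
| "accepted W (Suc m) = accepted W m \<union>
     {R \<in> candidates W. card R = Suc m \<and> (\<forall>Q\<in>accepted W m. Q \<inter> R = {})}"

text \<open>For an arbitrary sample the accepted sets may overlap, hence the equivalence classes.\<close>

definition joint_class :: "'a multiset set \<Rightarrow> nat \<Rightarrow> 'a \<Rightarrow> 'a set" where
  "joint_class W n a = {b \<in> conflict_free W. \<forall>R\<in>accepted W n. a \<in> R \<longleftrightarrow> b \<in> R}"

text \<open>The grouping has to be a partition for every sample, also for one that is not
  characteristic. Conflicting symbols are grouped by equal conflict sets, since conflict alone need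
  not be transitive. A joint class that some word misses falls back to singletons, and so do symbols
  that never occur.\<close>

definition symbol_class :: "'a multiset set \<Rightarrow> nat \<Rightarrow> 'a \<Rightarrow> 'a set" where
  "symbol_class W n a =
     (if a \<in> conflict_free W then if hits W (joint_class W n a) then joint_class W n a else {a}
      else if occurs W a then {b. occurs W b \<and> conflicts W b = conflicts W a}
      else {a})"

definition plus_symbol :: "'a multiset set \<Rightarrow> nat \<Rightarrow> 'a \<Rightarrow> bool" where
  "plus_symbol W n a \<longleftrightarrow> a \<in> conflict_free W \<and> symbol_class W n a \<noteq> {a}"

text \<open>Absence is left to the outer multiplicity, so \<open>a^*\<close> is learned as
  \<open>(a^+)^?\<close>. In a plus factor the repetition also comes from outside.\<close>

definition inner_mult :: "'a multiset set \<Rightarrow> nat \<Rightarrow> 'a \<Rightarrow> mult" where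
  "inner_mult W n a = (if \<not> plus_symbol W n a \<and> repeated W a then MPlus else MOne)"

definition outer_mult :: "'a multiset set \<Rightarrow> nat \<Rightarrow> 'a \<Rightarrow> mult" where
  "outer_mult W n a =
     (if plus_symbol W n a then MPlus else if \<not> occurs W a then MZero
      else if hits W (symbol_class W n a) then MOne else MOpt)"

definition class_disj :: "'a list \<Rightarrow> 'a multiset set \<Rightarrow> 'a \<Rightarrow> 'a disj" where
  "class_disj S W a = map (\<lambda>b. (b, inner_mult W (length S) b))
     (filter (\<lambda>b. b \<in> symbol_class W (length S) a) S)"

definition learn_dme :: "'a::linorder list \<Rightarrow> 'a multiset set \<Rightarrow> 'a dme" where
  "learn_dme S W = map (\<lambda>a. (class_disj S W a, outer_mult W (length S) a))
     (filter (\<lambda>a. \<forall>b\<in>set S. b \<in> symbol_class W (length S) a \<longrightarrow> a \<le> b) S)"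

section \<open>The learned expression and its language\<close>

lemma symbol_class_self: "a \<in> symbol_class W n a"
  by (auto simp: symbol_class_def joint_class_def)

lemma conflicts_self: "a \<in> conflicts W a"
  by (simp add: conflicts_def)

lemma symbol_class_cases:
  assumes "b \<in> symbol_class W n a"
  shows "b = a \<or> (a \<in> conflict_free W \<and> b \<in> joint_class W n a \<and> hits W (joint_class W n a) \<and>
      symbol_class W n a = joint_class W n a) \<or>
    (a \<notin> conflict_free W \<and> occurs W a \<and> occurs W b \<and> conflicts W b = conflicts W a)"
  using assms by (auto simp: symbol_class_def split: if_splits)

lemma joint_class_eq: "b \<in> joint_class W n a \<Longrightarrow> joint_class W n b = joint_class W n a"
  by (auto simp: joint_class_def)

text \<open>Membership in a common class is an equivalence for every \<open>W\<close>, and the outer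
  multiplicity depends only on the class. This makes the factors of \<open>learn_dme\<close>
  disjoint and independent of the chosen representatives.\<close>

lemma same_class:
  assumes "b \<in> symbol_class W n a"
  shows "symbol_class W n b = symbol_class W n a" "plus_symbol W n b \<longleftrightarrow> plus_symbol W n a"
    "occurs W b \<longleftrightarrow> occurs W a" "outer_mult W n b = outer_mult W n a"
proof -
  have *: "symbol_class W n b = symbol_class W n a \<and>
      (plus_symbol W n b \<longleftrightarrow> plus_symbol W n a) \<and> (occurs W b \<longleftrightarrow> occurs W a)"
  proof (cases "b = a")
    case False
    from symbol_class_cases[OF assms] False consider
      (joint) "a \<in> conflict_free W" "b \<in> joint_class W n a" "hits W (joint_class W n a)"
        "symbol_class W n a = joint_class W n a"
      | (conf) "a \<notin> conflict_free W" "occurs W a" "occurs W b" "conflicts W b = conflicts W a"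
      by blast
    then show ?thesis
    proof cases
      case joint
      then have "b \<in> conflict_free W" by (simp add: joint_class_def)
      moreover have "symbol_class W n b = joint_class W n a"
        using calculation joint joint_class_eq[OF joint(2)] by (simp add: symbol_class_def)
      ultimately show ?thesis using joint False symbol_class_self[of a W n]
        by (auto simp: plus_symbol_def conflict_free_def)
    next
      case conf
      have "b \<notin> conflict_free W"
        using conf conflicts_self[of a W] False by (auto simp: conflict_free_def)
      then show ?thesis using conf by (simp add: symbol_class_def plus_symbol_def)
    qed
  qed simp
  then show "symbol_class W n b = symbol_class W n a" "plus_symbol W n b \<longleftrightarrow> plus_symbol W n a"
    "occurs W b \<longleftrightarrow> occurs W a" by blast+
  then show "outer_mult W n b = outer_mult W n a" by (simp add: outer_mult_def)
qed

lemma class_disj_cong: "b \<in> symbol_class W (length S) a \<Longrightarrow> class_disj S W b = class_disj S W a"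
  by (simp add: class_disj_def same_class)

lemma fst_class_disj: "map fst (class_disj S W a) = filter (\<lambda>b. b \<in> symbol_class W (length S) a) S"
  by (simp add: class_disj_def o_def)

lemma set_class_disj: "fst ` set (class_disj S W a) = symbol_class W (length S) a \<inter> set S"
  by (auto simp: class_disj_def image_image)

lemma class_head:
  fixes S :: "'a::linorder list"
  assumes "a \<in> set S"
  obtains h where "h \<in> set S" "h \<in> symbol_class W (length S) a" "a \<in> symbol_class W (length S) h"
    "\<And>b. b \<in> set S \<Longrightarrow> b \<in> symbol_class W (length S) h \<Longrightarrow> h \<le> b"
proof -
  let ?K = "symbol_class W (length S) a \<inter> set S"
  define h where "h = Min ?K"
  have "?K \<noteq> {}" "finite ?K" using assms symbol_class_self[of a W "length S"] by auto
  then have h: "h \<in> ?K" "\<And>b. b \<in> ?K \<Longrightarrow> h \<le> b" unfolding h_def by (auto simp: Min_in simp del: Int_iff)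
  then have "symbol_class W (length S) h = symbol_class W (length S) a" by (simp add: same_class)
  then show ?thesis using h symbol_class_self[of a W "length S"] by (intro that[of h]) auto
qed

lemma set_dme_symbols_learn: "set (dme_symbols (learn_dme S W)) = set S"
proof -
  have "set (dme_symbols (learn_dme S W)) \<subseteq> set S"
    by (auto simp: dme_symbols_def learn_dme_def class_disj_def)
  moreover have "a \<in> set (dme_symbols (learn_dme S W))" if a: "a \<in> set S" for a
  proof -
    obtain h where h: "h \<in> set S" "a \<in> symbol_class W (length S) h"
      "\<And>b. b \<in> set S \<Longrightarrow> b \<in> symbol_class W (length S) h \<Longrightarrow> h \<le> b"
      using class_head[OF a] by metis
    then have "a \<in> fst ` set (class_disj S W h)"
      "(class_disj S W h, outer_mult W (length S) h) \<in> set (learn_dme S W)"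
      using a unfolding set_class_disj by (auto simp: learn_dme_def)
    then show ?thesis unfolding dme_symbols_def by force
  qed
  ultimately show ?thesis by blast
qed

lemma distinct_dme_symbols_learn:
  assumes "distinct S"
  shows "distinct (dme_symbols (learn_dme S W))"
proof -
  let ?h = "\<lambda>a. \<forall>b\<in>set S. b \<in> symbol_class W (length S) a \<longrightarrow> a \<le> b"
  have eq: "dme_symbols (learn_dme S W) =
      concat (map (\<lambda>a. filter (\<lambda>b. b \<in> symbol_class W (length S) a) S) (filter ?h S))"
    by (simp add: dme_symbols_def learn_dme_def map_concat o_def fst_class_disj)
  have "distinct (concat (map (\<lambda>a. filter (\<lambda>b. b \<in> symbol_class W (length S) a) S) hs))"
    if "distinct hs" "set hs \<subseteq> set S" "\<forall>a\<in>set hs. ?h a" for hs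
    using that
  proof (induction hs)
    case (Cons x hs)
    have False if "b \<in> symbol_class W (length S) x" "y \<in> set hs" "b \<in> symbol_class W (length S) y" for b y
    proof -
      have "symbol_class W (length S) x = symbol_class W (length S) y"
        using that same_class(1) by metis
      then have "x \<in> symbol_class W (length S) y" "y \<in> symbol_class W (length S) x"
        using symbol_class_self by metis+
      \<comment> \<open>Both are heads of the same class, and each is least in it.\<close>
      then have "x = y" using Cons.prems that(2) by (intro order.antisym) auto
      then show False using Cons.prems that(2) by simp
    qed
    then show ?case using Cons assms by auto
  qed simp
  then show ?thesis unfolding eq using assms by simp
qed

lemma learn_dme_dmes:
  assumes "distinct S" "S \<noteq> []"
  shows "learn_dme S W \<in> dmes (set S)"
proof -
  have "set (dme_symbols (learn_dme S W)) \<noteq> {}" unfolding set_dme_symbols_learn using assms by simp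
  then have "learn_dme S W \<noteq> []" by (auto simp: dme_symbols_def)
  moreover have "class_disj S W a \<noteq> []" if "a \<in> set S" for a
    using that symbol_class_self[of a W] by (auto simp: class_disj_def filter_empty_conv)
  ultimately show ?thesis
    using assms set_dme_symbols_learn[of S W] distinct_dme_symbols_learn[of S W]
    unfolding dmes_def by (auto simp: learn_dme_def)
qed

lemma disj_lang_class:
  "v \<in> disj_lang (map (\<lambda>b. (b, if P b then MPlus else MOne)) l) \<longleftrightarrow>
    (\<exists>b\<in>set l. set_mset v = {b} \<and> (\<not> P b \<longrightarrow> count v b \<le> 1))"
proof
  assume "v \<in> disj_lang (map (\<lambda>b. (b, if P b then MPlus else MOne)) l)"
  then obtain b i where "b \<in> set l" "i \<in> mult_set (if P b then MPlus else MOne)" "v = replicate_mset i b"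
    unfolding disj_lang_iff by auto
  then show "\<exists>b\<in>set l. set_mset v = {b} \<and> (\<not> P b \<longrightarrow> count v b \<le> 1)"
    by (intro bexI[of _ b]) (auto split: if_splits)
next
  assume "\<exists>b\<in>set l. set_mset v = {b} \<and> (\<not> P b \<longrightarrow> count v b \<le> 1)"
  then obtain b where b: "b \<in> set l" "set_mset v = {b}" "\<not> P b \<longrightarrow> count v b \<le> 1" by blast
  obtain i where i: "count v b = Suc i" using b(2) by (cases "count v b") (auto simp: count_eq_zero_iff)
  have "v = replicate_mset (Suc i) b"
    using b(2) i by (auto simp: multiset_eq_iff count_eq_zero_iff)
  moreover have "Suc i \<in> mult_set (if P b then MPlus else MOne)" using b(3) i by auto
  ultimately show "v \<in> disj_lang (map (\<lambda>b. (b, if P b then MPlus else MOne)) l)"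
    using b(1) unfolding disj_lang_iff
    by (intro exI[of _ b] exI[of _ "if P b then MPlus else MOne"] exI[of _ "Suc i"]) simp
qed

lemma power_lang_class:
  fixes a S W w
  defines "n \<equiv> length S" and "v \<equiv> filter_mset (\<lambda>x. x \<in> symbol_class W (length S) a) w"
  assumes w: "set_mset w \<subseteq> set S" and a: "a \<in> set S"
  shows "v \<in> power_lang (class_disj S W a) (outer_mult W n a) \<longleftrightarrow>
    (occurs W a \<or> v = {#}) \<and>
    (occurs W a \<longrightarrow> hits W (symbol_class W n a) \<longrightarrow> v \<noteq> {#}) \<and>
    (\<not> plus_symbol W n a \<longrightarrow>
      (\<forall>b\<in>symbol_class W n a. b \<in># w \<longrightarrow> set_mset v = {b} \<and> (count w b \<le> 1 \<or> repeated W b)))"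
proof -
  have sub: "set_mset v \<subseteq> symbol_class W n a \<inter> set S" using w by (auto simp: v_def n_def)
  have occ: "occurs W a" if "plus_symbol W n a"
    using that by (simp add: plus_symbol_def conflict_free_def)
  show ?thesis
  proof (cases "plus_symbol W n a")
    case True
    then have "symbol_class W n a = joint_class W n a" "hits W (joint_class W n a)"
      by (auto simp: plus_symbol_def symbol_class_def split: if_splits)
    then have h: "hits W (symbol_class W n a)" by simp
    have "class_disj S W a = map (\<lambda>b. (b, MOne)) (filter (\<lambda>b. b \<in> symbol_class W n a) S)"
      using True same_class(2)[of _ W n a] by (auto simp: class_disj_def n_def inner_mult_def)
    then have "live_symbols (class_disj S W a) = symbol_class W n a \<inter> set S"
      "{#} \<notin> disj_lang (class_disj S W a)"
      by (auto simp: live_symbols_def disj_lang_iff)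
    then show ?thesis using True occ h sub by (simp add: outer_mult_def power_lang_plus)
  next
    case False
    have "inner_mult W n b = (if repeated W b then MPlus else MOne)" if "b \<in> symbol_class W n a" for b
      using False same_class(2)[OF that] by (simp add: inner_mult_def)
    then have D: "class_disj S W a = map (\<lambda>b. (b, if repeated W b then MPlus else MOne))
        (filter (\<lambda>b. b \<in> symbol_class W n a) S)"
      by (simp add: class_disj_def n_def)
    have in_v: "b \<in># v \<longleftrightarrow> b \<in> symbol_class W n a \<and> b \<in># w" for b by (auto simp: v_def n_def)
    have cnt: "count v b = count w b" if "b \<in> symbol_class W n a" for b using that by (simp add: v_def n_def)
    have "v \<in> disj_lang (class_disj S W a) \<longleftrightarrow> v \<noteq> {#} \<and>
        (\<forall>b\<in>symbol_class W n a. b \<in># w \<longrightarrow> set_mset v = {b} \<and> (count w b \<le> 1 \<or> repeated W b))"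
      (is "_ \<longleftrightarrow> _ \<and> ?U")
    proof
      assume "v \<in> disj_lang (class_disj S W a)"
      then obtain b where b: "b \<in> symbol_class W n a" "set_mset v = {b}"
          "\<not> repeated W b \<longrightarrow> count v b \<le> 1"
        unfolding D disj_lang_class by auto
      have "b' = b" if "b' \<in> symbol_class W n a" "b' \<in># w" for b' using that in_v b(2) by blast
      then have "set_mset v = {b'} \<and> (count w b' \<le> 1 \<or> repeated W b')"
        if "b' \<in> symbol_class W n a" "b' \<in># w" for b'
        using that b(2,3) cnt[OF b(1)] by metis
      moreover have "v \<noteq> {#}" using b(2) by auto
      ultimately show "v \<noteq> {#} \<and> ?U" by blast
    next
      assume R: "v \<noteq> {#} \<and> ?U"
      then obtain b where "b \<in># v" by (meson multiset_nonemptyE)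
      moreover from this have "b \<in> symbol_class W n a" "b \<in># w" "b \<in> set S"
        using in_v sub by auto
      ultimately show "v \<in> disj_lang (class_disj S W a)"
        unfolding D disj_lang_class using R cnt by (intro bexI[of _ b]) auto
    qed
    moreover have ?U if "v = {#}" using that in_v by auto
    ultimately show ?thesis using False
      by (auto simp: outer_mult_def power_lang_one power_lang_opt power_lang_zero)
  qed
qed

text \<open>Removes the syntax: consistency and exactness are both derived from this description.
  Only outside plus factors do symbols of a class exclude each other and can counts be
  bounded.\<close>

lemma learn_dme_iff:
  assumes "distinct S" and occ: "{a. occurs W a} \<subseteq> set S"
  shows "w \<in> dme_lang (learn_dme S W) \<longleftrightarrow> (\<forall>a. a \<in># w \<longrightarrow> occurs W a) \<and>
    (\<forall>a. occurs W a \<longrightarrow>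
      (hits W (symbol_class W (length S) a) \<longrightarrow> (\<exists>b\<in>symbol_class W (length S) a. b \<in># w)) \<and>
      (\<not> plus_symbol W (length S) a \<longrightarrow> a \<in># w \<longrightarrow>
        (\<forall>b\<in>symbol_class W (length S) a. b \<in># w \<longrightarrow> a = b) \<and> (count w a \<le> 1 \<or> repeated W a)))"
    (is "_ \<longleftrightarrow> ?R")
proof -
  let ?K = "symbol_class W (length S)"
  let ?v = "\<lambda>a. filter_mset (\<lambda>x. x \<in> ?K a) w"
  have v_empty: "?v a = {#} \<longleftrightarrow> (\<forall>b\<in>?K a. b \<notin># w)" for a
    by (auto simp: multiset_eq_iff count_eq_zero_iff)
  have "w \<in> dme_lang (learn_dme S W) \<longleftrightarrow> set_mset w \<subseteq> set S \<and>
      (\<forall>(D, M)\<in>set (learn_dme S W). filter_mset (\<lambda>x. x \<in> fst ` set D) w \<in> power_lang D M)"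
    unfolding dme_lang_iff[OF distinct_dme_symbols_learn[OF assms(1)]] set_dme_symbols_learn ..
  also have "\<dots> \<longleftrightarrow> set_mset w \<subseteq> set S \<and>
      (\<forall>a\<in>set S. ?v a \<in> power_lang (class_disj S W a) (outer_mult W (length S) a))"
  proof (rule conj_cong[OF refl])
    assume w: "set_mset w \<subseteq> set S"
    have v: "filter_mset (\<lambda>x. x \<in> fst ` set (class_disj S W a)) w = ?v a" for a
      unfolding set_class_disj using w by (intro filter_mset_cong_set) auto
    show "(\<forall>(D, M)\<in>set (learn_dme S W). filter_mset (\<lambda>x. x \<in> fst ` set D) w \<in> power_lang D M) \<longleftrightarrow>
      (\<forall>a\<in>set S. ?v a \<in> power_lang (class_disj S W a) (outer_mult W (length S) a))"
    proof
      assume L: "\<forall>(D, M)\<in>set (learn_dme S W). filter_mset (\<lambda>x. x \<in> fst ` set D) w \<in> power_lang D M"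
      show "\<forall>a\<in>set S. ?v a \<in> power_lang (class_disj S W a) (outer_mult W (length S) a)"
      proof
        fix a assume a: "a \<in> set S"
        obtain h where h: "h \<in> set S" "h \<in> ?K a"
          "\<And>b. b \<in> set S \<Longrightarrow> b \<in> ?K h \<Longrightarrow> h \<le> b"
          using class_head[OF a] by metis
        then have "(class_disj S W h, outer_mult W (length S) h) \<in> set (learn_dme S W)"
          by (auto simp: learn_dme_def)
        then have "?v h \<in> power_lang (class_disj S W h) (outer_mult W (length S) h)"
          using L v[of h] by auto
        then show "?v a \<in> power_lang (class_disj S W a) (outer_mult W (length S) a)"
          using same_class[OF h(2)] class_disj_cong[OF h(2)] by simp
      qed
    next
      assume R: "\<forall>a\<in>set S. ?v a \<in> power_lang (class_disj S W a) (outer_mult W (length S) a)"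
      show "\<forall>(D, M)\<in>set (learn_dme S W). filter_mset (\<lambda>x. x \<in> fst ` set D) w \<in> power_lang D M"
        using R v by (auto simp: learn_dme_def)
    qed
  qed
  also have "\<dots> \<longleftrightarrow> ?R"
  proof
    assume L: "set_mset w \<subseteq> set S \<and>
      (\<forall>a\<in>set S. ?v a \<in> power_lang (class_disj S W a) (outer_mult W (length S) a))"
    then have *: "(occurs W a \<or> ?v a = {#}) \<and>
      (occurs W a \<longrightarrow> hits W (?K a) \<longrightarrow> ?v a \<noteq> {#}) \<and>
      (\<not> plus_symbol W (length S) a \<longrightarrow>
        (\<forall>b\<in>?K a. b \<in># w \<longrightarrow> set_mset (?v a) = {b} \<and> (count w b \<le> 1 \<or> repeated W b)))"
      if "a \<in> set S" for a
      using power_lang_class[of w S a W] that by blast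
    show ?R
    proof (intro conjI allI impI)
      show "occurs W a" if "a \<in># w" for a
        using *[of a] L that symbol_class_self[of a W "length S"] v_empty[of a] by blast
      fix a assume a: "occurs W a"
      then have aS: "a \<in> set S" using occ by blast
      show "\<exists>b\<in>?K a. b \<in># w" if "hits W (?K a)"
        using *[OF aS] a that v_empty[of a] by blast
      assume np: "\<not> plus_symbol W (length S) a" and aw: "a \<in># w"
      then have s: "set_mset (?v a) = {a}" "count w a \<le> 1 \<or> repeated W a"
        using *[OF aS] symbol_class_self[of a W "length S"] by blast+
      show "count w a \<le> 1 \<or> repeated W a" by (rule s(2))
      show "\<forall>b\<in>?K a. b \<in># w \<longrightarrow> a = b" using s(1) by auto
    qed
  next
    assume R: ?R
    then have wS: "set_mset w \<subseteq> set S" using occ by blast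
    have "?v a \<in> power_lang (class_disj S W a) (outer_mult W (length S) a)" if aS: "a \<in> set S" for a
      unfolding power_lang_class[OF wS aS]
    proof (intro conjI impI ballI)
      show "occurs W a \<or> ?v a = {#}"
        using R same_class(3)[of _ W "length S" a] unfolding v_empty by blast
      show "?v a \<noteq> {#}" if "occurs W a" "hits W (?K a)"
        unfolding v_empty using R that by blast
      fix b assume np: "\<not> plus_symbol W (length S) a" and b: "b \<in> ?K a" "b \<in># w"
      have "\<not> plus_symbol W (length S) b" "?K b = ?K a" using same_class[OF b(1)] np by simp_all
      then have U: "\<And>c. c \<in> ?K a \<Longrightarrow> c \<in># w \<Longrightarrow> b = c" and "count w b \<le> 1 \<or> repeated W b"
        using R b(2) by metis+
      then show "count w b \<le> 1 \<or> repeated W b" by blast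
      have "c \<in># ?v a \<longleftrightarrow> c = b" for c using U[of c] b by auto
      then show "set_mset (?v a) = {b}" unfolding set_eq_iff by simp
    qed
    then show "set_mset w \<subseteq> set S \<and>
      (\<forall>a\<in>set S. ?v a \<in> power_lang (class_disj S W a) (outer_mult W (length S) a))" using wS by blast
  qed
  finally show ?thesis .
qed

text \<open>Every constraint in \<open>learn_dme_iff\<close> was read off \<open>W\<close>, so any
  \<open>W\<close> obeys it, whether or not it stems from an expression. Soundness of the learner
  rests on this.\<close>

lemma learn_dme_consistent:
  assumes "distinct S" "{a. occurs W a} \<subseteq> set S"
  shows "W \<subseteq> dme_lang (learn_dme S W)"
proof
  fix w assume w: "w \<in> W"
  show "w \<in> dme_lang (learn_dme S W)"
    unfolding learn_dme_iff[OF assms]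
  proof (intro conjI allI impI ballI)
    show "occurs W a" if "a \<in># w" for a using w that by (auto simp: occurs_def)
    show "\<exists>b\<in>symbol_class W (length S) a. b \<in># w" if "hits W (symbol_class W (length S) a)" for a
      using w that by (auto simp: hits_def)
    show "count w a \<le> 1 \<or> repeated W a" for a using w by (force simp: repeated_def)
    show "a = b" if "\<not> plus_symbol W (length S) a" "a \<in># w"
      "b \<in> symbol_class W (length S) a" "b \<in># w" for a b
    proof (cases "a \<in> conflict_free W")
      case True
      then show ?thesis using that by (auto simp: plus_symbol_def)
    next
      case False
      from symbol_class_cases[OF that(3)] False consider "b = a" | "conflicts W b = conflicts W a"
        by blast
      then show ?thesis
      proof cases
        case 2
        \<comment> \<open>\<open>b\<close> belongs to its own conflict set, which is that of
          \<open>a\<close>; being in one word of \<open>W\<close> together, the two must be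
          equal.\<close>
        then have "b \<in> conflicts W a" using conflicts_self[of b W] by simp
        then show ?thesis using w that by (auto simp: conflicts_def cooccur_def)
      qed simp
    qed
  qed
qed

section \<open>What a sample with all characteristic words reveals\<close>

context shape begin

context
  fixes W n
  assumes CS_W: "char_words n \<subseteq> W" and W_L: "W \<subseteq> shape_lang X \<C> \<Q> Mx" and n: "card X \<le> n"
begin

lemma support_word:
  assumes "S \<in> char_supports n"
  shows "word S \<in> W" "set_mset (word S) = S"
    "count (word S) a = (if a \<in> S then if a \<in> Mx then 1 else 2 else 0)"
proof -
  have "finite S" using assms char_supports_valid valid_support_finite by blast
  then show "set_mset (word S) = S" "count (word S) a = (if a \<in> S then if a \<in> Mx then 1 else 2 else 0)"
    by (simp_all add: set_word count_word)
  show "word S \<in> W" using assms CS_W by (auto simp: char_words_def)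
qed

lemma pair_support_char:
  assumes "a \<in> X" "b \<in> X" "\<forall>C\<in>\<C>. a \<in> C \<longrightarrow> b \<in> C \<longrightarrow> a = b"
  shows "pair_support a b \<in> char_supports n"
  unfolding char_supports_def using assms by (intro UnI1) force

lemma sample_occurs: "occurs W a \<longleftrightarrow> a \<in> X"
proof
  assume "occurs W a" then show "a \<in> X" using W_L by (auto simp: occurs_def shape_lang_def)
next
  assume "a \<in> X"
  then have "pair_support a a \<in> char_supports n" by (intro pair_support_char) auto
  note support_word(1,2)[OF this]
  moreover have "a \<in> pair_support a a" by (simp add: pair_support_def)
  ultimately show "occurs W a" unfolding occurs_def by (metis (no_types))
qed

lemma sample_cooccur:
  assumes "a \<in> X" "b \<in> X"
  shows "cooccur W a b \<longleftrightarrow> (\<forall>C\<in>\<C>. a \<in> C \<longrightarrow> b \<in> C \<longrightarrow> a = b)"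
proof
  assume "cooccur W a b"
  then show "\<forall>C\<in>\<C>. a \<in> C \<longrightarrow> b \<in> C \<longrightarrow> a = b"
    using W_L unfolding cooccur_def shape_lang_def by blast
next
  assume "\<forall>C\<in>\<C>. a \<in> C \<longrightarrow> b \<in> C \<longrightarrow> a = b"
  then have "pair_support a b \<in> char_supports n" using assms by (intro pair_support_char)
  note support_word(1,2)[OF this]
  moreover have "a \<in> pair_support a b" "b \<in> pair_support a b" by (auto simp: pair_support_def)
  ultimately show "cooccur W a b" unfolding cooccur_def by metis
qed

lemma sample_repeated:
  assumes "a \<in> X"
  shows "repeated W a \<longleftrightarrow> a \<notin> Mx"
proof
  assume "repeated W a"
  then show "a \<notin> Mx" using W_L unfolding repeated_def shape_lang_def by fastforce
next
  assume "a \<notin> Mx"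
  have "pair_support a a \<in> char_supports n" using assms by (intro pair_support_char) auto
  note support_word(1,3)[OF this]
  moreover have "a \<in> pair_support a a" by (simp add: pair_support_def)
  ultimately show "repeated W a" using \<open>a \<notin> Mx\<close> unfolding repeated_def by (metis order_refl)
qed

lemma sample_hits_class:
  assumes "C \<in> \<C>"
  shows "hits W C \<longleftrightarrow> C \<in> \<Q>"
proof
  assume "C \<in> \<Q>" then show "hits W C" using W_L unfolding hits_def shape_lang_def by blast
next
  assume h: "hits W C"
  have "min_support \<in> char_supports n" by (simp add: char_supports_def)
  from support_word(1,2)[OF this] obtain a where a: "a \<in> C" "a \<in> min_support"
    using h unfolding hits_def by metis
  then obtain C' where C': "C' \<in> \<C> \<inter> \<Q>" "a = pick C'"
    using not_class_free[OF assms] unfolding min_support_def by blast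
  then have "C' = C" using pick_eq assms a by blast
  then show "C \<in> \<Q>" using C' by blast
qed

lemma sample_hits_block: "A \<in> blocks \<Longrightarrow> hits W A"
  using W_L unfolding hits_def shape_lang_def blocks_def by blast

lemma sample_not_hits:
  assumes "R \<subseteq> free_part" "R \<noteq> {}" "\<And>A. A \<in> blocks \<Longrightarrow> \<not> A \<subseteq> R"
    "\<And>A. A \<in> blocks \<Longrightarrow> A \<inter> R \<noteq> {} \<Longrightarrow> card R \<le> card A"
  shows "\<not> hits W R"
proof -
  obtain S where S: "S \<in> char_supports n" "S \<inter> R = {}"
    using transversal_avoids[OF assms(1,2) n assms(3,4)] by blast
  from support_word(1,2)[OF S(1)] S(2) show ?thesis unfolding hits_def by blast
qed

lemma sample_conflicts:
  assumes "a \<in> X"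
  shows "conflicts W a = {b. b = a \<or> (\<exists>C\<in>\<C>. a \<in> C \<and> b \<in> C)}"
proof -
  have "b \<in> X" if "C \<in> \<C>" "b \<in> C" for b C using that \<C>_X by blast
  then show ?thesis
    unfolding conflicts_def sample_occurs using sample_cooccur[OF assms] by blast
qed

lemma sample_conflicts_class:
  assumes "C \<in> \<C>" "a \<in> C" shows "conflicts W a = C"
proof -
  have aX: "a \<in> X" using assms \<C>_X by blast
  have "(\<exists>C'\<in>\<C>. a \<in> C' \<and> b \<in> C') \<longleftrightarrow> b \<in> C" for b
  proof
    assume "\<exists>C'\<in>\<C>. a \<in> C' \<and> b \<in> C'"
    then obtain C' where "C' \<in> \<C>" "a \<in> C'" "b \<in> C'" by blast
    then show "b \<in> C" using \<C>_disjoint[of C' C a] assms by simp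
  qed (use assms in blast)
  then show ?thesis unfolding sample_conflicts[OF aX] using assms(2) by auto
qed

lemma sample_conflict_free: "conflict_free W = free_part"
proof (intro set_eqI iffI)
  fix a assume a: "a \<in> conflict_free W"
  then have aX: "a \<in> X" by (simp add: conflict_free_def sample_occurs)
  have "a \<notin> C" if "C \<in> \<C>" for C
    using sample_conflicts_class[OF that, of a] \<C>_two[OF that] a by (auto simp: conflict_free_def)
  then show "a \<in> free_part" using aX by (auto simp: free_part_def)
next
  fix a assume a: "a \<in> free_part"
  then have "a \<in> X" "\<And>C. C \<in> \<C> \<Longrightarrow> a \<notin> C" by (auto simp: free_part_def)
  then show "a \<in> conflict_free W" unfolding conflict_free_def
    using sample_conflicts[of a] by (auto simp: sample_occurs)
qed

lemma sample_block_candidate: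
  assumes A: "A \<in> blocks" shows "A \<in> candidates W"
proof -
  obtain a where a: "a \<in> A" using block_nonempty[OF A] by blast
  have af: "a \<in> free_part" using block_free[OF A a] .
  then have "max_support a \<in> char_supports n" by (auto simp: char_supports_def free_part_def)
  note w = support_word(1,2)[OF this]
  have "\<Union>{A'\<in>blocks. a \<in> A'} = A" using A a blocks_disjoint by blast
  then have "max_support a = (free_part - (A - {a})) \<union> pick ` \<C>" by (simp add: max_support_def)
  then have "insert a (free_part - max_support a) = A"
    using a af pick_not_free block_free[OF A] by auto
  then show ?thesis
    unfolding candidates_def sample_conflict_free using sample_hits_block[OF A] af w by blast
qed

lemma sample_accepted: "accepted W m = {A \<in> blocks. card A \<le> m}"
proof (induction m)
  case 0
  show ?case using finite_block block_nonempty by (auto simp: card_eq_0_iff)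
next
  case (Suc m)
  have "R \<in> blocks" if R: "R \<in> candidates W" "card R = Suc m" "\<forall>Q\<in>accepted W m. Q \<inter> R = {}" for R
  proof (rule ccontr)
    assume nb: "R \<notin> blocks"
    obtain a w where aw: "a \<in> free_part" "w \<in> W" "R = insert a (free_part - set_mset w)"
      using R(1) unfolding candidates_def sample_conflict_free by blast
    have finR: "finite R" using aw(3) finite_X by (simp add: free_part_def)
    have small: "A \<inter> R = {}" if "A \<in> blocks" "card A \<le> m" for A using R(3) Suc that by blast
    \<comment> \<open>Smaller blocks are disjoint from \<open>R\<close>, so a block inside
      \<open>R\<close> would have at least the size of \<open>R\<close> and coincide with
      it.\<close>
    have "\<not> A \<subseteq> R" if A: "A \<in> blocks" for A
    proof
      assume AR: "A \<subseteq> R"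
      have "\<not> card A \<le> m" using small[OF A] AR block_nonempty[OF A] by blast
      then have "card R \<le> card A" using R(2) by simp
      then have "A = R" using AR finR by (intro card_seteq) auto
      then show False using nb A by simp
    qed
    moreover have "card R \<le> card A" if "A \<in> blocks" "A \<inter> R \<noteq> {}" for A
      using small that R(2) by fastforce
    moreover have "R \<subseteq> free_part" "R \<noteq> {}" using aw by auto
    ultimately have "\<not> hits W R" by (intro sample_not_hits)
    then show False using R(1) by (simp add: candidates_def)
  qed
  moreover have "A \<in> accepted W (Suc m)" if A: "A \<in> blocks" "card A \<le> Suc m" for A
  proof (cases "card A \<le> m")
    case True
    then show ?thesis using A Suc by simp
  next
    case False
    then have "Q \<inter> A = {}" if "Q \<in> accepted W m" for Q
      using that Suc blocks_disjoint A by blast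
    then show ?thesis using A False sample_block_candidate[OF A(1)] by simp
  qed
  ultimately show ?case using Suc by fastforce
qed

lemma sample_accepted_n: "accepted W n = blocks"
proof -
  have "card A \<le> n" if "A \<in> blocks" for A
  proof -
    have "card A \<le> card X" using \<Q>_X that finite_X by (intro card_mono) (auto simp: blocks_def)
    then show ?thesis using n by simp
  qed
  then show ?thesis unfolding sample_accepted by blast
qed

lemma symbol_class_block:
  assumes A: "A \<in> blocks" "a \<in> A"
  shows "symbol_class W n a = A"
proof -
  have "joint_class W n a = A"
    unfolding joint_class_def sample_accepted_n sample_conflict_free
    using A block_free[OF A(1)] blocks_disjoint[OF _ A(1)] by blast
  then show ?thesis
    using sample_hits_block[OF A(1)] block_free[OF A]
    by (simp add: symbol_class_def sample_conflict_free)
qed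

text \<open>All free symbols outside the blocks form one joint class. No block meets it, so a
  transversal avoids it, and the failing test for \<open>hits\<close> sends each of these symbols
  back to its own singleton.\<close>

lemma symbol_class_star:
  assumes a: "a \<in> free_part" "a \<notin> \<Union>blocks"
  shows "symbol_class W n a = {a}"
proof -
  have "joint_class W n a = free_part - \<Union>blocks"
    unfolding joint_class_def sample_accepted_n sample_conflict_free using a by blast
  moreover have "\<not> hits W (free_part - \<Union>blocks)"
    using a block_nonempty by (intro sample_not_hits) blast+
  ultimately show ?thesis using a by (simp add: symbol_class_def sample_conflict_free)
qed

lemma symbol_class_class:
  assumes C: "C \<in> \<C>" "a \<in> C"
  shows "symbol_class W n a = C"
proof -
  have aX: "a \<in> X" using C \<C>_X by blast
  have "conflicts W b = C \<longleftrightarrow> b \<in> C" if "b \<in> X" for b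
    using sample_conflicts_class[OF C(1)] conflicts_self[of b W] by blast
  then have "{b. occurs W b \<and> conflicts W b = conflicts W a} = C"
    unfolding sample_occurs sample_conflicts_class[OF C] using C(1) \<C>_X by blast
  then show ?thesis using not_class_free[OF C] aX
    by (simp add: symbol_class_def sample_conflict_free sample_occurs)
qed

end

end

lemma learn_dme_exact:
  assumes shape: "shape X \<C> \<Q> Mx" and CS_W: "shape.char_words X \<C> \<Q> Mx n \<subseteq> W"
    and W_L: "W \<subseteq> shape_lang X \<C> \<Q> Mx" and n: "card X \<le> n"
    and S: "distinct S" "X \<subseteq> set S" "length S = n"
  shows "dme_lang (learn_dme S W) = shape_lang X \<C> \<Q> Mx"
proof (rule set_eqI)
  fix w
  interpret shape X \<C> \<Q> Mx by (rule shape)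
  note sample = CS_W W_L n
  note sample_occurs = sample_occurs[OF sample] and sample_repeated = sample_repeated[OF sample]
    and sample_not_hits = sample_not_hits[OF sample]
    and sample_hits_class = sample_hits_class[OF sample]
    and sample_hits_block = sample_hits_block[OF sample]
    and sample_conflict_free = sample_conflict_free[OF sample]
    and symbol_class_block = symbol_class_block[OF sample]
    and symbol_class_star = symbol_class_star[OF sample]
    and symbol_class_class = symbol_class_class[OF sample]
  have not_hits_star: "\<not> hits W {a}" if "a \<in> free_part" "a \<notin> \<Union>blocks" for a
    using that block_nonempty by (intro sample_not_hits) blast+
  have iff: "w \<in> dme_lang (learn_dme S W) \<longleftrightarrow> (\<forall>a. a \<in># w \<longrightarrow> a \<in> X) \<and>
    (\<forall>a\<in>X. (hits W (symbol_class W n a) \<longrightarrow> (\<exists>b\<in>symbol_class W n a. b \<in># w)) \<and>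
      (\<not> plus_symbol W n a \<longrightarrow> a \<in># w \<longrightarrow>
        (\<forall>b\<in>symbol_class W n a. b \<in># w \<longrightarrow> a = b) \<and> (count w a \<le> 1 \<or> a \<notin> Mx)))"
    using learn_dme_iff[OF S(1), of W w] S(2) unfolding S(3) sample_occurs
    using sample_repeated by blast
  have X_cases: "(\<exists>A\<in>blocks. a \<in> A) \<or> (a \<in> free_part \<and> a \<notin> \<Union>blocks) \<or> (\<exists>C\<in>\<C>. a \<in> C)"
    if "a \<in> X" for a using that by (auto simp: free_part_def)
  show "w \<in> dme_lang (learn_dme S W) \<longleftrightarrow> w \<in> shape_lang X \<C> \<Q> Mx"
  proof
    assume L: "w \<in> dme_lang (learn_dme S W)"
    note L = L[unfolded iff]
    show "w \<in> shape_lang X \<C> \<Q> Mx"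
      unfolding shape_lang_def mem_Collect_eq
    proof (intro conjI ballI impI)
      show "set_mset w \<subseteq> X" using L by blast
      show "\<exists>a\<in>Q. a \<in># w" if Q: "Q \<in> \<Q>" for Q
      proof -
        obtain a where a: "a \<in> Q" "a \<in> X" using \<Q>_nonempty[OF Q] \<Q>_X Q by blast
        have "symbol_class W n a = Q"
          using symbol_class_class symbol_class_block a Q by (cases "Q \<in> \<C>") (auto simp: blocks_def)
        moreover have "hits W Q"
          using sample_hits_class sample_hits_block Q by (cases "Q \<in> \<C>") (auto simp: blocks_def)
        ultimately show ?thesis using L a by metis
      qed
      show "a = b" if C: "C \<in> \<C>" "a \<in> C" "b \<in> C" "a \<in># w" "b \<in># w" for C a b
      proof -
        have "\<not> plus_symbol W n a" using not_class_free[OF C(1,2)]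
          by (simp add: plus_symbol_def sample_conflict_free)
        moreover have "a \<in> X" using C \<C>_X by blast
        ultimately show ?thesis using L C symbol_class_class[OF C(1,2)] by metis
      qed
      show "count w a \<le> 1" if a: "a \<in> Mx" for a
      proof (cases "a \<in># w")
        case True
        have aX: "a \<in> X" using a Mx_X by blast
        \<comment> \<open>A plus symbol lies in a block, but the only block that can contain a
          symbol of \<open>Mx\<close> is its singleton, and then its class is a singleton as
          well.\<close>
        have "\<not> plus_symbol W n a"
        proof
          assume p: "plus_symbol W n a"
          then have af: "a \<in> free_part" "symbol_class W n a \<noteq> {a}"
            by (simp_all add: plus_symbol_def sample_conflict_free)
          then obtain A where "A \<in> blocks" "a \<in> A" using symbol_class_star by blast
          then have "A = {a}" using a \<Q>_Mx by (simp add: blocks_def)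
          then show False using symbol_class_block[OF \<open>A \<in> blocks\<close> \<open>a \<in> A\<close>] af by simp
        qed
        then show ?thesis using L aX True a by blast
      qed (simp add: count_eq_zero_iff[THEN iffD2])
    qed
  next
    assume R: "w \<in> shape_lang X \<C> \<Q> Mx"
    have wX: "\<forall>a. a \<in># w \<longrightarrow> a \<in> X" and cnt: "\<And>a. a \<in> Mx \<Longrightarrow> count w a \<le> 1"
      and one: "\<And>C a b. C \<in> \<C> \<Longrightarrow> a \<in> C \<Longrightarrow> b \<in> C \<Longrightarrow> a \<in># w \<Longrightarrow> b \<in># w \<Longrightarrow> a = b"
      and req: "\<And>Q. Q \<in> \<Q> \<Longrightarrow> \<exists>a\<in>Q. a \<in># w"
      using R unfolding shape_lang_def by blast+
    show "w \<in> dme_lang (learn_dme S W)"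
      unfolding iff
    proof (intro conjI ballI impI)
      fix a assume a: "a \<in> X"
      show "\<exists>b\<in>symbol_class W n a. b \<in># w" if h: "hits W (symbol_class W n a)"
        using X_cases[OF a]
      proof (elim disjE bexE)
        fix A assume A: "A \<in> blocks" "a \<in> A"
        then show ?thesis using symbol_class_block[OF A] req by (simp add: blocks_def)
      next
        assume "a \<in> free_part \<and> a \<notin> \<Union>blocks"
        then show ?thesis using symbol_class_star not_hits_star h by auto
      next
        fix C assume C: "C \<in> \<C>" "a \<in> C"
        then show ?thesis using symbol_class_class[OF C] sample_hits_class[OF C(1)] h req by simp
      qed
      show "a = b" if b: "b \<in> symbol_class W n a" "b \<in># w" and np: "\<not> plus_symbol W n a" "a \<in># w" for b
      proof (cases "a \<in> free_part")
        case True
        then show ?thesis using np(1) b(1) by (simp add: plus_symbol_def sample_conflict_free)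
      next
        case False
        then obtain C where "C \<in> \<C>" "a \<in> C" using a by (auto simp: free_part_def)
        then show ?thesis using symbol_class_class[of C a] one b np by metis
      qed
      show "count w a \<le> 1 \<or> a \<notin> Mx" using cnt by blast
    qed (use wX in blast)
  qed
qed

text \<open>\<open>CS\<close> is chosen for \<open>E\<close> and \<open>U\<close> alone and works
  for all later samples \<open>W\<close> and listings \<open>S\<close>. The restriction to
  \<open>U\<close> reflects that a sample can show only symbols that occur in trees of the
  schema.\<close>

lemma learn_dme_characteristic:
  assumes E: "E \<in> dmes \<Sigma>" and fin: "finite \<Sigma>" and ne: "{w \<in> dme_lang E. set_mset w \<subseteq> U} \<noteq> {}"
  obtains CS where "CS \<subseteq> {w \<in> dme_lang E. set_mset w \<subseteq> U}" "CS \<noteq> {}" "finite CS"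
    "card CS \<le> (card \<Sigma> + 1) ^ 3"
    "\<And>W S. \<lbrakk>CS \<subseteq> W; W \<subseteq> {w \<in> dme_lang E. set_mset w \<subseteq> U}; distinct S; set S = \<Sigma>\<rbrakk> \<Longrightarrow>
      dme_lang (learn_dme S W) = {w \<in> dme_lang E. set_mset w \<subseteq> U}"
proof -
  let ?L = "{w \<in> dme_lang E. set_mset w \<subseteq> U}"
  have d: "distinct (dme_symbols E)" "set (dme_symbols E) \<subseteq> \<Sigma>" using E by (auto simp: dmes_def)
  obtain X where X: "X \<subseteq> set (dme_symbols E)" "shapely X ?L" using shapely_dme[OF d(1) ne] by blast
  obtain \<C> \<Q> Mx where sh: "shape X \<C> \<Q> Mx" and L: "?L = shape_lang X \<C> \<Q> Mx"
    using X(2) unfolding shapely_def by blast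
  interpret shape X \<C> \<Q> Mx by (rule sh)
  have cX: "card X \<le> card \<Sigma>" using X(1) d(2) fin by (intro card_mono) auto
  show ?thesis
  proof (rule that)
    show "char_words (card \<Sigma>) \<subseteq> ?L" unfolding L by (rule char_words_subset)
    show "char_words (card \<Sigma>) \<noteq> {}" by (rule char_words_nonempty)
    show "finite (char_words (card \<Sigma>))" by (rule finite_char_words)
    show "card (char_words (card \<Sigma>)) \<le> (card \<Sigma> + 1) ^ 3" using cX by (rule card_char_words)
    show "dme_lang (learn_dme S W) = ?L"
      if "char_words (card \<Sigma>) \<subseteq> W" "W \<subseteq> ?L" "distinct S" "set S = \<Sigma>" for S W
    proof -
      have "length S = card \<Sigma>" using distinct_card[OF that(3)] that(4) by simp
      moreover have "X \<subseteq> set S" using X(1) d(2) that(4) by blast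
      ultimately show ?thesis
        using learn_dme_exact[OF sh that(1) _ cX that(3)] that(2) unfolding L by simp
    qed
  qed
qed

section \<open>Learning a schema\<close>

text \<open>Ordered inductive trees stand between the trees of the setting and their encodings:
  structural induction, replacement of subtrees and the program all work on them.\<close>

datatype 'a rtree = Node (label: 'a) (subtrees: "'a rtree list")

fun rnodes :: "'a rtree \<Rightarrow> 'a rtree list" where
  "rnodes (Node a ts) = Node a ts # concat (map rnodes ts)"

definition rtree_data :: "'a rtree \<Rightarrow> ('a \<times> 'a multiset) set" where
  "rtree_data r = (\<lambda>x. (label x, mset (map label (subtrees x)))) ` set (rnodes r)"

text \<open>Apart from the root label this is all that \<open>satisfies\<close> and the learner see
  of a tree, so trees may be exchanged as long as it is preserved.\<close>

definition tree_data :: "'a tree \<Rightarrow> ('a \<times> 'a multiset) set" where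
  "tree_data t = (\<lambda>n. (tree_lab t n, child_word t n)) ` tree_nodes t"

lemma rtree_data_Node:
  "rtree_data (Node a ts) = insert (a, mset (map label ts)) (\<Union>r\<in>set ts. rtree_data r)"
  by (auto simp: rtree_data_def)

lemma fst_rtree_data: "fst ` rtree_data r = label ` set (rnodes r)"
  by (simp add: rtree_data_def image_image)

lemma rnodes_self: "r \<in> set (rnodes r)"
  by (cases r) simp

lemma satisfies_iff:
  "satisfies t S \<longleftrightarrow> tree_lab t (tree_root t) = dms_root S \<and>
    (\<forall>(a, w) \<in> tree_data t. w \<in> dme_lang (dms_rule S a))"
  by (auto simp: satisfies_def tree_data_def)

section \<open>Reading an encoded tree as an inductive tree\<close>

inductive represents :: "'a tree \<Rightarrow> nat \<Rightarrow> 'a rtree \<Rightarrow> bool" for t where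
  "distinct ms \<Longrightarrow> set ms = {m. (n, m) \<in> tree_child t} \<Longrightarrow> list_all2 (represents t) ms rs \<Longrightarrow>
    represents t n (Node (tree_lab t n) rs)"

fun enc_rtree :: "'a rtree \<Rightarrow> 'a val" where
  "enc_rtree (Node a ts) = VPair (VSym a) (enc_list (map enc_rtree ts))"

lemma enc_node_represents: "enc_node t n v \<Longrightarrow> \<exists>r. represents t n r \<and> v = enc_rtree r"
proof (induction rule: enc_node.induct)
  case (1 ms n vs)
  have "\<exists>rs. list_all2 (represents t) ms rs \<and> vs = map enc_rtree rs"
    using 1(3)
  proof (induction rule: list_all2_induct)
    case Nil
    then show ?case by simp
  next
    case (Cons m ms v vs)
    then obtain r rs where "list_all2 (represents t) ms rs" "vs = map enc_rtree rs"
      "represents t m r" "v = enc_rtree r" by blast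
    then show ?case by (intro exI[of _ "r # rs"]) simp
  qed
  then obtain rs where rs: "list_all2 (represents t) ms rs" "vs = map enc_rtree rs" by blast
  then have "represents t n (Node (tree_lab t n) rs)" using 1 by (intro represents.intros)
  then show ?case using rs(2) by (intro exI[of _ "Node (tree_lab t n) rs"]) simp
qed

lemma represents_label: "represents t n r \<Longrightarrow> label r = tree_lab t n"
  by (induction rule: represents.induct) simp

context
  fixes t :: "'a tree" and \<Sigma> :: "'a set"
  assumes t: "t \<in> trees \<Sigma>"
begin

lemma tree_facts:
  shows finite_nodes: "finite (tree_nodes t)" and root_node: "tree_root t \<in> tree_nodes t"
    and lab_in: "n \<in> tree_nodes t \<Longrightarrow> tree_lab t n \<in> \<Sigma>"
    and child_nodes: "(n, m) \<in> tree_child t \<Longrightarrow> n \<in> tree_nodes t \<and> m \<in> tree_nodes t"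
    and child_acyclic: "acyclic (tree_child t)"
    and parent: "n \<in> tree_nodes t \<Longrightarrow> n \<noteq> tree_root t \<Longrightarrow> \<exists>!m. (m, n) \<in> tree_child t"
  using t by (auto simp: trees_def)

lemma finite_child: "finite (tree_child t)"
  using t finite_subset[of "tree_child t" "tree_nodes t \<times> tree_nodes t"] by (auto simp: trees_def)

lemma root_reaches: "n \<in> tree_nodes t \<Longrightarrow> (tree_root t, n) \<in> (tree_child t)\<^sup>*"
proof -
  have "wf (tree_child t)" using finite_child child_acyclic by (rule finite_acyclic_wf)
  then show "n \<in> tree_nodes t \<Longrightarrow> (tree_root t, n) \<in> (tree_child t)\<^sup>*"
  proof (induction n rule: wf_induct_rule)
    case (less n)
    show ?case
    proof (cases "n = tree_root t")
      case False
      then obtain m where m: "(m, n) \<in> tree_child t" using parent less by blast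
      then have "(tree_root t, m) \<in> (tree_child t)\<^sup>*" using less child_nodes by blast
      then show ?thesis using m by (rule rtrancl_into_rtrancl)
    qed simp
  qed
qed

text \<open>Trees postulate uniqueness for non-root nodes only. The root has no parent at all: it
  reaches every node, so an edge back to it would close a cycle.\<close>

lemma parent_unique:
  assumes "(m, n) \<in> tree_child t" "(m', n) \<in> tree_child t"
  shows "m = m'"
proof (cases "n = tree_root t")
  case True
  have "(n, m) \<in> (tree_child t)\<^sup>*" using root_reaches child_nodes assms(1) True by blast
  then have "(n, n) \<in> (tree_child t)\<^sup>+" using assms(1) by (rule rtrancl_into_trancl1)
  then show ?thesis using child_acyclic by (simp add: acyclic_def)
next
  case False
  then show ?thesis using parent[of n] child_nodes assms by blast
qed

definition descendants :: "nat \<Rightarrow> nat set" where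
  "descendants n = {m. (n, m) \<in> (tree_child t)\<^sup>*}"

lemma descendants_subset: "n \<in> tree_nodes t \<Longrightarrow> descendants n \<subseteq> tree_nodes t"
proof
  fix m assume "n \<in> tree_nodes t" "m \<in> descendants n"
  then have "(n, m) \<in> (tree_child t)\<^sup>*" by (simp add: descendants_def)
  then show "m \<in> tree_nodes t"
    using \<open>n \<in> tree_nodes t\<close> child_nodes by (induction rule: rtrancl_induct) blast+
qed

lemma descendants_root: "descendants (tree_root t) = tree_nodes t"
  using descendants_subset[OF root_node] root_reaches by (auto simp: descendants_def)

lemma descendants_unfold:
  "descendants n = insert n (\<Union>m\<in>{m. (n, m) \<in> tree_child t}. descendants m)"
  by (auto simp: descendants_def intro: converse_rtrancl_into_rtrancl elim: converse_rtranclE)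

text \<open>Parents are unique, so two paths into \<open>x\<close> agree when traced backwards, and
  the longer one passes through the start of the shorter.\<close>

lemma descendants_comparable:
  assumes "(m, x) \<in> (tree_child t)\<^sup>*" "(m', x) \<in> (tree_child t)\<^sup>*"
  shows "(m, m') \<in> (tree_child t)\<^sup>* \<or> (m', m) \<in> (tree_child t)\<^sup>*"
  using assms(1,2)
proof (induction rule: rtrancl_induct)
  case base
  then show ?case by blast
next
  case (step y z)
  from step.prems show ?case
  proof (cases rule: rtranclE)
    case base
    then show ?thesis using step(1,2) by (meson rtrancl_into_rtrancl)
  next
    case (step y')
    then have "y' = y" using parent_unique \<open>(y, z) \<in> tree_child t\<close> by blast
    then show ?thesis using step \<open>(m', y) \<in> _ \<Longrightarrow> _\<close> by blast
  qed
qed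

lemma siblings_not_reach:
  assumes "(n, m) \<in> tree_child t" "(n, m') \<in> tree_child t" "m \<noteq> m'"
  shows "(m, m') \<notin> (tree_child t)\<^sup>*"
proof
  assume "(m, m') \<in> (tree_child t)\<^sup>*"
  then obtain p where p: "(m, p) \<in> (tree_child t)\<^sup>*" "(p, m') \<in> tree_child t"
    using assms(3) by (meson rtranclE)
  then have "p = n" using parent_unique assms(2) by blast
  then have "(n, n) \<in> (tree_child t)\<^sup>+" using p(1) assms(1) by (meson rtrancl_into_trancl2)
  then show False using child_acyclic by (simp add: acyclic_def)
qed

lemma descendants_disjoint:
  assumes "(n, m) \<in> tree_child t" "(n, m') \<in> tree_child t" "m \<noteq> m'"
  shows "descendants m \<inter> descendants m' = {}"
  using descendants_comparable siblings_not_reach[OF assms]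
    siblings_not_reach[OF assms(2,1) assms(3)[symmetric]]
  unfolding descendants_def by blast

lemma not_own_descendant:
  assumes "(n, m) \<in> tree_child t" shows "n \<notin> descendants m"
proof
  assume "n \<in> descendants m"
  then have "(n, n) \<in> (tree_child t)\<^sup>+" using assms by (simp add: descendants_def rtrancl_into_trancl2)
  then show False using child_acyclic by (simp add: acyclic_def)
qed

text \<open>The encoding unravels the child relation. Unique parents keep the descendants of
  siblings disjoint, so no node is copied and the count is exact; the running time in terms of
  \<open>tree_size\<close> depends on this.\<close>

lemma represents_data:
  assumes "represents t n r" "n \<in> tree_nodes t"
  shows "rtree_data r = (\<lambda>m. (tree_lab t m, child_word t m)) ` descendants n \<and>
    length (rnodes r) = card (descendants n)"
  using assms
proof (induction rule: represents.induct)
  case (1 ms n rs)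
  note ms = 1(1,2)
  have children: "{m \<in> tree_nodes t. (n, m) \<in> tree_child t} = set ms"
    using ms child_nodes by blast
  have IH: "list_all2 (\<lambda>m r. label r = tree_lab t m \<and>
      rtree_data r = (\<lambda>m. (tree_lab t m, child_word t m)) ` descendants m \<and>
      length (rnodes r) = card (descendants m)) ms rs"
  proof (rule list.rel_mono_strong[OF 1(3)])
    fix m r
    assume m: "m \<in> set ms" and r: "represents t m r \<and> (m \<in> tree_nodes t \<longrightarrow>
      rtree_data r = (\<lambda>m. (tree_lab t m, child_word t m)) ` descendants m \<and>
      length (rnodes r) = card (descendants m))"
    have "m \<in> tree_nodes t" using m ms child_nodes by blast
    then show "label r = tree_lab t m \<and>
        rtree_data r = (\<lambda>m. (tree_lab t m, child_word t m)) ` descendants m \<and>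
        length (rnodes r) = card (descendants m)"
      using r represents_label by blast
  qed
  have "map label rs = map (tree_lab t) ms"
    using IH by (induction rule: list_all2_induct) auto
  moreover have "child_word t n = mset (map (tree_lab t) ms)"
    unfolding child_word_def children using ms(1) by (simp add: mset_set_set)
  ultimately have cw: "child_word t n = mset (map label rs)" by simp
  have data: "(\<Union>r\<in>set rs. rtree_data r) =
      (\<Union>m\<in>set ms. (\<lambda>m. (tree_lab t m, child_word t m)) ` descendants m)"
    using IH by (induction rule: list_all2_induct) auto
  have len: "length (concat (map rnodes rs)) = (\<Sum>m\<leftarrow>ms. card (descendants m))"
    using IH by (induction rule: list_all2_induct) auto
  have "card (descendants n) = Suc (card (\<Union>m\<in>set ms. descendants m))"
  proof -
    have "finite (\<Union>m\<in>set ms. descendants m)"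
    proof (rule finite_subset[OF _ finite_nodes])
      show "(\<Union>m\<in>set ms. descendants m) \<subseteq> tree_nodes t"
        using descendants_subset children by blast
    qed
    moreover have "n \<notin> (\<Union>m\<in>set ms. descendants m)" using not_own_descendant ms by auto
    ultimately show ?thesis using descendants_unfold[of n] ms by simp
  qed
  also have "card (\<Union>m\<in>set ms. descendants m) = (\<Sum>m\<in>set ms. card (descendants m))"
  proof (rule card_UN_disjoint)
    show "\<forall>m\<in>set ms. finite (descendants m)"
      using ms child_nodes finite_subset[OF descendants_subset finite_nodes] by blast
    show "\<forall>m\<in>set ms. \<forall>m'\<in>set ms. m \<noteq> m' \<longrightarrow> descendants m \<inter> descendants m' = {}"
      using ms descendants_disjoint by auto
  qed simp
  also have "\<dots> = (\<Sum>m\<leftarrow>ms. card (descendants m))" using ms(1) by (simp add: sum_list_distinct_conv_sum_set)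
  finally have "length (rnodes (Node (tree_lab t n) rs)) = card (descendants n)" using len by simp
  moreover have "rtree_data (Node (tree_lab t n) rs) =
      (\<lambda>m. (tree_lab t m, child_word t m)) ` descendants n"
    unfolding rtree_data_Node data cw[symmetric] using descendants_unfold[of n] ms by auto
  ultimately show ?case by blast
qed

lemma enc_tree_rtree:
  assumes "enc_tree t v"
  obtains r where "v = enc_rtree r" "rtree_data r = tree_data t" "label r = tree_lab t (tree_root t)"
    "length (rnodes r) = tree_size t"
proof -
  obtain r where r: "represents t (tree_root t) r" "v = enc_rtree r"
    using enc_node_represents assms unfolding enc_tree_def by blast
  show ?thesis
    using represents_data[OF r(1) root_node] represents_label[OF r(1)] r(2)
    by (intro that[of r]) (simp_all add: descendants_root tree_data_def tree_size_def)
qed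

lemma tree_data_alphabet:
  assumes "(a, w) \<in> tree_data t"
  shows "a \<in> \<Sigma>" "set_mset w \<subseteq> fst ` tree_data t"
proof -
  obtain n where n: "n \<in> tree_nodes t" "a = tree_lab t n" "w = child_word t n"
    using assms by (auto simp: tree_data_def)
  then show "a \<in> \<Sigma>" using lab_in by simp
  have "finite {m \<in> tree_nodes t. (n, m) \<in> tree_child t}" using finite_nodes by simp
  then show "set_mset w \<subseteq> fst ` tree_data t"
    unfolding n(3) child_word_def tree_data_def by (auto simp: image_image)
qed

lemma root_tree_data: "tree_lab t (tree_root t) \<in> fst ` tree_data t"
  using root_node by (auto simp: tree_data_def image_image)

lemma tree_to_rtree:
  obtains r where "rtree_data r = tree_data t" "label r = tree_lab t (tree_root t)"
  using enc_tree_exists[OF t] enc_tree_rtree by metis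

end

section \<open>Inductive trees as trees of the setting\<close>

fun subtree_at :: "'a rtree \<Rightarrow> nat list \<Rightarrow> 'a rtree option" where
  "subtree_at r [] = Some r"
| "subtree_at (Node a ts) (i # p) = (if i < length ts then subtree_at (ts ! i) p else None)"

lemma subtree_at_append:
  "subtree_at r (p @ q) = (case subtree_at r p of None \<Rightarrow> None | Some x \<Rightarrow> subtree_at x q)"
  by (induction r p rule: subtree_at.induct) auto

lemma subtree_at_snoc:
  "subtree_at r p = Some x \<Longrightarrow> subtree_at r (p @ [i]) =
    (if i < length (subtrees x) then Some (subtrees x ! i) else None)"
  by (cases x) (simp add: subtree_at_append)

lemma finite_paths: "finite {p. subtree_at r p \<noteq> None}"
proof (induction r)
  case (Node a ts)
  have "{p. subtree_at (Node a ts) p \<noteq> None} \<subseteq>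
    insert [] (\<Union>i\<in>{..<length ts}. (#) i ` {p. subtree_at (ts ! i) p \<noteq> None})"
  proof
    fix p assume "p \<in> {p. subtree_at (Node a ts) p \<noteq> None}"
    then show "p \<in> insert [] (\<Union>i\<in>{..<length ts}. (#) i ` {p. subtree_at (ts ! i) p \<noteq> None})"
      by (cases p) (auto split: if_splits)
  qed
  moreover have "finite \<dots>" using Node by auto
  ultimately show ?case by (rule finite_subset)
qed

lemma set_rnodes: "x \<in> set (rnodes r) \<longleftrightarrow> (\<exists>p. subtree_at r p = Some x)"
proof (induction r)
  case (Node a ts)
  show ?case
  proof
    assume "x \<in> set (rnodes (Node a ts))"
    then consider "x = Node a ts" | i where "i < length ts" "x \<in> set (rnodes (ts ! i))"
      using in_set_conv_nth[of _ ts] by (auto simp del: in_set_conv_nth)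
    then show "\<exists>p. subtree_at (Node a ts) p = Some x"
    proof cases
      case 1
      then show ?thesis by (intro exI[of _ "[]"]) simp
    next
      case 2
      then obtain p where "subtree_at (ts ! i) p = Some x" using Node[of "ts ! i"] by auto
      then show ?thesis using 2 by (intro exI[of _ "i # p"]) simp
    qed
  next
    assume "\<exists>p. subtree_at (Node a ts) p = Some x"
    then obtain p where p: "subtree_at (Node a ts) p = Some x" by blast
    then show "x \<in> set (rnodes (Node a ts))"
    proof (cases p)
      case Nil
      then have "x = Node a ts" using p by simp
      then show ?thesis using rnodes_self by simp
    next
      case (Cons i q)
      then have "i < length ts" "subtree_at (ts ! i) q = Some x" using p by (auto split: if_splits)
      then have "x \<in> set (rnodes (ts ! i))" using Node[of "ts ! i"] by auto
      then show ?thesis using \<open>i < length ts\<close> nth_mem by fastforce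
    qed
  qed
qed

text \<open>Nodes are coded paths, so equal subtrees at different places remain different nodes.
  Every edge lengthens the path, whence acyclicity.\<close>

lemma tree_of_rtree:
  assumes lab: "fst ` rtree_data r \<subseteq> \<Sigma>"
  obtains t where "t \<in> trees \<Sigma>" "tree_data t = rtree_data r" "tree_lab t (tree_root t) = label r"
proof -
  let ?at = "\<lambda>p. subtree_at r p"
  define N where "N = list_encode ` {p. ?at p \<noteq> None}"
  define lb where "lb = (\<lambda>n. label (the (?at (list_decode n))))"
  define ch where "ch = {(list_encode p, list_encode (p @ [i])) |p i. ?at (p @ [i]) \<noteq> None}"
  define t :: "'a tree" where "t = \<lparr>tree_nodes = N, tree_root = list_encode [],
    tree_lab = restrict lb N, tree_child = ch\<rparr>"
  have prefix: "?at p \<noteq> None" if "?at (p @ q) \<noteq> None" for p q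
    using that by (auto simp: subtree_at_append split: option.splits)
  have N: "list_encode p \<in> N \<longleftrightarrow> ?at p \<noteq> None" for p
    by (auto simp: N_def inj_image_mem_iff[OF inj_list_encode])
  have ch: "(list_encode p, n) \<in> ch \<longleftrightarrow> (\<exists>i. n = list_encode (p @ [i]) \<and> ?at (p @ [i]) \<noteq> None)" for p n
    by (auto simp: ch_def list_encode_eq)
  have labN: "lb n \<in> \<Sigma>" if nN: "n \<in> N" for n
  proof -
    obtain p where p: "n = list_encode p" "?at p \<noteq> None" using nN unfolding N_def by blast
    then obtain x where "?at p = Some x" by blast
    moreover from this have "x \<in> set (rnodes r)" using set_rnodes by blast
    ultimately show ?thesis using lab p(1) by (auto simp: lb_def fst_rtree_data)
  qed
  have "acyclic ch"
  proof (rule acyclic_subset)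
    show "ch \<subseteq> measure (\<lambda>n. length (list_decode n))" by (auto simp: ch_def)
    show "acyclic (measure (\<lambda>n. length (list_decode n)))" by (rule wf_acyclic) simp
  qed
  moreover have "\<exists>!m. (m, n) \<in> ch" if nN: "n \<in> N - {list_encode []}" for n
  proof -
    obtain p where p: "n = list_encode p" "?at p \<noteq> None" using nN unfolding N_def by blast
    then have "p \<noteq> []" using nN by auto
    then obtain q i where q: "p = q @ [i]" by (cases p rule: rev_cases) auto
    have "(list_encode q, n) \<in> ch" using p q by (auto simp: ch_def)
    moreover have "m = list_encode q" if "(m, n) \<in> ch" for m
      using that p(1) q by (auto simp: ch_def list_encode_eq)
    ultimately show ?thesis by blast
  qed
  moreover have "ch \<subseteq> N \<times> N"
  proof clarify
    fix x y assume "(x, y) \<in> ch"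
    then obtain p i where "x = list_encode p" "y = list_encode (p @ [i])" "?at (p @ [i]) \<noteq> None"
      unfolding ch_def by blast
    then show "x \<in> N \<and> y \<in> N" using prefix[of p "[i]"] by (simp add: N)
  qed
  ultimately have "t \<in> trees \<Sigma>"
    unfolding trees_def t_def using labN finite_paths[of r] N[of "[]"] by (auto simp: N_def)
  moreover have "tree_data t = rtree_data r"
  proof -
    have node: "(tree_lab t (list_encode p), child_word t (list_encode p)) =
        (label x, mset (map label (subtrees x)))" if x: "?at p = Some x" for p x
    proof -
      let ?f = "\<lambda>i. list_encode (p @ [i])"
      have "{m \<in> tree_nodes t. (list_encode p, m) \<in> tree_child t} = ?f ` {..<length (subtrees x)}"
        using subtree_at_snoc[OF x] by (auto simp: t_def ch N split: if_splits)
      moreover have "inj_on ?f {..<length (subtrees x)}" by (auto simp: inj_on_def list_encode_eq)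
      ultimately have "child_word t (list_encode p) =
          image_mset (tree_lab t) (image_mset ?f (mset_set {..<length (subtrees x)}))"
        unfolding child_word_def by (simp add: image_mset_mset_set)
      also have "\<dots> = image_mset (\<lambda>i. label (subtrees x ! i)) (mset_set {..<length (subtrees x)})"
        unfolding image_mset.compositionality
        by (rule image_mset_cong) (auto simp: t_def N lb_def subtree_at_snoc[OF x])
      also have "\<dots> = mset (map label (subtrees x))"
      proof -
        have "map label (subtrees x) = map (\<lambda>i. label (subtrees x ! i)) [0..<length (subtrees x)]"
          by (rule nth_equalityI) simp_all
        from arg_cong[OF this, of mset] show ?thesis
          by (simp only: mset_map mset_upt lessThan_atLeast0)
      qed
      finally show ?thesis using x by (simp add: t_def N lb_def)
    qed
    have "tree_data t = (\<lambda>p. (tree_lab t (list_encode p), child_word t (list_encode p))) `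
        {p. ?at p \<noteq> None}"
      by (simp add: tree_data_def t_def N_def image_image)
    also have "\<dots> = {(label x, mset (map label (subtrees x))) |p x. ?at p = Some x}"
      using node by force
    also have "\<dots> = (\<lambda>x. (label x, mset (map label (subtrees x)))) ` {x. \<exists>p. ?at p = Some x}"
      by blast
    also have "\<dots> = rtree_data r" unfolding rtree_data_def set_rnodes[symmetric] by simp
    finally show ?thesis .
  qed
  moreover have "tree_lab t (tree_root t) = label r"
    using N[of "[]"] by (simp add: t_def lb_def)
  ultimately show ?thesis by (rule that)
qed

text \<open>Only the label of a subtree enters the child word of its parent, so a replacement with
  the same label leaves the data above it unchanged.\<close>

lemma replace_subtree:
  assumes "x \<in> set (rnodes r)" "label x' = label x" "rtree_data r \<subseteq> A" "rtree_data x' \<subseteq> A"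
  shows "\<exists>r'. label r' = label r \<and> rtree_data r' \<subseteq> A \<and> x' \<in> set (rnodes r')"
  using assms(1,3)
proof (induction r)
  case (Node a ts)
  show ?case
  proof (cases "x = Node a ts")
    case True
    then show ?thesis using assms(2,4) rnodes_self by (intro exI[of _ x']) auto
  next
    case False
    then obtain y where y: "y \<in> set ts" "x \<in> set (rnodes y)" using Node.prems(1) by auto
    moreover have "rtree_data y \<subseteq> A" using Node.prems(2) y by (auto simp: rtree_data_Node)
    ultimately obtain y' where y': "label y' = label y" "rtree_data y' \<subseteq> A" "x' \<in> set (rnodes y')"
      using Node.IH by blast
    obtain us vs where ts: "ts = us @ y # vs" using y(1) by (meson split_list)
    have "rtree_data (Node a (us @ y' # vs)) \<subseteq> A"
      using Node.prems(2) y'(1,2) by (auto simp: rtree_data_Node ts)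
    then show ?thesis using y'(3) by (intro exI[of _ "Node a (us @ y' # vs)"]) auto
  qed
qed

section \<open>The learner, its soundness and its completeness\<close>

definition sample_words :: "'a tree set \<Rightarrow> 'a \<Rightarrow> 'a multiset set" where
  "sample_words D a = {w. \<exists>t\<in>D. (a, w) \<in> tree_data t}"

definition root_labels :: "'a tree set \<Rightarrow> 'a set" where
  "root_labels D = (\<lambda>t. tree_lab t (tree_root t)) ` D"

text \<open>All trees of a schema share the root label, and this is the only way in which a sample
  can be inconsistent with every schema. A symbol absent from the sample has no words, and its
  learned rule admits only the empty word.\<close>

definition dms_learner :: "'a::linorder set \<Rightarrow> 'a tree set \<Rightarrow> 'a dms option" where
  "dms_learner \<Sigma> D =
     (if is_singleton (root_labels D) then
        Some \<lparr>dms_root = the_elem (root_labels D),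
              dms_rule = \<lambda>a\<in>\<Sigma>. learn_dme (sorted_list_of_set \<Sigma>) (sample_words D a)\<rparr>
      else None)"

lemma sample_words_occurs:
  assumes "D \<subseteq> trees \<Sigma>" "occurs (sample_words D a) b"
  shows "b \<in> \<Sigma>"
proof -
  obtain t w where tw: "t \<in> D" "(a, w) \<in> tree_data t" "b \<in># w"
    using assms(2) by (auto simp: occurs_def sample_words_def)
  then have t: "t \<in> trees \<Sigma>" using assms(1) by blast
  then obtain w' where "(b, w') \<in> tree_data t" using tree_data_alphabet(2)[OF t tw(2)] tw(3) by force
  then show ?thesis using tree_data_alphabet(1)[OF t] by blast
qed

lemma sound_dms_learner: "sound_learner dms_setting dms_learner"
  unfolding sound_learner_def
proof (intro allI impI)
  fix \<Sigma> :: "'a set" and D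
  assume a: "finite \<Sigma> \<and> is_sample dms_setting \<Sigma> D"
  then have fin: "finite \<Sigma>" and D: "D \<subseteq> trees \<Sigma>" "D \<noteq> {}"
    by (auto simp: is_sample_def dms_setting_def)
  let ?S = "sorted_list_of_set \<Sigma>"
  show "case dms_learner \<Sigma> D of
      Some c \<Rightarrow> c \<in> concepts dms_setting \<Sigma> \<and> consistent dms_setting \<Sigma> D c
    | None \<Rightarrow> \<not> (\<exists>c\<in>concepts dms_setting \<Sigma>. consistent dms_setting \<Sigma> D c)"
  proof (cases "is_singleton (root_labels D)")
    case False
    have "is_singleton (root_labels D)" if "consistent dms_setting \<Sigma> D c" for c
    proof -
      have "root_labels D = {dms_root c}"
        using that D(2) by (force simp: consistent_def dms_setting_def dms_lang_def satisfies_def root_labels_def)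
      then show ?thesis by simp
    qed
    then show ?thesis using False by (auto simp: dms_learner_def)
  next
    case True
    then obtain a0 where a0: "root_labels D = {a0}" by (auto simp: is_singleton_def)
    define c where "c = \<lparr>dms_root = a0, dms_rule = \<lambda>a\<in>\<Sigma>. learn_dme ?S (sample_words D a)\<rparr>"
    have c: "dms_learner \<Sigma> D = Some c" using True a0 by (simp add: dms_learner_def c_def)
    have root: "tree_lab t (tree_root t) = a0" if "t \<in> D" for t using a0 that by (auto simp: root_labels_def)
    obtain t0 where t0: "t0 \<in> D" using D(2) by blast
    then have "a0 \<in> fst ` tree_data t0" using root_tree_data[of t0 \<Sigma>] D(1) root[OF t0] by auto
    then have a0\<Sigma>: "a0 \<in> \<Sigma>" using tree_data_alphabet(1)[of t0 \<Sigma>] t0 D(1) by auto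
    then have "learn_dme ?S W \<in> dmes \<Sigma>" for W
      using learn_dme_dmes[of ?S W] fin by auto
    then have "c \<in> dmss \<Sigma>" using a0\<Sigma> by (simp add: c_def dmss_def)
    moreover have "t \<in> dms_lang \<Sigma> c" if t: "t \<in> D" for t
    proof -
      have "w \<in> dme_lang (dms_rule c a)" if aw: "(a, w) \<in> tree_data t" for a w
      proof -
        have "w \<in> sample_words D a" using aw t by (auto simp: sample_words_def)
        moreover have "sample_words D a \<subseteq> dme_lang (learn_dme ?S (sample_words D a))"
          using fin sample_words_occurs[OF D(1)] by (intro learn_dme_consistent) auto
        moreover have "a \<in> \<Sigma>" using tree_data_alphabet(1)[OF _ aw] t D(1) by blast
        ultimately show ?thesis by (auto simp: c_def)
      qed
      then show ?thesis using t D(1) root by (auto simp: dms_lang_def satisfies_iff c_def)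
    qed
    ultimately show ?thesis by (auto simp: c consistent_def dms_setting_def)
  qed
qed

text \<open>Subtrees for the symbols of \<open>w\<close> can be taken from the trees of the schema that use them.\<close>

lemma realize_word:
  assumes S: "S \<in> dmss \<Sigma>" and U: "U = (\<Union>t\<in>dms_lang \<Sigma> S. fst ` tree_data t)"
    and a: "a \<in> U" and w: "w \<in> dme_lang (dms_rule S a)" "set_mset w \<subseteq> U"
  shows "\<exists>t\<in>dms_lang \<Sigma> S. (a, w) \<in> tree_data t"
proof -
  let ?A = "{(b, v). b \<in> \<Sigma> \<and> v \<in> dme_lang (dms_rule S b)}"
  have sub: "\<exists>r x. rtree_data r \<subseteq> ?A \<and> label r = dms_root S \<and> x \<in> set (rnodes r) \<and> label x = b"
    if bU: "b \<in> U" for b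
  proof -
    obtain t where t: "t \<in> dms_lang \<Sigma> S" "b \<in> fst ` tree_data t" using bU unfolding U by blast
    then have tr: "t \<in> trees \<Sigma>" by (simp add: dms_lang_def)
    obtain r where r: "rtree_data r = tree_data t" "label r = tree_lab t (tree_root t)"
      using tree_to_rtree[OF tr] by blast
    have "rtree_data r \<subseteq> ?A"
      using t(1) tree_data_alphabet(1)[OF tr] unfolding r(1) by (auto simp: dms_lang_def satisfies_iff)
    moreover have "b \<in> label ` set (rnodes r)" using t(2) unfolding r(1)[symmetric] fst_rtree_data .
    moreover have "label r = dms_root S" using t(1) r(2) by (simp add: dms_lang_def satisfies_iff)
    ultimately show ?thesis by blast
  qed
  have mono: "rtree_data x \<subseteq> rtree_data r" if "x \<in> set (rnodes r)" for x r :: "'a rtree"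
  proof -
    have "set (rnodes x) \<subseteq> set (rnodes r)" using that
      by (induction r) auto
    then show ?thesis by (auto simp: rtree_data_def)
  qed
  have "\<exists>x. rtree_data x \<subseteq> ?A \<and> label x = b" if bU: "b \<in> U" for b
  proof -
    obtain r x where "rtree_data r \<subseteq> ?A" "x \<in> set (rnodes r)" "label x = b" using sub[OF bU] by blast
    moreover from this have "rtree_data x \<subseteq> rtree_data r" by (intro mono)
    ultimately show ?thesis by (intro exI[of _ x] conjI) (rule order_trans)
  qed
  then have "\<exists>g. \<forall>b\<in>U. rtree_data (g b) \<subseteq> ?A \<and> label (g b) = b" by (intro bchoice ballI)
  then obtain g where g: "\<And>b. b \<in> U \<Longrightarrow> rtree_data (g b) \<subseteq> ?A" "\<And>b. b \<in> U \<Longrightarrow> label (g b) = b"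
    by blast
  obtain l where l: "mset l = w" using ex_mset by blast
  have lU: "set l \<subseteq> U" using w(2) l by auto
  \<comment> \<open>A node labeled \<open>a\<close> whose children spell \<open>w\<close>; it will
    replace a subtree with label \<open>a\<close> in some tree of the schema.\<close>
  define x' where "x' = Node a (map g l)"
  obtain r x where r: "rtree_data r \<subseteq> ?A" "label r = dms_root S" "x \<in> set (rnodes r)" "label x = a"
    using sub[OF a] by blast
  have labels: "map label (map g l) = l" using lU g(2) by (simp add: map_idI subset_iff)
  have "a \<in> \<Sigma>" using r(1,3,4) by (auto simp: rtree_data_def)
  then have "rtree_data x' \<subseteq> ?A"
    unfolding x'_def rtree_data_Node labels using w(1) l g(1) lU by auto
  then obtain r' where r': "label r' = label r" "rtree_data r' \<subseteq> ?A" "x' \<in> set (rnodes r')"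
    using replace_subtree[OF r(3) _ r(1), of x'] r(4) by (auto simp: x'_def)
  have "fst ` rtree_data r' \<subseteq> \<Sigma>" using r'(2) by auto
  then obtain t where t: "t \<in> trees \<Sigma>" "tree_data t = rtree_data r'" "tree_lab t (tree_root t) = label r'"
    by (rule tree_of_rtree)
  have "t \<in> dms_lang \<Sigma> S" using t r' r(2) by (auto simp: dms_lang_def satisfies_iff)
  moreover have "(a, w) \<in> tree_data t"
  proof -
    have "(label x', mset (map label (subtrees x'))) \<in> rtree_data r'" using r'(3) by (auto simp: rtree_data_def)
    moreover have "mset (map label (subtrees x')) = w" using labels l by (simp add: x'_def del: mset_map)
    ultimately show ?thesis unfolding t(2) by (simp add: x'_def)
  qed
  ultimately show ?thesis by blast
qed

text \<open>The rules of \<open>S\<close> may mention symbols that occur in none of its trees, being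
  unreachable or having no finite subtree, and no sample determines them. Trees of \<open>S'\<close>
  avoid these too: the root label is in \<open>U\<close>, and rules of \<open>S'\<close> at symbols
  of \<open>U\<close> produce only symbols of \<open>U\<close>.\<close>

lemma dms_lang_eqI:
  assumes root: "dms_root S' = dms_root S"
    and U: "U = (\<Union>t\<in>dms_lang \<Sigma> S. fst ` tree_data t)" and ne: "dms_lang \<Sigma> S \<noteq> {}"
    and rule: "\<And>a. a \<in> U \<Longrightarrow> dme_lang (dms_rule S' a) = {w \<in> dme_lang (dms_rule S a). set_mset w \<subseteq> U}"
  shows "dms_lang \<Sigma> S' = dms_lang \<Sigma> S"
proof (intro equalityI subsetI)
  fix t assume t: "t \<in> dms_lang \<Sigma> S"
  then have tr: "t \<in> trees \<Sigma>" by (simp add: dms_lang_def)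
  have "w \<in> dme_lang (dms_rule S' a)" if aw: "(a, w) \<in> tree_data t" for a w
  proof -
    have sub: "fst ` tree_data t \<subseteq> U" unfolding U using t by blast
    then have "set_mset w \<subseteq> U" using tree_data_alphabet(2)[OF tr aw] by blast
    moreover have "w \<in> dme_lang (dms_rule S a)" using t aw by (auto simp: dms_lang_def satisfies_iff)
    moreover have "a \<in> U" using sub aw by force
    ultimately show ?thesis by (simp add: rule)
  qed
  then show "t \<in> dms_lang \<Sigma> S'" using t root by (auto simp: dms_lang_def satisfies_iff)
next
  fix t assume t: "t \<in> dms_lang \<Sigma> S'"
  then have tr: "t \<in> trees \<Sigma>" by (simp add: dms_lang_def)
  obtain r where r: "rtree_data r = tree_data t" "label r = tree_lab t (tree_root t)"
    using tree_to_rtree[OF tr] by blast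
  have "dms_root S \<in> U"
  proof -
    obtain t0 where t0: "t0 \<in> dms_lang \<Sigma> S" using ne by blast
    then have "tree_lab t0 (tree_root t0) = dms_root S" "t0 \<in> trees \<Sigma>"
      by (simp_all add: dms_lang_def satisfies_iff)
    then show ?thesis using root_tree_data[of t0 \<Sigma>] t0 U by auto
  qed
  then have "label r \<in> U" using t r(2) root by (simp add: dms_lang_def satisfies_iff)
  moreover have "\<forall>(a, w)\<in>rtree_data r. w \<in> dme_lang (dms_rule S' a)"
    using t unfolding r(1) by (simp add: dms_lang_def satisfies_iff)
  ultimately have "\<forall>(a, w)\<in>rtree_data r. w \<in> dme_lang (dms_rule S a)"
  proof (induction r)
    case (Node a ts)
    then have aU: "a \<in> U" by simp
    have "mset (map label ts) \<in> dme_lang (dms_rule S' a)"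
      using Node.prems(2) by (simp add: rtree_data_Node)
    then have w: "mset (map label ts) \<in> dme_lang (dms_rule S a)" "set_mset (mset (map label ts)) \<subseteq> U"
      using rule[OF aU] by auto
    have "\<forall>(a, w)\<in>rtree_data y. w \<in> dme_lang (dms_rule S a)" if "y \<in> set ts" for y
      using Node.IH[OF that] Node.prems(2) w(2) that by (auto simp: rtree_data_Node)
    then show ?case using w(1) by (auto simp: rtree_data_Node)
  qed
  then show "t \<in> dms_lang \<Sigma> S" using t root unfolding r(1) by (auto simp: dms_lang_def satisfies_iff)
qed

text \<open>There are at most \<open>card \<Sigma>\<close> relevant rules with at most
  \<open>(card \<Sigma> + 1) ^ 3\<close> words each and one tree per word, and
  \<open>card \<Sigma> < dms_size \<Sigma> S\<close>; hence the fourth power. The constant 1 covers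
  the one-tree sample for an empty language.\<close>

lemma complete_dms_learner: "complete_learner dms_setting dms_learner"
  unfolding complete_learner_def
proof (intro exI[of _ "[:1:] + [:0, 1:] ^ 4"] allI impI ballI)
  fix \<Sigma> :: "'a set" and S
  assume fin: "finite \<Sigma>" and "S \<in> concepts dms_setting \<Sigma>"
  then have S: "S \<in> dmss \<Sigma>" by (simp add: dms_setting_def)
  let ?L = "dms_lang \<Sigma> S" and ?q = "[:1:] + [:0, 1:] ^ 4 :: nat poly"
  have dms: "language dms_setting = dms_lang" "examples dms_setting = trees"
    "concept_size dms_setting = dms_size" "concepts dms_setting = dmss"
    by (simp_all add: dms_setting_def)
  have q: "poly ?q m = 1 + m ^ 4" for m by simp
  show "\<exists>CS. is_sample dms_setting \<Sigma> CS \<and>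
      (language dms_setting \<Sigma> S \<noteq> {} \<longrightarrow> consistent dms_setting \<Sigma> CS S) \<and>
      card CS \<le> poly ?q (concept_size dms_setting \<Sigma> S) \<and>
      (\<forall>D. is_sample dms_setting \<Sigma> D \<and> CS \<subseteq> D \<and> D \<subseteq> language dms_setting \<Sigma> S \<longrightarrow>
        (\<exists>c'\<in>concepts dms_setting \<Sigma>. dms_learner \<Sigma> D = Some c' \<and>
          language dms_setting \<Sigma> c' = language dms_setting \<Sigma> S))"
  proof (cases "?L = {}")
    \<comment> \<open>Samples are nonempty, so an arbitrary tree is taken; the final condition is
      vacuous because no nonempty \<open>D\<close> lies in the empty language.\<close>
    case True
    have "fst ` rtree_data (Node (dms_root S) []) \<subseteq> \<Sigma>"
      using S by (simp add: dmss_def rtree_data_Node)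
    then obtain t where "t \<in> trees \<Sigma>" by (rule tree_of_rtree)
    then show ?thesis using True
      by (intro exI[of _ "{t}"]) (auto simp: is_sample_def dms simp del: One_nat_def)
  next
    case False
    define U where "U = (\<Union>t\<in>?L. fst ` tree_data t)"
    define La where "La = (\<lambda>a. {w \<in> dme_lang (dms_rule S a). set_mset w \<subseteq> U})"
    have U\<Sigma>: "U \<subseteq> \<Sigma>" 
    proof
      fix a assume "a \<in> U"
      then obtain t w where t: "t \<in> ?L" "(a, w) \<in> tree_data t" unfolding U_def by auto
      then have "t \<in> trees \<Sigma>" by (simp add: dms_lang_def)
      then show "a \<in> \<Sigma>" using tree_data_alphabet(1) t(2) by metis
    qed
    have in_La: "w \<in> La a" if "t \<in> ?L" "(a, w) \<in> tree_data t" for t a w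
    proof -
      have "fst ` tree_data t \<subseteq> U" unfolding U_def using that(1) by blast
      moreover have "t \<in> trees \<Sigma>" using that(1) by (simp add: dms_lang_def)
      from tree_data_alphabet(2)[OF this that(2)] have "set_mset w \<subseteq> fst ` tree_data t" .
      ultimately have "set_mset w \<subseteq> U" by (rule order_trans[rotated])
      then show ?thesis using that by (auto simp: La_def dms_lang_def satisfies_iff)
    qed
    have La_ne: "La a \<noteq> {}" if aU: "a \<in> U" for a
    proof -
      obtain t w where "t \<in> ?L" "(a, w) \<in> tree_data t" using aU unfolding U_def by auto
      then have "w \<in> La a" by (rule in_La)
      then show ?thesis by blast
    qed
    have "\<exists>CS. CS \<subseteq> La a \<and> CS \<noteq> {} \<and> finite CS \<and> card CS \<le> (card \<Sigma> + 1) ^ 3 \<and>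
      (\<forall>W S. CS \<subseteq> W \<longrightarrow> W \<subseteq> La a \<longrightarrow> distinct S \<longrightarrow> set S = \<Sigma> \<longrightarrow> dme_lang (learn_dme S W) = La a)"
      if a: "a \<in> U" for a
    proof -
      have "dms_rule S a \<in> dmes \<Sigma>" using S a U\<Sigma> by (auto simp: dmss_def)
      then show ?thesis
        unfolding La_def
      proof (rule learn_dme_characteristic[OF _ fin La_ne[OF a, unfolded La_def]], goal_cases)
        case (1 CS)
        then show ?case by (intro exI[of _ CS] conjI allI impI) simp_all
      qed
    qed
    then have "\<forall>a\<in>U. \<exists>CS. CS \<subseteq> La a \<and> CS \<noteq> {} \<and> finite CS \<and> card CS \<le> (card \<Sigma> + 1) ^ 3 \<and>
      (\<forall>W S. CS \<subseteq> W \<longrightarrow> W \<subseteq> La a \<longrightarrow> distinct S \<longrightarrow> set S = \<Sigma> \<longrightarrow> dme_lang (learn_dme S W) = La a)"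
      by (rule ballI)
    from bchoice[OF this] obtain CW where CW: "\<forall>a\<in>U. CW a \<subseteq> La a \<and> CW a \<noteq> {} \<and> finite (CW a) \<and>
      card (CW a) \<le> (card \<Sigma> + 1) ^ 3 \<and>
      (\<forall>W S. CW a \<subseteq> W \<longrightarrow> W \<subseteq> La a \<longrightarrow> distinct S \<longrightarrow> set S = \<Sigma> \<longrightarrow> dme_lang (learn_dme S W) = La a)" ..
    have CW_exact: "dme_lang (learn_dme S W) = La a"
      if "a \<in> U" "CW a \<subseteq> W" "W \<subseteq> La a" "distinct S" "set S = \<Sigma>" for a W S
      using CW that by simp
    have CW: "CW a \<subseteq> La a" "CW a \<noteq> {}" "finite (CW a)" "card (CW a) \<le> (card \<Sigma> + 1) ^ 3"
      if "a \<in> U" for a using CW that by simp_all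
    have "\<exists>t\<in>?L. (a, w) \<in> tree_data t" if "a \<in> U" "w \<in> La a" for a w
      using realize_word[OF S U_def that(1)] that(2) by (simp add: La_def)
    then have "\<forall>a\<in>U. \<exists>f. \<forall>w\<in>La a. f w \<in> ?L \<and> (a, w) \<in> tree_data (f w)"
      by (intro ballI bchoice) blast
    then have "\<exists>T. \<forall>a\<in>U. \<forall>w\<in>La a. T a w \<in> ?L \<and> (a, w) \<in> tree_data (T a w)" by (rule bchoice)
    then obtain T where T: "\<And>a w. a \<in> U \<Longrightarrow> w \<in> La a \<Longrightarrow> T a w \<in> ?L"
      "\<And>a w. a \<in> U \<Longrightarrow> w \<in> La a \<Longrightarrow> (a, w) \<in> tree_data (T a w)" by blast
    \<comment> \<open>One tree per characteristic word. Its other nodes contribute further words of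
      the restricted languages, which \<open>learn_dme_characteristic\<close> tolerates.\<close>
    define CS where "CS = (\<Union>a\<in>U. T a ` CW a)"
    have finU: "finite U" using U\<Sigma> fin by (rule finite_subset)
    have CS_L: "CS \<subseteq> ?L" using T(1) CW(1) unfolding CS_def by blast
    have "U \<noteq> {}" using False root_tree_data by (force simp: U_def dms_lang_def)
    then have "CS \<noteq> {}" using CW(2) by (auto simp: CS_def)
    moreover have "finite CS" using finU CW(3) by (simp add: CS_def)
    ultimately have sample: "is_sample dms_setting \<Sigma> CS"
      using CS_L by (auto simp: is_sample_def dms dms_lang_def)
    have "card CS \<le> (\<Sum>a\<in>U. card (T a ` CW a))" unfolding CS_def using finU by (rule card_UN_le)
    also have "\<dots> \<le> (\<Sum>a\<in>U. (card \<Sigma> + 1) ^ 3)"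
      by (intro sum_mono order_trans[OF card_image_le CW(4)] CW(3))
    also have "\<dots> \<le> (card \<Sigma> + 1) * (card \<Sigma> + 1) ^ 3"
      using card_mono[OF fin U\<Sigma>] unfolding sum_constant of_nat_id by (intro mult_le_mono1) simp
    also have "\<dots> = (card \<Sigma> + 1) ^ 4" by (simp add: eval_nat_numeral)
    also have "\<dots> \<le> dms_size \<Sigma> S ^ 4"
      unfolding dms_size_def sum.distrib by (intro power_mono) simp_all
    finally have card: "card CS \<le> poly ?q (dms_size \<Sigma> S)" unfolding q by simp
    have exact: "\<exists>c'\<in>dmss \<Sigma>. dms_learner \<Sigma> D = Some c' \<and> dms_lang \<Sigma> c' = ?L"
      if D: "is_sample dms_setting \<Sigma> D" "CS \<subseteq> D" "D \<subseteq> ?L" for D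
    proof -
      have roots: "root_labels D = {dms_root S}"
        using D by (force simp: root_labels_def dms_lang_def satisfies_def is_sample_def)
      then have sing: "is_singleton (root_labels D)" by simp
      define c' where "c' = the (dms_learner \<Sigma> D)"
      have c': "dms_learner \<Sigma> D = Some c'" using sing by (simp add: c'_def dms_learner_def)
      have "c' \<in> dmss \<Sigma>"
        using sound_dms_learner D(1) fin c' unfolding sound_learner_def dms by fastforce
      moreover have "dms_lang \<Sigma> c' = ?L"
      proof (rule dms_lang_eqI[OF _ U_def False])
        show "dms_root c' = dms_root S" using sing roots by (simp add: c'_def dms_learner_def)
        fix a assume a: "a \<in> U"
        have "CW a \<subseteq> sample_words D a"
          using T(2)[OF a] CW(1)[OF a] D(2) a unfolding sample_words_def CS_def by blast
        moreover have "sample_words D a \<subseteq> La a" using in_La D(3) unfolding sample_words_def by blast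
        ultimately have "dme_lang (learn_dme (sorted_list_of_set \<Sigma>) (sample_words D a)) = La a"
          using fin by (intro CW_exact[OF a]) simp_all
        moreover have "a \<in> \<Sigma>" using a U\<Sigma> by blast
        ultimately show "dme_lang (dms_rule c' a) = {w \<in> dme_lang (dms_rule S a). set_mset w \<subseteq> U}"
          using sing by (simp add: c'_def dms_learner_def La_def)
      qed
      ultimately show ?thesis using c' by blast
    qed
    show ?thesis unfolding dms consistent_def
      using sample card exact CS_L by (intro exI[of _ CS]) simp
  qed
qed

section \<open>The learner as a program\<close>

abbreviation enc_syms :: "'a list \<Rightarrow> 'a val" where "enc_syms l \<equiv> enc_list (map VSym l)"

abbreviation enc_words :: "'a list list \<Rightarrow> 'a val" where "enc_words ws \<equiv> enc_list (map (\<lambda>w. enc_list (map VSym w)) ws)"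

lemma val_snd_enc_list: "val_snd (enc_list (map e l)) = enc_list (map e (tl l))"
  by (cases l) simp_all

lemma poly_time_tl:
  assumes "poly_time \<rho> (\<lambda>s. enc_list (map e (l s)))"
  shows "poly_time \<rho> (\<lambda>s. enc_list (map e (tl (l s))))"
  using poly_time_snd[OF assms] by (simp add: val_snd_enc_list)

lemma poly_time_mem:
  assumes "poly_time \<rho> (\<lambda>s. VSym (a s))" "poly_time \<rho> (\<lambda>s. enc_syms (l s))"
  shows "poly_time \<rho> (\<lambda>s. bool_val (a s \<in> set (l s)))"
proof -
  have "poly_time \<rho> (\<lambda>s. bool_val (\<exists>x\<in>set (l s). x = a s))"
    by (intro poly_time_bex[OF assms(2)] assms poly_time_eq poly_time_fstI poly_time_arity[OF assms(1)]
        poly_time_sndI[of \<rho> "\<lambda>s. VSym (a s)"])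
  then show ?thesis by simp
qed

text \<open>Without arithmetic, lengths are compared by dropping: in
  \<open>poly_time_length_eq\<close> two lists have equal length if neither outlasts the
  other.\<close>

lemma poly_time_drop:
  fixes \<rho> :: "'s \<Rightarrow> 'a::linorder val list" and e :: "'b \<Rightarrow> 'a val" and e' :: "'c \<Rightarrow> 'a val"
  assumes xs: "poly_time \<rho> (\<lambda>s. enc_list (map e (xs s)))" and l: "poly_time \<rho> (\<lambda>s. enc_list (map e' (l s)))"
  shows "poly_time \<rho> (\<lambda>s. enc_list (map e' (drop (length (xs s)) (l s))))"
proof (rule poly_time_list_rec[where F = "\<lambda>s xs. enc_list (map e' (drop (length xs) (l s)))", OF _ xs])
  note ar = poly_time_arity[OF xs]
  show "poly_time \<rho> (\<lambda>s. enc_list (map e' (drop (length []) (l s))))" using l by simp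
  have eq: "drop (length (x # xs)) ys = tl (drop (length xs) ys)" for x xs ys by (simp add: drop_Suc tl_drop)
  show "poly_time (\<lambda>t. enc_list (map e' (drop (length (fst (snd t))) (l (snd (snd t))))) # e (fst t) #
        enc_list (map e (fst (snd t))) # \<rho> (snd (snd t)))
      (\<lambda>t. enc_list (map e' (drop (length (fst t # fst (snd t))) (l (snd (snd t))))))"
    unfolding eq by (intro poly_time_tl poly_time_step_rec ar)
  have "vsize (enc_list (map e' (drop n l))) \<le> vsize (enc_list (map e' l))" for n l
  proof -
    have "sum_list (map (\<lambda>v. 1 + vsize v) (map e' l)) = sum_list (map (\<lambda>v. 1 + vsize v) (map e' (take n l))) +
        sum_list (map (\<lambda>v. 1 + vsize v) (map e' (drop n l)))"
      by (subst append_take_drop_id[of n l, symmetric]) (simp only: map_append sum_list_append)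
    then show ?thesis by (simp add: vsize_enc_list)
  qed
  moreover have "poly_bounded (\<lambda>s. env_size (\<rho> s)) (\<lambda>s. vsize (enc_list (map e' (l s))))"
    using l by (simp add: poly_time_def)
  then obtain d where d: "\<And>s. vsize (enc_list (map e' (l s))) \<le> (env_size (\<rho> s) + 2) ^ d"
    unfolding poly_bounded_def by blast
  note le = calculation(1)
  show "poly_bounded (\<lambda>t. vsize (enc_list (map e (fst t :: 'b list))) + env_size (\<rho> (snd t)))
     (\<lambda>t. vsize (enc_list (map e' (drop (length (fst t)) (l (snd t))))))"
  proof (rule poly_boundedI)
    fix t :: "'b list \<times> 's"
    have "vsize (enc_list (map e' (drop (length (fst t)) (l (snd t))))) \<le> (env_size (\<rho> (snd t)) + 2) ^ d"
      using le d by (rule order_trans)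
    also have "\<dots> \<le> (vsize (enc_list (map e (fst t))) + env_size (\<rho> (snd t)) + 2) ^ d"
      by (rule power_mono) simp_all
    finally show "vsize (enc_list (map e' (drop (length (fst t)) (l (snd t))))) \<le>
      (vsize (enc_list (map e (fst t))) + env_size (\<rho> (snd t)) + 2) ^ d" .
  qed
qed

lemma poly_time_length_eq:
  assumes "poly_time \<rho> (\<lambda>s. enc_list (map e (xs s)))" "poly_time \<rho> (\<lambda>s. enc_list (map e' (ys s)))"
  shows "poly_time \<rho> (\<lambda>s. bool_val (length (xs s) = length (ys s)))"
proof -
  have "poly_time \<rho> (\<lambda>s. bool_val (\<not> (drop (length (xs s)) (ys s) \<noteq> []) \<and> \<not> (drop (length (ys s)) (xs s) \<noteq> [])))"
    by (intro poly_time_conj poly_time_not poly_time_list_nonempty[where e = e']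
        poly_time_list_nonempty[where e = e] poly_time_drop[of \<rho> e _ e'] poly_time_drop[of \<rho> e' _ e] assms)
  moreover have "\<not> (drop (length xs) ys \<noteq> []) \<and> \<not> (drop (length ys) xs \<noteq> []) \<longleftrightarrow> length xs = length ys"
    for xs :: "'c list" and ys :: "'d list" by auto
  ultimately show ?thesis by simp
qed

text \<open>The environment provides the sorted alphabet \<open>S\<close> and the words \<open>ws\<close> of a sample.\<close>

definition learn_env ::
  "('s \<Rightarrow> 'a::linorder val list) \<Rightarrow> ('s \<Rightarrow> 'a list) \<Rightarrow> ('s \<Rightarrow> 'a list list) \<Rightarrow> bool" where
  "learn_env \<rho> S ws \<longleftrightarrow> poly_time \<rho> (\<lambda>s. enc_syms (S s)) \<and> poly_time \<rho> (\<lambda>s. enc_words (ws s)) \<and>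
     (\<forall>s. distinct (S s) \<and> (\<forall>w\<in>set (ws s). set w \<subseteq> set (S s)))"

abbreviation bag :: "'a list list \<Rightarrow> 'a multiset set" where "bag ws \<equiv> mset ` set ws"

lemma learn_envD:
  assumes "learn_env \<rho> S ws"
  shows "poly_time \<rho> (\<lambda>s. enc_syms (S s))" "poly_time \<rho> (\<lambda>s. enc_words (ws s))"
    "\<exists>n. \<forall>s. length (\<rho> s) = n" "distinct (S s)" "occurs (bag (ws s)) a \<Longrightarrow> a \<in> set (S s)"
proof -
  show "poly_time \<rho> (\<lambda>s. enc_syms (S s))" "poly_time \<rho> (\<lambda>s. enc_words (ws s))" "distinct (S s)"
    using assms by (simp_all add: learn_env_def)
  then show "\<exists>n. \<forall>s. length (\<rho> s) = n" using poly_time_arity by blast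
  have "\<forall>w\<in>set (ws s). set w \<subseteq> set (S s)" using assms by (simp add: learn_env_def)
  then show "occurs (bag (ws s)) a \<Longrightarrow> a \<in> set (S s)" by (auto simp: occurs_def)
qed

text \<open>Inside a list function the current element joins the situation and heads the
  environment; iterating this lemma takes the place of nested binders.\<close>

lemma learn_env_ext:
  assumes "learn_env \<rho> S ws"
  shows "learn_env (\<lambda>t. e (fst t) # \<rho> (snd t)) (\<lambda>t. S (snd t)) (\<lambda>t. ws (snd t))"
  using assms poly_time_sndI[OF learn_envD(1)[OF assms], of e] poly_time_sndI[OF learn_envD(2)[OF assms], of e]
  unfolding learn_env_def by simp

lemma poly_time_new: "learn_env \<rho> S ws \<Longrightarrow> poly_time (\<lambda>t. e (fst t) # \<rho> (snd t)) (\<lambda>t. e (fst t))"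
  using learn_envD(3) by (intro poly_time_fstI)

lemma poly_time_old_sym: "poly_time \<rho> (\<lambda>s. VSym (a s)) \<Longrightarrow>
    poly_time (\<lambda>t. e (fst t) # \<rho> (snd t)) (\<lambda>t. VSym (a (snd t)))"
  by (rule poly_time_sndI)

lemma poly_time_old_list: "poly_time \<rho> (\<lambda>s. enc_list (map e' (l s))) \<Longrightarrow>
    poly_time (\<lambda>t. e (fst t) # \<rho> (snd t)) (\<lambda>t. enc_list (map e' (l (snd t))))"
  by (rule poly_time_sndI)

lemma poly_time_occurs:
  assumes L: "learn_env \<rho> S ws" and a: "poly_time \<rho> (\<lambda>s. VSym (a s))"
  shows "poly_time \<rho> (\<lambda>s. bool_val (occurs (bag (ws s)) (a s)))"
proof -
  have "poly_time \<rho> (\<lambda>s. bool_val (\<exists>w\<in>set (ws s). a s \<in> set w))"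
    by (intro poly_time_bex[OF learn_envD(2)[OF L]] poly_time_mem poly_time_old_sym[OF a] poly_time_new[OF L])
  then show ?thesis by (simp add: occurs_def)
qed

lemma poly_time_cooccur:
  assumes L: "learn_env \<rho> S ws" and a: "poly_time \<rho> (\<lambda>s. VSym (a s))" and b: "poly_time \<rho> (\<lambda>s. VSym (b s))"
  shows "poly_time \<rho> (\<lambda>s. bool_val (cooccur (bag (ws s)) (a s) (b s)))"
proof -
  have "poly_time \<rho> (\<lambda>s. bool_val (\<exists>w\<in>set (ws s). a s \<in> set w \<and> b s \<in> set w))"
    by (intro poly_time_bex[OF learn_envD(2)[OF L]] poly_time_conj poly_time_mem
        poly_time_old_sym[OF a] poly_time_old_sym[OF b] poly_time_new[OF L])
  then show ?thesis by (simp add: cooccur_def)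
qed

lemma poly_time_repeated:
  fixes \<rho> :: "'s \<Rightarrow> 'a::linorder val list"
  assumes L: "learn_env \<rho> S ws" and a: "poly_time \<rho> (\<lambda>s. VSym (a s))"
  shows "poly_time \<rho> (\<lambda>s. bool_val (repeated (bag (ws s)) (a s)))"
proof -
  let ?e = "\<lambda>w. enc_list (map VSym w)"
  have "poly_time (\<lambda>t. ?e (fst t) # \<rho> (snd t))
      (\<lambda>t. bool_val (tl (filter (\<lambda>x. x = a (snd t)) (fst t)) \<noteq> []))"
    by (intro poly_time_list_nonempty[where e = VSym] poly_time_tl poly_time_filter poly_time_new[OF L]
        poly_time_eq poly_time_fstI learn_envD(3)[OF learn_env_ext[OF L]]
        poly_time_old_sym[OF poly_time_old_sym[OF a]])
  from poly_time_bex[OF learn_envD(2)[OF L] this]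
  have p: "poly_time \<rho> (\<lambda>s. bool_val (\<exists>w\<in>set (ws s). tl (filter (\<lambda>x. x = a s) w) \<noteq> []))" .
  have eq: "tl (filter (\<lambda>x. x = b) w) \<noteq> [] \<longleftrightarrow> 2 \<le> count (mset w) b" for w and b :: 'a
  proof -
    have "count (mset w) b = length (filter (\<lambda>x. x = b) w)"
      by (induction w) auto
    then show ?thesis unfolding \<open>count _ _ = _\<close>
      by (cases "filter (\<lambda>x. x = b) w") (simp_all add: Suc_le_eq numeral_2_eq_2)
  qed
  have "poly_time \<rho> (\<lambda>s. bool_val (\<exists>w\<in>set (ws s). 2 \<le> count (mset w) (a s)))"
    using p unfolding eq .
  then show ?thesis by (simp add: repeated_def)
qed

lemma poly_time_hits:
  assumes L: "learn_env \<rho> S ws" and R: "poly_time \<rho> (\<lambda>s. enc_syms (R s))"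
  shows "poly_time \<rho> (\<lambda>s. bool_val (hits (bag (ws s)) (set (R s))))"
proof -
  have "poly_time \<rho> (\<lambda>s. bool_val (\<forall>w\<in>set (ws s). \<exists>a\<in>set (R s). a \<in> set w))"
    by (intro poly_time_ball[OF learn_envD(2)[OF L]] poly_time_bex[OF poly_time_old_list[OF R]] poly_time_mem
        poly_time_old_list[OF poly_time_new[OF L]] poly_time_new[OF learn_env_ext[OF L]])
  then show ?thesis by (simp add: hits_def)
qed

lemma poly_time_conflicts:
  assumes L: "learn_env \<rho> S ws" and a: "poly_time \<rho> (\<lambda>s. VSym (a s))" and b: "poly_time \<rho> (\<lambda>s. VSym (b s))"
  shows "poly_time \<rho> (\<lambda>s. bool_val (b s \<in> conflicts (bag (ws s)) (a s)))"
  unfolding conflicts_def mem_Collect_eq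
  by (intro poly_time_disj poly_time_conj poly_time_not poly_time_eq
      poly_time_occurs[OF L] poly_time_cooccur[OF L] a b)

text \<open>The sets of the learner quantify over all symbols, a program only over the list
  \<open>S\<close>. Both agree because occurring symbols belong to \<open>S\<close>; the same
  restriction recurs for the classes below.\<close>

lemma poly_time_conflict_free:
  assumes L: "learn_env \<rho> S ws" and a: "poly_time \<rho> (\<lambda>s. VSym (a s))"
  shows "poly_time \<rho> (\<lambda>s. bool_val (a s \<in> conflict_free (bag (ws s))))"
proof -
  have p: "poly_time (\<lambda>t. VSym (fst t) # \<rho> (snd t))
      (\<lambda>t. bool_val (fst t = a (snd t) \<or> \<not> fst t \<in> conflicts (bag (ws (snd t))) (a (snd t))))"
    by (intro poly_time_disj poly_time_not poly_time_eq poly_time_conflicts[OF learn_env_ext[OF L]]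
        poly_time_new[OF L] poly_time_old_sym[OF a])
  have "poly_time \<rho> (\<lambda>s. bool_val (occurs (bag (ws s)) (a s) \<and>
      (\<forall>b\<in>set (S s). b = a s \<or> \<not> b \<in> conflicts (bag (ws s)) (a s))))"
    by (intro poly_time_conj poly_time_occurs[OF L] a poly_time_ball[OF learn_envD(1)[OF L] p])
  moreover have "(occurs (bag (ws s)) (a s) \<and>
      (\<forall>b\<in>set (S s). b = a s \<or> \<not> b \<in> conflicts (bag (ws s)) (a s))) \<longleftrightarrow>
      a s \<in> conflict_free (bag (ws s))" for s
    using learn_envD(5)[OF L, of s] by (auto simp: conflict_free_def conflicts_def)
  ultimately show ?thesis by simp
qed

definition free_list :: "'a list \<Rightarrow> 'a list list \<Rightarrow> 'a list" where
  "free_list S ws = filter (\<lambda>b. b \<in> conflict_free (bag ws)) S"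

lemma poly_time_free_list:
  assumes L: "learn_env \<rho> S ws"
  shows "poly_time \<rho> (\<lambda>s. enc_syms (free_list (S s) (ws s)))"
  unfolding free_list_def
  by (intro poly_time_filter learn_envD(1)[OF L] poly_time_conflict_free[OF learn_env_ext[OF L]]
      poly_time_new[OF L])

lemma set_free_list: "learn_env \<rho> S ws \<Longrightarrow> set (free_list (S s) (ws s)) = conflict_free (bag (ws s))"
  using learn_envD(5)[of \<rho> S ws s] by (auto simp: free_list_def conflict_free_def)

definition candidate_list :: "'a list \<Rightarrow> 'a list list \<Rightarrow> 'a list list" where
  "candidate_list S ws = filter (\<lambda>R. hits (bag ws) (set R))
     (concat (map (\<lambda>a. map (\<lambda>w. filter (\<lambda>b. b = a \<or> \<not> b \<in> set w) (free_list S ws)) ws) (free_list S ws)))"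

lemma poly_time_candidate_list:
  assumes L: "learn_env \<rho> S ws"
  shows "poly_time \<rho> (\<lambda>s. enc_words (candidate_list (S s) (ws s)))"
proof -
  let ?\<rho>1 = "\<lambda>t. VSym (fst t) # \<rho> (snd t)"
  let ?\<rho>2 = "\<lambda>t. enc_list (map VSym (fst t)) # ?\<rho>1 (snd t)"
  note L1 = learn_env_ext[OF L, of VSym] and L2 = learn_env_ext[OF learn_env_ext[OF L, of VSym], of "\<lambda>w. enc_list (map VSym w)"]
  note F = poly_time_free_list[OF L]
  have "poly_time ?\<rho>2 (\<lambda>t. enc_syms (filter (\<lambda>b. b = fst (snd t) \<or> \<not> b \<in> set (fst t))
      (free_list (S (snd (snd t))) (ws (snd (snd t))))))"
    by (intro poly_time_filter poly_time_disj poly_time_not poly_time_eq poly_time_mem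
        poly_time_old_list[OF poly_time_old_list[OF F]] poly_time_new[OF L2]
        poly_time_old_sym[OF poly_time_old_sym[OF poly_time_new[OF L]]]
        poly_time_old_list[OF poly_time_new[OF L1]])
  from poly_time_map[OF learn_envD(2)[OF L1], where e' = "\<lambda>w. enc_list (map VSym w)", OF this]
  have "poly_time ?\<rho>1 (\<lambda>t. enc_words (map (\<lambda>w. filter (\<lambda>b. b = fst t \<or> \<not> b \<in> set w)
      (free_list (S (snd t)) (ws (snd t)))) (ws (snd t))))" .
  from poly_time_concat_map[OF F this]
  have C: "poly_time \<rho> (\<lambda>s. enc_words (concat (map (\<lambda>a. map (\<lambda>w. filter (\<lambda>b. b = a \<or> \<not> b \<in> set w)
      (free_list (S s) (ws s))) (ws s)) (free_list (S s) (ws s)))))" .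
  show ?thesis unfolding candidate_list_def
    by (intro poly_time_filter[OF C] poly_time_hits[OF learn_env_ext[OF L]] poly_time_new[OF L])
qed

lemma candidate_list:
  assumes "learn_env \<rho> S ws"
  shows "set ` set (candidate_list (S s) (ws s)) = candidates (bag (ws s))"
    "R \<in> set (candidate_list (S s) (ws s)) \<Longrightarrow> distinct R"
proof -
  let ?W = "bag (ws s)" and ?f = "\<lambda>a w. filter (\<lambda>b. b = a \<or> \<not> b \<in> set w) (free_list (S s) (ws s))"
  have f: "set (?f a w) = insert a (conflict_free ?W - set_mset (mset w))" if "a \<in> conflict_free ?W" for a w
    using that set_free_list[OF assms, of s] by auto
  have mem: "R \<in> set (candidate_list (S s) (ws s)) \<longleftrightarrow> hits ?W (set R) \<and>
      (\<exists>a\<in>conflict_free ?W. \<exists>w\<in>set (ws s). R = ?f a w)" for R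
    by (auto simp: candidate_list_def set_free_list[OF assms])
  show "set ` set (candidate_list (S s) (ws s)) = candidates ?W"
  proof (intro equalityI subsetI)
    fix Q assume "Q \<in> set ` set (candidate_list (S s) (ws s))"
    then obtain R where R: "R \<in> set (candidate_list (S s) (ws s))" "Q = set R" by blast
    then obtain a w where "hits ?W Q" "a \<in> conflict_free ?W" "w \<in> set (ws s)" "R = ?f a w"
      unfolding mem by blast
    then show "Q \<in> candidates ?W" unfolding candidates_def R(2) using f by blast
  next
    fix Q assume "Q \<in> candidates ?W"
    then obtain a w where aw: "hits ?W Q" "a \<in> conflict_free ?W" "w \<in> set (ws s)"
      "Q = insert a (conflict_free ?W - set_mset (mset w))" unfolding candidates_def by blast
    then have Q: "Q = set (?f a w)" using f by simp
    then have "?f a w \<in> set (candidate_list (S s) (ws s))" using aw unfolding mem by blast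
    then show "Q \<in> set ` set (candidate_list (S s) (ws s))" unfolding Q by (rule imageI)
  qed
  show "R \<in> set (candidate_list (S s) (ws s)) \<Longrightarrow> distinct R"
    using learn_envD(4)[OF assms, of s] by (auto simp: candidate_list_def free_list_def)
qed

text \<open>In the absence of numbers, a list serves as the bound on the size of the accepted sets.\<close>

fun accepted_list :: "'b list \<Rightarrow> 'a list list \<Rightarrow> 'a list list" where
  "accepted_list [] cs = []"
| "accepted_list (x # xs) cs = accepted_list xs cs @
     filter (\<lambda>R. length R = length (x # xs) \<and> (\<forall>Q\<in>set (accepted_list xs cs). \<forall>q\<in>set Q. \<not> q \<in> set R)) cs"

lemma accepted_list:
  assumes "learn_env \<rho> S ws"
  shows "set ` set (accepted_list xs (candidate_list (S s) (ws s))) = accepted (bag (ws s)) (length xs)"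
proof (induction xs)
  case (Cons x xs)
  let ?c = "candidate_list (S s) (ws s)" and ?W = "bag (ws s)"
  have *: "(\<forall>Q\<in>set (accepted_list xs ?c). \<forall>q\<in>set Q. \<not> q \<in> set R) \<longleftrightarrow>
      (\<forall>Q\<in>accepted ?W (length xs). Q \<inter> set R = {})" for R
    unfolding Cons[symmetric] by auto
  have len: "length R = card (set R)" if "R \<in> set ?c" for R
    using candidate_list(2)[OF assms that] by (simp add: distinct_card)
  have "set ` set (accepted_list (x # xs) ?c) = accepted ?W (length xs) \<union>
      set ` {R \<in> set ?c. card (set R) = Suc (length xs) \<and> (\<forall>Q\<in>accepted ?W (length xs). Q \<inter> set R = {})}"
    unfolding accepted_list.simps set_append image_Un Cons set_filter * using len by auto
  also have "\<dots> = accepted ?W (length (x # xs))"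
    unfolding list.size accepted.simps add_Suc_right add_0_right candidate_list(1)[OF assms, symmetric] by auto
  finally show ?case .
qed simp

text \<open>The size bound for the recursion on \<open>xs\<close>. Each step appends only candidates
  of a new length, so no entry of \<open>cs\<close> is used twice, however long \<open>xs\<close>
  is.\<close>

lemma vsize_accepted_list:
  "vsize (enc_words (accepted_list xs cs)) \<le> vsize (enc_words cs)"
proof -
  let ?h = "\<lambda>R. 1 + vsize (enc_syms R)"
  have split: "sum_list (map ?h (filter P cs)) + sum_list (map ?h (filter Q cs)) \<le>
      sum_list (map ?h (filter R cs))"
    if "\<And>x. P x \<Longrightarrow> R x" "\<And>x. Q x \<Longrightarrow> R x" "\<And>x. P x \<Longrightarrow> \<not> Q x" for P Q R
    using that by (induction cs) auto
  have "sum_list (map ?h (accepted_list xs cs)) \<le> sum_list (map ?h (filter (\<lambda>R. length R \<le> length xs) cs))"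
  proof (induction xs)
    case (Cons x xs)
    have "sum_list (map ?h (filter (\<lambda>R. length R \<le> length xs) cs)) + sum_list (map ?h (filter
        (\<lambda>R. length R = length (x # xs) \<and> (\<forall>Q\<in>set (accepted_list xs cs). \<forall>q\<in>set Q. \<not> q \<in> set R)) cs)) \<le>
      sum_list (map ?h (filter (\<lambda>R. length R \<le> length (x # xs)) cs))"
      by (rule split) auto
    then show ?case using Cons unfolding accepted_list.simps map_append sum_list_append by linarith
  qed simp
  also have "\<dots> \<le> sum_list (map ?h cs)"
    using split[of "\<lambda>R. length R \<le> length xs" "\<lambda>_. True" "\<lambda>_. False"] by simp
  finally show ?thesis by (simp add: vsize_enc_list o_def)
qed

lemma poly_time_accepted_list:
  fixes \<rho> :: "'s \<Rightarrow> 'a::linorder val list" and xs :: "'s \<Rightarrow> 'a list"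
  assumes c: "poly_time \<rho> (\<lambda>s. enc_words (cs s))" and xs: "poly_time \<rho> (\<lambda>s. enc_syms (xs s))"
  shows "poly_time \<rho> (\<lambda>s. enc_words (accepted_list (xs s) (cs s)))"
proof (rule poly_time_list_rec[where F = "\<lambda>s xs. enc_words (accepted_list xs (cs s))", OF _ xs])
  note ar = poly_time_arity[OF xs]
  let ?e = "\<lambda>w :: 'a list. enc_list (map VSym w)"
  show "poly_time \<rho> (\<lambda>s. enc_words (accepted_list [] (cs s)))"
    using poly_time_nil[OF ar] by simp
  let ?\<rho> = "\<lambda>t. enc_words (accepted_list (fst (snd t)) (cs (snd (snd t)))) # VSym (fst t) #
      enc_syms (fst (snd t)) # \<rho> (snd (snd t))"
  have A: "poly_time ?\<rho> (\<lambda>t. enc_words (accepted_list (fst (snd t)) (cs (snd (snd t)))))"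
    and x: "poly_time ?\<rho> (\<lambda>t. VSym (fst t))" and xs': "poly_time ?\<rho> (\<lambda>t. enc_syms (fst (snd t)))"
    by (rule poly_time_step_rec(1)[OF ar], rule poly_time_step_rec(2)[OF ar],
        rule poly_time_step_rec(3)[OF ar])
  have xxs: "poly_time ?\<rho> (\<lambda>t. enc_syms (fst t # fst (snd t)))"
    using poly_time_list_cons[of ?\<rho> VSym, OF x xs'] .
  have ar': "\<exists>n. \<forall>t. length (?\<rho> t) = n" using A by (rule poly_time_arity)
  have R: "poly_time (\<lambda>t. ?e (fst t) # ?\<rho> (snd t)) (\<lambda>t. ?e (fst t))" using ar' by (rule poly_time_fstI)
  have ar1: "\<exists>n. \<forall>t. length (?e (fst t) # ?\<rho> (snd t)) = n" using R by (rule poly_time_arity)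
  let ?\<rho>2 = "\<lambda>t. ?e (fst t) # ?e (fst (snd t)) # ?\<rho> (snd (snd t))"
  have Q: "poly_time ?\<rho>2 (\<lambda>t. ?e (fst t))" using ar1 by (rule poly_time_fstI)
  have R': "poly_time ?\<rho>2 (\<lambda>t. ?e (fst (snd t)))" using R by (rule poly_time_old_list)
  have "poly_time (\<lambda>t. VSym (fst t) # ?\<rho>2 (snd t)) (\<lambda>t. bool_val (\<not> fst t \<in> set (fst (snd (snd t)))))"
    by (intro poly_time_not poly_time_mem poly_time_fstI[OF poly_time_arity[OF Q]]
        poly_time_old_list[OF R'])
  from poly_time_ball[OF Q this]
  have QR: "poly_time (\<lambda>t. ?e (fst t) # ?e (fst (snd t)) # ?\<rho> (snd (snd t)))
      (\<lambda>t. bool_val (\<forall>q\<in>set (fst t). \<not> q \<in> set (fst (snd t))))" .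
  have "poly_time (\<lambda>t. ?e (fst t) # ?\<rho> (snd t)) (\<lambda>t. bool_val (length (fst t) = length (fst (snd t) # fst (snd (snd t))) \<and>
      (\<forall>Q\<in>set (accepted_list (fst (snd (snd t))) (cs (snd (snd (snd t))))). \<forall>q\<in>set Q. \<not> q \<in> set (fst t))))"
    by (intro poly_time_conj poly_time_length_eq[where e = VSym and e' = VSym] R
        poly_time_old_list[OF xxs] poly_time_ball[OF poly_time_old_list[OF A] QR])
  from poly_time_filter[OF poly_time_step_env'[OF c] this]
  show "poly_time ?\<rho> (\<lambda>t. enc_words (accepted_list (fst t # fst (snd t)) (cs (snd (snd t)))))"
    unfolding accepted_list.simps by (intro poly_time_append A)
  show "poly_bounded (\<lambda>t. vsize (enc_syms (fst t :: 'a list)) + env_size (\<rho> (snd t)))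
      (\<lambda>t. vsize (enc_words (accepted_list (fst t) (cs (snd t)))))"
  proof -
    obtain d where d: "\<And>s. vsize (enc_words (cs s)) \<le> (env_size (\<rho> s) + 2) ^ d"
      using c unfolding poly_time_def poly_bounded_def by blast
    show ?thesis
    proof (rule poly_boundedI)
      fix t :: "'a list \<times> 's"
      have "vsize (enc_words (accepted_list (fst t) (cs (snd t)))) \<le> (env_size (\<rho> (snd t)) + 2) ^ d"
        using vsize_accepted_list d by (rule order_trans)
      also have "\<dots> \<le> (vsize (enc_syms (fst t)) + env_size (\<rho> (snd t)) + 2) ^ d"
        by (rule power_mono) simp_all
      finally show "vsize (enc_words (accepted_list (fst t) (cs (snd t)))) \<le>
        (vsize (enc_syms (fst t)) + env_size (\<rho> (snd t)) + 2) ^ d" .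
    qed
  qed
qed

lemma occurs_in_alphabet:
  assumes "learn_env \<rho> S ws"
  shows "conflict_free (bag (ws s)) \<subseteq> set (S s)" "occurs (bag (ws s)) a \<Longrightarrow> conflicts (bag (ws s)) a \<subseteq> set (S s)"
  using learn_envD(5)[OF assms, of s] by (auto simp: conflict_free_def conflicts_def)

lemma poly_time_joint_class:
  fixes \<rho> :: "'s \<Rightarrow> 'a::linorder val list"
  assumes L: "learn_env \<rho> S ws" and a: "poly_time \<rho> (\<lambda>s. VSym (a s))" and b: "poly_time \<rho> (\<lambda>s. VSym (b s))"
  shows "poly_time \<rho> (\<lambda>s. bool_val (b s \<in> joint_class (bag (ws s)) (length (S s)) (a s)))"
proof -
  let ?A = "\<lambda>s. accepted_list (S s) (candidate_list (S s) (ws s))"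
  have A: "poly_time \<rho> (\<lambda>s. enc_words (?A s))"
    by (intro poly_time_accepted_list poly_time_candidate_list[OF L] learn_envD(1)[OF L])
  have "poly_time (\<lambda>t. enc_syms (fst t) # \<rho> (snd t))
      (\<lambda>t. bool_val (a (snd t) \<in> set (fst t) \<longleftrightarrow> b (snd t) \<in> set (fst t)))"
    by (intro poly_time_iff poly_time_mem poly_time_old_sym[OF a] poly_time_old_sym[OF b] poly_time_new[OF L])
  from poly_time_ball[OF A this]
  have "poly_time \<rho> (\<lambda>s. bool_val (b s \<in> conflict_free (bag (ws s)) \<and>
      (\<forall>R\<in>set (?A s). a s \<in> set R \<longleftrightarrow> b s \<in> set R)))"
    by (intro poly_time_conj poly_time_conflict_free[OF L] b)
  then show ?thesis unfolding joint_class_def accepted_list[OF L, symmetric] by simp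
qed

lemma poly_time_hits_joint_class:
  fixes \<rho> :: "'s \<Rightarrow> 'a::linorder val list"
  assumes L: "learn_env \<rho> S ws" and a: "poly_time \<rho> (\<lambda>s. VSym (a s))"
  shows "poly_time \<rho> (\<lambda>s. bool_val (hits (bag (ws s)) (joint_class (bag (ws s)) (length (S s)) (a s))))"
proof -
  let ?K = "\<lambda>s. joint_class (bag (ws s)) (length (S s)) (a s)"
  have "poly_time \<rho> (\<lambda>s. bool_val (hits (bag (ws s)) (set (filter (\<lambda>b. b \<in> ?K s) (S s)))))"
    by (intro poly_time_hits[OF L] poly_time_filter learn_envD(1)[OF L]
        poly_time_joint_class[OF learn_env_ext[OF L]] poly_time_old_sym[OF a] poly_time_new[OF L])
  moreover have "set (filter (\<lambda>b. b \<in> ?K s) (S s)) = ?K s" for s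
    using occurs_in_alphabet(1)[OF L, of s] by (auto simp: joint_class_def)
  ultimately show ?thesis by simp
qed

lemma poly_time_symbol_class:
  fixes \<rho> :: "'s \<Rightarrow> 'a::linorder val list"
  assumes L: "learn_env \<rho> S ws" and a: "poly_time \<rho> (\<lambda>s. VSym (a s))" and b: "poly_time \<rho> (\<lambda>s. VSym (b s))"
  shows "poly_time \<rho> (\<lambda>s. bool_val (b s \<in> symbol_class (bag (ws s)) (length (S s)) (a s)))"
proof -
  let ?W = "\<lambda>s. bag (ws s)" and ?J = "\<lambda>s. joint_class (bag (ws s)) (length (S s)) (a s)"
  have c: "poly_time (\<lambda>t. VSym (fst t) # \<rho> (snd t))
      (\<lambda>t. bool_val (fst t \<in> conflicts (?W (snd t)) (b (snd t)) \<longleftrightarrow> fst t \<in> conflicts (?W (snd t)) (a (snd t))))"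
    by (intro poly_time_iff poly_time_conflicts[OF learn_env_ext[OF L]] poly_time_old_sym[OF a]
        poly_time_old_sym[OF b] poly_time_new[OF L])
  have "poly_time \<rho> (\<lambda>s. if a s \<in> conflict_free (?W s)
      then if hits (?W s) (?J s) then bool_val (b s \<in> ?J s) else bool_val (b s = a s)
      else if occurs (?W s) (a s)
      then bool_val (occurs (?W s) (b s) \<and>
        (\<forall>c\<in>set (S s). c \<in> conflicts (?W s) (b s) \<longleftrightarrow> c \<in> conflicts (?W s) (a s)))
      else bool_val (b s = a s))"
    by (intro poly_time_if poly_time_conflict_free[OF L] poly_time_hits_joint_class[OF L]
        poly_time_joint_class[OF L] poly_time_eq poly_time_occurs[OF L] poly_time_conj
        poly_time_ball[OF learn_envD(1)[OF L] c] a b)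
  then show ?thesis
  proof (rule poly_time_cong)
    fix s
    have "conflicts (?W s) (b s) = conflicts (?W s) (a s) \<longleftrightarrow>
        (\<forall>c\<in>set (S s). c \<in> conflicts (?W s) (b s) \<longleftrightarrow> c \<in> conflicts (?W s) (a s))"
      if "occurs (?W s) (a s)" "occurs (?W s) (b s)"
      using occurs_in_alphabet(2)[OF L that(1)] occurs_in_alphabet(2)[OF L that(2)] by blast
    then show "(if a s \<in> conflict_free (?W s)
      then if hits (?W s) (?J s) then bool_val (b s \<in> ?J s) else bool_val (b s = a s)
      else if occurs (?W s) (a s)
      then bool_val (occurs (?W s) (b s) \<and>
        (\<forall>c\<in>set (S s). c \<in> conflicts (?W s) (b s) \<longleftrightarrow> c \<in> conflicts (?W s) (a s)))
      else bool_val (b s = a s)) = bool_val (b s \<in> symbol_class (?W s) (length (S s)) (a s))"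
      by (auto simp: symbol_class_def intro!: arg_cong[of _ _ bool_val])
  qed
qed

lemma poly_time_symbol_class_list:
  fixes \<rho> :: "'s \<Rightarrow> 'a::linorder val list"
  assumes L: "learn_env \<rho> S ws" and a: "poly_time \<rho> (\<lambda>s. VSym (a s))"
  shows "poly_time \<rho> (\<lambda>s. enc_syms (filter (\<lambda>b. b \<in> symbol_class (bag (ws s)) (length (S s)) (a s)) (S s)))"
  by (intro poly_time_filter learn_envD(1)[OF L] poly_time_symbol_class[OF learn_env_ext[OF L]]
      poly_time_old_sym[OF a] poly_time_new[OF L])

lemma poly_time_plus_symbol:
  fixes \<rho> :: "'s \<Rightarrow> 'a::linorder val list"
  assumes L: "learn_env \<rho> S ws" and a: "poly_time \<rho> (\<lambda>s. VSym (a s))"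
  shows "poly_time \<rho> (\<lambda>s. bool_val (plus_symbol (bag (ws s)) (length (S s)) (a s)))"
proof -
  let ?K = "\<lambda>s. symbol_class (bag (ws s)) (length (S s)) (a s)"
  have p: "poly_time (\<lambda>t. VSym (fst t) # \<rho> (snd t))
      (\<lambda>t. bool_val (fst t \<in> ?K (snd t) \<and> \<not> fst t = a (snd t)))"
    by (intro poly_time_conj poly_time_not poly_time_eq poly_time_symbol_class[OF learn_env_ext[OF L]]
        poly_time_old_sym[OF a] poly_time_new[OF L])
  have "poly_time \<rho> (\<lambda>s. bool_val (a s \<in> conflict_free (bag (ws s)) \<and>
      (\<exists>b\<in>set (S s). b \<in> ?K s \<and> \<not> b = a s)))"
    by (intro poly_time_conj poly_time_conflict_free[OF L] a poly_time_bex[OF learn_envD(1)[OF L] p])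
  then show ?thesis
  proof (rule poly_time_cong)
    fix s
    have "?K s \<subseteq> set (S s)" if "a s \<in> conflict_free (bag (ws s))"
      using that occurs_in_alphabet(1)[OF L, of s] by (auto simp: symbol_class_def joint_class_def)
    then show "bool_val (a s \<in> conflict_free (bag (ws s)) \<and> (\<exists>b\<in>set (S s). b \<in> ?K s \<and> \<not> b = a s)) =
        bool_val (plus_symbol (bag (ws s)) (length (S s)) (a s))"
      using symbol_class_self[of "a s" "bag (ws s)" "length (S s)"]
      unfolding plus_symbol_def by (intro arg_cong[of _ _ bool_val]) blast
  qed
qed

text \<open>The guard permits listing the class by a filter over \<open>S\<close>: the class of an
  occurring symbol consists of occurring symbols, which lie in \<open>S\<close>.\<close>

lemma poly_time_hits_symbol_class:
  fixes \<rho> :: "'s \<Rightarrow> 'a::linorder val list"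
  assumes L: "learn_env \<rho> S ws" and a: "poly_time \<rho> (\<lambda>s. VSym (a s))"
  shows "poly_time \<rho> (\<lambda>s. bool_val (occurs (bag (ws s)) (a s) \<and>
    hits (bag (ws s)) (symbol_class (bag (ws s)) (length (S s)) (a s))))"
proof -
  let ?K = "\<lambda>s. symbol_class (bag (ws s)) (length (S s)) (a s)"
  have "poly_time \<rho> (\<lambda>s. bool_val (occurs (bag (ws s)) (a s) \<and>
      hits (bag (ws s)) (set (filter (\<lambda>b. b \<in> ?K s) (S s)))))"
    by (intro poly_time_conj poly_time_occurs[OF L] a poly_time_hits[OF L] poly_time_symbol_class_list[OF L])
  moreover have "set (filter (\<lambda>b. b \<in> ?K s) (S s)) = ?K s" if "occurs (bag (ws s)) (a s)" for s
    using same_class(3)[of _ "bag (ws s)" "length (S s)" "a s"] that learn_envD(5)[OF L, of s] by auto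
  ultimately show ?thesis by (elim poly_time_cong) (auto intro!: arg_cong[of _ _ bool_val])
qed

lemma poly_time_enc_mult: "\<exists>n. \<forall>s. length (\<rho> s) = n \<Longrightarrow> poly_time \<rho> (\<lambda>s. enc_mult M)"
  by (cases M) (auto intro!: poly_time_pair poly_time_nil)

lemma poly_time_inner_mult:
  fixes \<rho> :: "'s \<Rightarrow> 'a::linorder val list"
  assumes L: "learn_env \<rho> S ws" and a: "poly_time \<rho> (\<lambda>s. VSym (a s))"
  shows "poly_time \<rho> (\<lambda>s. enc_mult (inner_mult (bag (ws s)) (length (S s)) (a s)))"
  unfolding inner_mult_def if_distrib[of enc_mult]
  by (intro poly_time_if poly_time_conj poly_time_not poly_time_plus_symbol[OF L] poly_time_repeated[OF L] a
      poly_time_enc_mult learn_envD(3)[OF L])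

lemma poly_time_outer_mult:
  fixes \<rho> :: "'s \<Rightarrow> 'a::linorder val list"
  assumes L: "learn_env \<rho> S ws" and a: "poly_time \<rho> (\<lambda>s. VSym (a s))"
  shows "poly_time \<rho> (\<lambda>s. enc_mult (outer_mult (bag (ws s)) (length (S s)) (a s)))"
proof -
  let ?W = "\<lambda>s. bag (ws s)"
  have "poly_time \<rho> (\<lambda>s. if plus_symbol (?W s) (length (S s)) (a s) then enc_mult MPlus
     else if \<not> occurs (?W s) (a s) then enc_mult MZero
     else if occurs (?W s) (a s) \<and> hits (?W s) (symbol_class (?W s) (length (S s)) (a s)) then enc_mult MOne
     else enc_mult MOpt)"
    by (intro poly_time_if poly_time_not poly_time_plus_symbol[OF L] poly_time_occurs[OF L]
        poly_time_hits_symbol_class[OF L] a poly_time_enc_mult learn_envD(3)[OF L])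
  then show ?thesis by (rule poly_time_cong) (simp add: outer_mult_def)
qed

lemma poly_time_class_disj:
  fixes \<rho> :: "'s \<Rightarrow> 'a::linorder val list"
  assumes L: "learn_env \<rho> S ws" and a: "poly_time \<rho> (\<lambda>s. VSym (a s))"
  shows "poly_time \<rho> (\<lambda>s. enc_disj (class_disj (S s) (bag (ws s)) (a s)))"
  unfolding enc_disj_def class_disj_def
proof (rule poly_time_map[OF poly_time_symbol_class_list[OF L a]])
  have "poly_time (\<lambda>t. VSym (fst t) # \<rho> (snd t)) (\<lambda>t. VPair (VSym (fst t))
      (enc_mult (inner_mult (bag (ws (snd t))) (length (S (snd t))) (fst t))))"
    by (intro poly_time_pair poly_time_new[OF L] poly_time_inner_mult[OF learn_env_ext[OF L]])
  then show "poly_time (\<lambda>t. VSym (fst t) # \<rho> (snd t)) (\<lambda>t. case (fst t,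
      inner_mult (bag (ws (snd t))) (length (S (snd t))) (fst t)) of (a, M) \<Rightarrow> VPair (VSym a) (enc_mult M))"
    by simp
qed

lemma poly_time_learn_dme:
  fixes \<rho> :: "'s \<Rightarrow> 'a::linorder val list"
  assumes L: "learn_env \<rho> S ws"
  shows "poly_time \<rho> (\<lambda>s. enc_dme (learn_dme (S s) (bag (ws s))))"
  unfolding enc_dme_def learn_dme_def
proof (rule poly_time_map)
  let ?\<rho>1 = "\<lambda>t. VSym (fst t) # \<rho> (snd t)"
  note L1 = learn_env_ext[OF L, of VSym]
  have *: "poly_time (\<lambda>t. VSym (fst t) # ?\<rho>1 (snd t)) (\<lambda>t. bool_val
     (\<not> fst t \<in> symbol_class (bag (ws (snd (snd t)))) (length (S (snd (snd t)))) (fst (snd t)) \<or>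
      \<not> fst t < fst (snd t)))"
    by (intro poly_time_disj poly_time_not poly_time_less poly_time_symbol_class[OF learn_env_ext[OF L1]]
        poly_time_new[OF L1] poly_time_old_sym[OF poly_time_new[OF L]])
  from poly_time_ball[OF learn_envD(1)[OF L1] this]
  have "poly_time ?\<rho>1 (\<lambda>t. bool_val (\<forall>b\<in>set (S (snd t)).
      b \<in> symbol_class (bag (ws (snd t))) (length (S (snd t))) (fst t) \<longrightarrow> fst t \<le> b))"
    by (rule poly_time_cong) (auto simp: not_less intro!: arg_cong[of _ _ bool_val])
  then show "poly_time \<rho> (\<lambda>s. enc_syms (filter (\<lambda>a. \<forall>b\<in>set (S s).
      b \<in> symbol_class (bag (ws s)) (length (S s)) a \<longrightarrow> a \<le> b) (S s)))"
    by (rule poly_time_filter[OF learn_envD(1)[OF L]])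
  have "poly_time ?\<rho>1 (\<lambda>t. VPair (enc_disj (class_disj (S (snd t)) (bag (ws (snd t))) (fst t)))
      (enc_mult (outer_mult (bag (ws (snd t))) (length (S (snd t))) (fst t))))"
    by (intro poly_time_pair poly_time_class_disj[OF L1] poly_time_outer_mult[OF L1] poly_time_new[OF L])
  then show "poly_time ?\<rho>1 (\<lambda>t. case (class_disj (S (snd t)) (bag (ws (snd t))) (fst t),
      outer_mult (bag (ws (snd t))) (length (S (snd t))) (fst t)) of
      (D, M) \<Rightarrow> VPair (enc_disj D) (enc_mult M))" by simp
qed

section \<open>Traversing encoded trees\<close>

text \<open>A program cannot tell symbols from pairs, but an encoded tree and an encoded nonempty list of
  trees differ in whether the first component has a first component.\<close>

fun collect :: "'a val \<Rightarrow> 'a val list" where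
  "collect VNil = []"
| "collect (VSym a) = [VSym a]"
| "collect (VPair u v) = (if val_fst u = VNil then VPair u v # collect v else collect u @ collect v)"

lemma collect_list:
  assumes "\<And>r. r \<in> set rs \<Longrightarrow> collect (enc_rtree r) = map enc_rtree (rnodes r)"
  shows "collect (enc_list (map enc_rtree rs)) = map enc_rtree (concat (map rnodes rs))"
  using assms
proof (induction rs)
  case (Cons r rs)
  have "val_fst (enc_rtree r) \<noteq> VNil" by (cases r) simp
  then show ?case using Cons by simp
qed simp

lemma collect_rtree: "collect (enc_rtree r) = map enc_rtree (rnodes r)"
proof (induction r)
  case (Node a ts)
  then show ?case using collect_list[of ts] by simp
qed

text \<open>The values listed are subvalues at different positions, so both their number and their
  sizes are at most \<open>vsize v\<close>, which suggests the square.\<close>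

lemma vsize_collect: "vsize (enc_list (collect v)) \<le> vsize v * vsize v"
proof (induction v)
  case (VPair u v)
  have sq: "(1 + m + n) * (1 + m + n) = 1 + m * m + n * n + 2 * m + 2 * n + 2 * (m * n)" for m n :: nat
    by (simp add: algebra_simps)
  have app: "vsize (enc_list (xs @ ys)) \<le> vsize (enc_list xs) + vsize (enc_list ys)" for xs ys :: "'a val list"
    by (simp add: vsize_enc_list)
  have arith: "a \<le> b \<Longrightarrow> 0 < n \<Longrightarrow> 1 + (1 + m + n) + a \<le> 1 + c + b + 2 * m + 2 * n + 2 * e" for a b c e m n :: nat
    by linarith
  show ?case
  proof (cases "val_fst u = VNil")
    case True
    then show ?thesis using arith[OF VPair(2) vsize_pos[of v]] unfolding vsize.simps sq by simp
  next
    case False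
    then show ?thesis using VPair app[of "collect u" "collect v"] unfolding vsize.simps sq by simp
  qed
qed simp_all

text \<open>The one recursion with two genuine branches. Every value is a situation here, also one
  that encodes no tree, so test and measure have to cope with bare symbols.\<close>

lemma poly_time_collect_val: "poly_time (\<lambda>v :: 'a::linorder val. [v]) (\<lambda>v. enc_list (collect v))"
proof (rule poly_time_rec[where c = "\<lambda>v. v" and b = "\<lambda>v. VNil" and g = id and sl = val_fst and sr = val_snd
    and \<mu> = vsize])
  let ?F = "\<lambda>v :: 'a val. enc_list (collect v)"
  have v: "poly_time (\<lambda>v :: 'a val. [v]) (\<lambda>v. v)" using poly_time_hd[of "\<lambda>_. []" "\<lambda>v :: 'a val. v"] by simp
  then show "poly_time (\<lambda>v :: 'a val. [v]) (\<lambda>v. v)" .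
  show "poly_time (\<lambda>v :: 'a val. [v]) (\<lambda>v. VNil)" by (rule poly_time_nil) simp
  show "poly_times (\<lambda>v :: 'a val. [v]) (\<lambda>v. [val_fst v])" "poly_times (\<lambda>v :: 'a val. [v]) (\<lambda>v. [val_snd v])"
    by (intro poly_times_cons poly_times_nil poly_time_fst poly_time_snd v; simp)+
  let ?\<rho> = "\<lambda>u. ?F (val_fst (id u)) # ?F (val_snd (id u)) # [id u]"
  have var: "poly_time ?\<rho> (\<lambda>u. ?\<rho> u ! i)" if "i < 3" for i
    using that by (intro poly_time_var[where n = 3]) simp_all
  have u: "poly_time ?\<rho> (\<lambda>u. u)" and Fl: "poly_time ?\<rho> (\<lambda>u. enc_list (map (\<lambda>x. x) (collect (val_fst u))))"
    and Fr: "poly_time ?\<rho> (\<lambda>u. enc_list (map (\<lambda>x. x) (collect (val_snd u))))"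
    using var[of 2] var[of 0] var[of 1] by simp_all
  have "poly_time ?\<rho> (\<lambda>u. if u \<noteq> VNil then if val_fst (val_fst u) \<noteq> VNil
      then enc_list (map (\<lambda>x. x) (collect (val_fst u) @ collect (val_snd u)))
      else VPair u (enc_list (map (\<lambda>x. x) (collect (val_snd u)))) else VNil)"
    by (intro poly_time_ite poly_time_fst poly_time_append[OF Fl Fr] poly_time_pair u Fr poly_time_nil)
      simp
  then show "poly_time ?\<rho> (\<lambda>u. enc_list (collect (id u)))"
  proof (rule poly_time_cong)
    fix u :: "'a val"
    show "(if u \<noteq> VNil then if val_fst (val_fst u) \<noteq> VNil
      then enc_list (map (\<lambda>x. x) (collect (val_fst u) @ collect (val_snd u)))
      else VPair u (enc_list (map (\<lambda>x. x) (collect (val_snd u)))) else VNil) = enc_list (collect (id u))"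
      by (cases u) simp_all
  qed
  show "poly_bounded (\<lambda>v :: 'a val. env_size [v]) (\<lambda>v. vsize (enc_list (collect v)))"
  proof (rule poly_bounded_le[OF _ vsize_collect])
    show "poly_bounded (\<lambda>v :: 'a val. env_size [v]) (\<lambda>v. vsize v * vsize v)"
      using poly_bounded_mult[OF poly_bounded_self poly_bounded_self, of vsize] by simp
  qed
  show "poly_bounded (\<lambda>v :: 'a val. env_size [v]) vsize" using poly_bounded_self[of vsize] by simp
  \<comment> \<open>A symbol projects to \<open>VNil\<close> on both sides, giving 2; this is why
    \<open>vsize\<close> assigns weight 3 to symbols.\<close>
  show "vsize (val_fst v) + vsize (val_snd v) < vsize v" if "v \<noteq> VNil" for v :: "'a val"
    using that by (cases v) simp_all
qed (auto simp: vsize_fst_le vsize_snd_le)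

lemma poly_time_collect:
  assumes "poly_time \<rho> (\<lambda>s. enc_list (map enc_rtree (rs s)))"
  shows "poly_time \<rho> (\<lambda>s. enc_list (map enc_rtree (concat (map rnodes (rs s)))))"
proof -
  have "poly_times \<rho> (\<lambda>s. [enc_list (map enc_rtree (rs s))])"
    using poly_time_arity[OF assms] by (intro poly_times_cons assms poly_times_nil)
  from poly_time_comp[OF poly_time_collect_val this] show ?thesis
    by (simp add: collect_list collect_rtree)
qed

lemma val_fst_enc_rtree: "val_fst (enc_rtree r) = VSym (label r)"
  and val_snd_enc_rtree: "val_snd (enc_rtree r) = enc_list (map enc_rtree (subtrees r))"
  by (cases r; simp)+

lemma poly_time_label:
  assumes "poly_time \<rho> (\<lambda>s. enc_rtree (r s))"
  shows "poly_time \<rho> (\<lambda>s. VSym (label (r s)))"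
  using poly_time_fst[OF assms] by (simp add: val_fst_enc_rtree)

lemma poly_time_subtree_labels:
  assumes "poly_time \<rho> (\<lambda>s. enc_rtree (r s))"
  shows "poly_time \<rho> (\<lambda>s. enc_syms (map label (subtrees (r s))))"
proof -
  have "poly_time \<rho> (\<lambda>s. enc_list (map enc_rtree (subtrees (r s))))"
    using poly_time_snd[OF assms] by (simp add: val_snd_enc_rtree)
  then show ?thesis
    by (rule poly_time_map) (intro poly_time_label poly_time_fstI poly_time_arity[OF assms])
qed

text \<open>A node costs 6: 1 for its pair, 3 for its symbol, 1 for the end of its child list and 1
  for the list cell that holds the node.\<close>

lemma length_rnodes: "1 + vsize (enc_rtree r) \<le> 6 * length (rnodes r)"
proof (induction r)
  case (Node a ts)
  have "(\<Sum>v\<leftarrow>map enc_rtree ts. 1 + vsize v) \<le> 6 * length (concat (map rnodes ts))"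
    using Node
  proof (induction ts)
    case (Cons t ts)
    have "1 + vsize (enc_rtree t) \<le> 6 * length (rnodes t)" using Cons.prems by simp
    moreover have "(\<Sum>v\<leftarrow>map enc_rtree ts. 1 + vsize v) \<le> 6 * length (concat (map rnodes ts))"
      using Cons by simp
    ultimately show ?case by simp
  qed simp
  then show ?case by (simp add: vsize_enc_list)
qed

lemma subtrees_in_rnodes: "x \<in> set (rnodes r) \<Longrightarrow> y \<in> set (subtrees x) \<Longrightarrow> y \<in> set (rnodes r)"
proof (induction r)
  case (Node a ts)
  then show ?case using rnodes_self by fastforce
qed

section \<open>The complete program\<close>

type_synonym 'a situation = "'a list \<times> 'a rtree list"

definition well_formed :: "'a situation \<Rightarrow> bool" where
  "well_formed s \<longleftrightarrow> distinct (fst s) \<and> (\<forall>r\<in>set (snd s). label ` set (rnodes r) \<subseteq> set (fst s))"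

text \<open>A program has to be correct in all situations, so ill-formed ones are mapped to an empty input.\<close>

definition alphabet_of :: "'a situation \<Rightarrow> 'a list" where
  "alphabet_of s = (if well_formed s then fst s else [])"

definition rtrees_of :: "'a situation \<Rightarrow> 'a rtree list" where
  "rtrees_of s = (if well_formed s then snd s else [])"

definition input_env :: "'a situation \<Rightarrow> 'a val list" where
  "input_env s = [enc_syms (alphabet_of s), enc_list (map enc_rtree (rtrees_of s))]"

definition words_of :: "'a \<Rightarrow> 'a situation \<Rightarrow> 'a list list" where
  "words_of a s = map (\<lambda>x. map label (subtrees x))
     (filter (\<lambda>x. label x = a) (concat (map rnodes (rtrees_of s))))"

text \<open>\<open>enc_dms\<close> admits the rules in any order, here that of the input; inside a
  rule the sorted alphabet fixes the order of the factors as in \<open>dms_learner\<close>.\<close>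

definition rule_values :: "'a::linorder situation \<Rightarrow> 'a val list" where
  "rule_values s = map (\<lambda>a. VPair (VSym a) (enc_dme (learn_dme (sort (alphabet_of s)) (bag (words_of a s)))))
     (alphabet_of s)"

text \<open>The root label is read off the first tree. If there is none, as in ill-formed
  situations, the projections yield the default \<open>VNil\<close>.\<close>

definition learner_value :: "'a::linorder situation \<Rightarrow> 'a val" where
  "learner_value s = (if \<forall>r\<in>set (rtrees_of s). \<forall>r'\<in>set (rtrees_of s). label r = label r'
     then VPair (VPair (val_fst (val_fst (enc_list (map enc_rtree (rtrees_of s))))) (enc_list (rule_values s))) VNil
     else VNil)"

lemma poly_time_learner_value: "poly_time input_env (learner_value :: 'a::linorder situation \<Rightarrow> 'a val)"
proof -
  have ar: "\<And>s. length (input_env s) = 2" by (simp add: input_env_def)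
  have xs: "poly_time input_env (\<lambda>s. enc_syms (alphabet_of s :: 'a list))"
    using poly_time_var[of input_env 2 0, OF ar] by (simp add: input_env_def)
  have rs: "poly_time input_env (\<lambda>s. enc_list (map enc_rtree (rtrees_of s :: 'a rtree list)))"
    using poly_time_var[of input_env 2 1, OF ar] by (simp add: input_env_def)
  let ?\<rho>1 = "\<lambda>t. VSym (fst t) # input_env (snd t)"
  have ar': "\<exists>n. \<forall>s. length (input_env s :: 'a val list) = n" using ar by blast
  have a: "poly_time ?\<rho>1 (\<lambda>t. VSym (fst t :: 'a))" using ar' by (rule poly_time_fstI)
  have nodes: "poly_time ?\<rho>1 (\<lambda>t. enc_list (map enc_rtree (concat (map rnodes (rtrees_of (snd t :: 'a situation))))))"
    using poly_time_collect[OF rs] by (rule poly_time_sndI)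
  have new: "poly_time (\<lambda>t. enc_rtree (fst t) # ?\<rho>1 (snd t)) (\<lambda>t. enc_rtree (fst t :: 'a rtree))"
    by (rule poly_time_fstI[OF poly_time_arity[OF a]])
  have F: "poly_time ?\<rho>1 (\<lambda>t. enc_list (map enc_rtree (filter (\<lambda>x. label x = fst t)
      (concat (map rnodes (rtrees_of (snd t :: 'a situation)))))))"
    by (intro poly_time_filter[OF nodes] poly_time_eq poly_time_label new poly_time_old_sym[OF a])
  have W: "poly_time ?\<rho>1 (\<lambda>t. enc_words (words_of (fst t) (snd t :: 'a situation)))"
    unfolding words_of_def by (rule poly_time_map[OF F]) (intro poly_time_subtree_labels new)
  have "set w \<subseteq> set (alphabet_of s)" if w: "w \<in> set (words_of a s)" for w a and s :: "'a situation"
  proof -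
    obtain r x where "r \<in> set (rtrees_of s)" "x \<in> set (rnodes r)" "w = map label (subtrees x)"
      using w by (auto simp: words_of_def)
    then show ?thesis using subtrees_in_rnodes[of x r]
      by (auto simp: rtrees_of_def alphabet_of_def well_formed_def split: if_splits)
  qed
  moreover have "distinct (alphabet_of s)" for s :: "'a situation" by (simp add: alphabet_of_def well_formed_def)
  ultimately have L: "learn_env ?\<rho>1 (\<lambda>t. sort (alphabet_of (snd t :: 'a situation))) (\<lambda>t. words_of (fst t) (snd t))"
    unfolding learn_env_def using W poly_time_sndI[OF poly_time_sort[OF xs], of VSym] by simp
  have "poly_time input_env (\<lambda>s. enc_list (map (\<lambda>v. v) (rule_values (s :: 'a situation))))"
    unfolding rule_values_def
    by (rule poly_time_map[OF xs]) (intro poly_time_pair a poly_time_learn_dme[OF L])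
  then have rules: "poly_time input_env (\<lambda>s. enc_list (rule_values (s :: 'a situation)))" by simp
  let ?\<rho>r = "\<lambda>t. enc_rtree (fst t) # input_env (snd t)"
  have newr: "poly_time ?\<rho>r (\<lambda>t. enc_rtree (fst t :: 'a rtree))" using ar' by (rule poly_time_fstI)
  have rsr: "poly_time ?\<rho>r (\<lambda>t. enc_list (map enc_rtree (rtrees_of (snd t :: 'a situation))))"
    using rs by (rule poly_time_sndI)
  have "poly_time (\<lambda>t. enc_rtree (fst t) # ?\<rho>r (snd t)) (\<lambda>t. bool_val (label (fst (snd t)) = label (fst t :: 'a rtree)))"
    by (intro poly_time_eq poly_time_label poly_time_fstI poly_time_arity[OF newr]
        poly_time_old_sym[OF poly_time_label[OF newr]])
  from poly_time_ball[OF rs poly_time_ball[OF rsr this]]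
  have "poly_time input_env (\<lambda>s. bool_val (\<forall>r\<in>set (rtrees_of s). \<forall>r'\<in>set (rtrees_of (s :: 'a situation)). label r = label r'))" .
  then show ?thesis unfolding learner_value_def
    by (intro poly_time_if poly_time_pair poly_time_fst rs rules poly_time_nil ar')
qed

text \<open>\<open>run\<close> starts at function 0, so the main expression is put in front and all
  calls are renumbered by one.\<close>

lemma poly_time_run:
  assumes "poly_time \<rho> f"
  obtains P d where "\<And>s. \<exists>k. run P (\<rho> s) (f s) k \<and> k \<le> (env_size (\<rho> s) + 2) ^ d"
proof -
  obtain P e T where e: "\<And>s. eval P (\<rho> s) e (f s) (T s)" and T: "poly_bounded (\<lambda>s. env_size (\<rho> s)) T"
    using assms unfolding poly_time_def computes_def by blast
  obtain d where d: "\<And>s. T s \<le> (env_size (\<rho> s) + 2) ^ d" using T unfolding poly_bounded_def by blast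
  let ?P = "[shift 1 e] @ map (shift 1) P"
  have "run ?P (\<rho> s) (f s) (T s)" for s
    using eval_shift(1)[OF e, of "[shift 1 e]"] by (simp add: run_def)
  then show ?thesis using d by (intro that) blast
qed

lemma poly_time_dms_learner:
  "poly_time_learner (dms_setting :: ('a::linorder, 'a tree, 'a dms) learning_setting) dms_learner"
proof -
  obtain P d where P: "\<And>s :: 'a situation. \<exists>k. run P (input_env s) (learner_value s) k \<and>
      k \<le> (env_size (input_env s) + 2) ^ d"
    using poly_time_run[OF poly_time_learner_value] by blast
  show ?thesis
    unfolding poly_time_learner_def
  \<comment> \<open>The alphabet has size 1 plus 4 per symbol, the sample at most 1 plus 6 per node;
    with the 2 from the bound for \<open>P\<close> this stays below \<open>4 + 6 * m\<close>, where
    \<open>m\<close> is the input size.\<close>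
  proof (intro exI[of _ P] exI[of _ "[:4, 6:] ^ d"] allI impI)
    fix \<Sigma> :: "'a set" and D x y
    assume asm: "finite \<Sigma> \<and> is_sample dms_setting \<Sigma> D \<and> enc_alphabet \<Sigma> x \<and>
      enc_sample (example_enc dms_setting) D y"
    then have fin: "finite \<Sigma>" and D: "finite D" "D \<noteq> {}" "D \<subseteq> trees \<Sigma>"
      by (auto simp: is_sample_def dms_setting_def)
    obtain xs where xs: "distinct xs" "set xs = \<Sigma>" "x = enc_syms xs"
      using asm by (auto simp: enc_alphabet_def)
    obtain es vs where es: "distinct es" "set es = D" "list_all2 enc_tree es vs" "y = enc_list vs"
      using asm by (auto simp: enc_sample_def dms_setting_def)
    \<comment> \<open>Whichever order of the children an encoding uses, it is the encoding of an
      inductive tree with the same data.\<close>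
    have "\<exists>rs. vs = map enc_rtree rs \<and> list_all2 (\<lambda>t r. rtree_data r = tree_data t \<and>
        label r = tree_lab t (tree_root t) \<and> length (rnodes r) = tree_size t) es rs"
      if "list_all2 enc_tree es vs" "set es \<subseteq> trees \<Sigma>" for es vs
      using that
    proof (induction rule: list_all2_induct)
      case (Cons t es v vs)
      then obtain rs where rs: "vs = map enc_rtree rs" "list_all2 (\<lambda>t r. rtree_data r = tree_data t \<and>
        label r = tree_lab t (tree_root t) \<and> length (rnodes r) = tree_size t) es rs" by auto
      have "t \<in> trees \<Sigma>" using Cons.prems by simp
      then obtain r where "v = enc_rtree r" "rtree_data r = tree_data t"
          "label r = tree_lab t (tree_root t)" "length (rnodes r) = tree_size t"
        using enc_tree_rtree \<open>enc_tree t v\<close> by blast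
      then show ?case using rs by (intro exI[of _ "r # rs"]) simp
    qed simp
    then obtain rs where rs: "vs = map enc_rtree rs" and rel: "list_all2 (\<lambda>t r. rtree_data r = tree_data t \<and>
        label r = tree_lab t (tree_root t) \<and> length (rnodes r) = tree_size t) es rs"
      using es D(3) by blast
    define s where "s = (xs, rs)"
    have data: "rtree_data ` set rs = tree_data ` D" "label ` set rs = root_labels D"
      using rel unfolding es(2)[symmetric] root_labels_def
      by (induction rule: list_all2_induct) auto
    have lab: "label ` set (rnodes r) \<subseteq> \<Sigma>" if r: "r \<in> set rs" for r
    proof -
      have "rtree_data r \<in> tree_data ` D" unfolding data(1)[symmetric] using r by (rule imageI)
      then obtain t where t: "t \<in> D" "rtree_data r = tree_data t" by blast
      then have "t \<in> trees \<Sigma>" using D(3) by blast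
      then have "fst ` tree_data t \<subseteq> \<Sigma>" using tree_data_alphabet(1)[of t \<Sigma>] by auto
      then show ?thesis using t(2) by (simp add: fst_rtree_data[symmetric])
    qed
    then have "well_formed s" using xs by (simp add: well_formed_def s_def)
    then have s: "alphabet_of s = xs" "rtrees_of s = rs" by (simp_all add: alphabet_of_def rtrees_of_def s_def)
    have env: "input_env s = [x, y]" by (simp add: input_env_def s xs es rs)
    obtain k where k: "run P [x, y] (learner_value s) k" "k \<le> (env_size [x, y] + 2) ^ d"
      using P[of s] unfolding env by blast
    have rs_ne: "rs \<noteq> []" using rel es(2) D(2) by auto
    have "vsize x = 1 + 4 * card \<Sigma>"
    proof -
      have "vsize (enc_syms xs) = 1 + 4 * length xs" by (induction xs) auto
      then show ?thesis using xs distinct_card by metis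
    qed
    moreover have "vsize y \<le> 1 + 6 * (\<Sum>t\<in>D. tree_size t)"
    proof -
      have "(\<Sum>r\<leftarrow>rs. 1 + vsize (enc_rtree r)) \<le> (\<Sum>t\<leftarrow>es. 6 * tree_size t)"
        using rel
      proof (induction rule: list_all2_induct)
        case (Cons t es r rs)
        then show ?case using length_rnodes[of r] by simp
      qed simp
      also have "\<dots> = 6 * (\<Sum>t\<in>D. tree_size t)"
        using es(1,2) by (simp add: sum_list_distinct_conv_sum_set sum_distrib_left)
      finally show ?thesis by (simp add: es(4) rs vsize_enc_list o_def)
    qed
    ultimately have "env_size [x, y] + 2 \<le> 4 + 6 * (card \<Sigma> + sample_size dms_setting D)"
      by (simp add: sample_size_def dms_setting_def)
    then have "(env_size [x, y] + 2) ^ d \<le> (4 + 6 * (card \<Sigma> + sample_size dms_setting D)) ^ d"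
      by (rule power_mono) simp
    also have "\<dots> = poly ([:4, 6:] ^ d) (card \<Sigma> + sample_size dms_setting D)" by (simp add: mult.commute)
    finally have bound: "k \<le> poly ([:4, 6:] ^ d) (card \<Sigma> + sample_size dms_setting D)" using k(2) by simp
    have words: "bag (words_of a s) = sample_words D a" for a
    proof -
      have "w \<in> bag (words_of a s) \<longleftrightarrow> w \<in> sample_words D a" for w
      proof -
        have "w \<in> bag (words_of a s) \<longleftrightarrow> (\<exists>r\<in>set rs. (a, w) \<in> rtree_data r)"
          by (auto simp: words_of_def s rtree_data_def image_iff)
        also have "\<dots> \<longleftrightarrow> (\<exists>A\<in>rtree_data ` set rs. (a, w) \<in> A)" by simp
        also have "\<dots> \<longleftrightarrow> w \<in> sample_words D a" unfolding data(1) by (simp add: sample_words_def)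
        finally show ?thesis .
      qed
      then show ?thesis by blast
    qed
    have "enc_result (enc_dms \<Sigma>) (dms_learner \<Sigma> D) (learner_value s)"
    proof (cases "is_singleton (root_labels D)")
      case True
      then obtain a0 where a0: "root_labels D = {a0}" by (auto simp: is_singleton_def)
      define c where "c = \<lparr>dms_root = a0, dms_rule = \<lambda>a\<in>\<Sigma>. learn_dme (sorted_list_of_set \<Sigma>) (sample_words D a)\<rparr>"
      have c: "dms_learner \<Sigma> D = Some c" using True a0 by (simp add: dms_learner_def c_def)
      have lab0: "label r = a0" if "r \<in> set rs" for r using that data(2) a0 by blast
      obtain r0 rs' where r0: "rs = r0 # rs'" using rs_ne by (cases rs) auto
      have root: "val_fst (val_fst (enc_list (map enc_rtree rs))) = VSym a0"
        using lab0[of r0] by (cases r0) (simp add: r0)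
      have "sort xs = sorted_list_of_set \<Sigma>" using xs by (simp add: sorted_list_of_set.idem_if_sorted_distinct
            sorted_list_of_set_sort_remdups distinct_remdups_id flip: xs(2))
      then have rules: "rule_values s = map (\<lambda>a. VPair (VSym a) (enc_dme (dms_rule c a))) xs"
        using xs(2) by (auto simp: rule_values_def s words c_def)
      have "learner_value s = VPair (VPair (VSym a0) (enc_list (rule_values s))) VNil"
        using lab0 by (simp add: learner_value_def s root)
      moreover have "enc_dms \<Sigma> c (VPair (VSym a0) (enc_list (rule_values s)))"
        unfolding enc_dms_def using xs(1,2) rules by (intro exI[of _ xs]) (simp add: c_def)
      ultimately show ?thesis by (simp add: c)
    next
      case False
      have "\<not> (\<forall>r\<in>set rs. \<forall>r'\<in>set rs. label r = label r')"
      proof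
        assume eq: "\<forall>r\<in>set rs. \<forall>r'\<in>set rs. label r = label r'"
        then have "label ` set rs = {label (hd rs)}" using rs_ne hd_in_set[OF rs_ne] by blast
        then show False using False data(2) by simp
      qed
      then show ?thesis using False by (simp add: dms_learner_def learner_value_def s)
    qed
    then show "\<exists>v k. run P [x, y] v k \<and> k \<le> poly ([:4, 6:] ^ d) (card \<Sigma> + sample_size dms_setting D) \<and>
        enc_result (concept_enc dms_setting \<Sigma>) (dms_learner \<Sigma> D) v"
      using k(1) bound by (auto simp: dms_setting_def)
  qed
qed

theorem theorem4p4:
  "learnable_in_poly_time_and_data (dms_setting :: ('a::linorder, 'a tree, 'a dms) learning_setting)"
  unfolding learnable_in_poly_time_and_data_def
  using poly_time_dms_learner sound_dms_learner complete_dms_learner by blast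

end
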